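(* Threshold Contraction restricted to split graphs can be solved in time $2^{O(k^2)}n^{O(1)}$, where $n$ is the number of vertices of the input. Here the problem is: given a split graph $G$ and a positive integer $k$, decide whether a threshold graph can be obtained from $G$ by contracting at most $k$ edges.
   Context: All graphs are finite, simple and undirected. A graph is a split graph if its vertex set can be partitioned into a clique and an independent set. A graph $G$ is a threshold graph if there exist non-negative reals $r(v)$, $v\in V(G)$, and a real $t$ such that for every $X\subseteq V(G)$, $X$ is independent iff $\sum_{v\in X}r(v)\le t$; equivalently, $G$ contains no induced $2K_2$, $C_4$ or $P_4$. Contracting an edge $uv$ removes $u$ and $v$ and replaces them by a single new vertex adjacent to exactly those vertices that were adjacent to at least one of $u$ or $v$. *)

theory Defs
  imports "HOL-Library.Landau_Symbols" "HOL-Library.Ramsey"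
begin

section \<open>Graphs\<close>

text \<open>
  A graph is a pair \<open>(V, E)\<close> whose edges are two-element sets of vertices. The predicates
  \<^const>\<open>clique\<close> and \<^const>\<open>indep\<close> are those of \<open>HOL-Library.Ramsey\<close>.
\<close>

type_synonym 'a graph = "'a set \<times> 'a set set"

definition simple_graph :: "'a graph \<Rightarrow> bool" where
  "simple_graph = (\<lambda>(V, E). finite V \<and> (\<forall>e\<in>E. e \<subseteq> V \<and> card e = 2))"

definition split_graph :: "'a graph \<Rightarrow> bool" where
  "split_graph = (\<lambda>(V, E). \<exists>C I. C \<union> I = V \<and> C \<inter> I = {} \<and> clique C E \<and> indep I E)"

definition threshold_graph :: "'a graph \<Rightarrow> bool" where
  "threshold_graph = (\<lambda>(V, E). \<exists>(r :: 'a \<Rightarrow> real) (t :: real).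
     (\<forall>v\<in>V. 0 \<le> r v) \<and> (\<forall>X. X \<subseteq> V \<longrightarrow> (indep X E \<longleftrightarrow> (\<Sum>v\<in>X. r v) \<le> t)))"

text \<open>
  One edge contraction. The name \<open>w\<close> of the new vertex is arbitrary apart from being fresh, so the
  result is determined up to isomorphism; over an infinite vertex type such as \<^typ>\<open>nat\<close> a fresh
  name always exists.
\<close>

inductive contract_edge :: "'a graph \<Rightarrow> 'a graph \<Rightarrow> bool" where
  "\<lbrakk> {u, v} \<in> E; u \<noteq> v; w \<notin> V \<rbrakk> \<Longrightarrow>
   contract_edge (V, E)
     (insert w (V - {u, v}),
      {e \<in> E. u \<notin> e \<and> v \<notin> e} \<union>
      {{w, x} | x. x \<in> V - {u, v} \<and> ({u, x} \<in> E \<or> {v, x} \<in> E)})"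

definition threshold_contractible :: "'a graph \<Rightarrow> nat \<Rightarrow> bool" where
  "threshold_contractible G k \<longleftrightarrow>
     (\<exists>j\<le>k. \<exists>H. (contract_edge ^^ j) G H \<and> threshold_graph H)"

lemma simple_graph_contract_edge:
  assumes "contract_edge G H" "simple_graph G"
  shows "simple_graph H"
  using assms
proof cases
  case (1 u v E w V)
  have "card {w, x} = 2" if "x \<in> V" for x
    using 1 that by (auto simp: card_2_iff)
  then show ?thesis
    using 1 assms(2) by (auto simp: simple_graph_def)
qed


section \<open>Random access machines\<close>

text \<open>
  Algorithms are structured programs for a random access machine. The memory consists of named
  arrays of natural numbers; a program mentions only finitely many of them. The only arithmetic
  operations are addition and truncated subtraction, so that in \<open>t\<close> steps the
  bit length of the stored numbers exceeds that of the initial ones and of the constants of the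
  program by at most \<open>t\<close>. This makes the unit-cost
  measure used here polynomially related to logarithmic cost and to Turing machine time; this would
  fail with unit-cost multiplication.
\<close>

type_synonym arr_name = string

type_synonym memory = "arr_name \<Rightarrow> nat \<Rightarrow> nat"

datatype aexp =
    Const nat
  | Cell arr_name aexp
  | Add aexp aexp
  | Sub aexp aexp

primrec aval :: "aexp \<Rightarrow> memory \<Rightarrow> nat" where
  "aval (Const c) s = c"
| "aval (Cell x a) s = s x (aval a s)"
| "aval (Add a b) s = aval a s + aval b s"
| "aval (Sub a b) s = aval a s - aval b s"

primrec acost :: "aexp \<Rightarrow> nat" where
  "acost (Const c) = 1"
| "acost (Cell x a) = 1 + acost a"
| "acost (Add a b) = 1 + acost a + acost b"
| "acost (Sub a b) = 1 + acost a + acost b"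

datatype com =
    Skip
  | Assign arr_name aexp aexp
  | Seq com com
  | Cond aexp com com
  | While aexp com

text \<open>
  \<open>run c s t s'\<close>: started in memory \<open>s\<close>, the program \<open>c\<close> halts after \<open>t\<close> steps in memory \<open>s'\<close>.
  The tests of \<open>Cond\<close> and \<open>While\<close> succeed when their value is nonzero.
\<close>

inductive run :: "com \<Rightarrow> memory \<Rightarrow> nat \<Rightarrow> memory \<Rightarrow> bool" where
  run_Skip: "run Skip s 1 s"
| run_Assign:
    "run (Assign x i a) s (1 + acost i + acost a) (s(x := (s x)(aval i s := aval a s)))"
| run_Seq: "\<lbrakk> run c s t s'; run d s' t' s'' \<rbrakk> \<Longrightarrow> run (Seq c d) s (t + t') s''"
| run_Cond_true:
    "\<lbrakk> aval b s \<noteq> 0; run c s t s' \<rbrakk> \<Longrightarrow> run (Cond b c d) s (1 + acost b + t) s'"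
| run_Cond_false:
    "\<lbrakk> aval b s = 0; run d s t s' \<rbrakk> \<Longrightarrow> run (Cond b c d) s (1 + acost b + t) s'"
| run_While_true:
    "\<lbrakk> aval b s \<noteq> 0; run c s t s'; run (While b c) s' t' s'' \<rbrakk> \<Longrightarrow>
     run (While b c) s (1 + acost b + t + t') s''"
| run_While_false: "aval b s = 0 \<Longrightarrow> run (While b c) s (1 + acost b) s"

inductive_cases run_SkipE: "run Skip s t s'"
inductive_cases run_AssignE: "run (Assign x i a) s t s'"
inductive_cases run_SeqE: "run (Seq c d) s t s'"
inductive_cases run_CondE: "run (Cond b c d) s t s'"
inductive_cases run_WhileE: "run (While b c) s t s'"

lemma run_deterministic:
  assumes "run c s t s'" "run c s u s''"
  shows "t = u \<and> s' = s''"
  using assms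
proof (induction arbitrary: u s'' rule: run.induct)
  case (run_Skip s)
  then show ?case by (auto elim: run_SkipE)
next
  case (run_Assign x i a s)
  then show ?case by (auto elim: run_AssignE)
next
  case (run_Seq c s t s' d t' r)
  from run_Seq.prems obtain t1 s1 t2 where
    "run c s t1 s1" "run d s1 t2 s''" "u = t1 + t2"
    by (rule run_SeqE)
  with run_Seq.IH show ?case by metis
next
  case (run_Cond_true b s c t s' d)
  from run_Cond_true.prems run_Cond_true.hyps(1) obtain t1 where
    "run c s t1 s''" "u = 1 + acost b + t1"
    by (auto elim: run_CondE)
  with run_Cond_true.IH show ?case by metis
next
  case (run_Cond_false b s d t s' c)
  from run_Cond_false.prems run_Cond_false.hyps(1) obtain t1 where
    "run d s t1 s''" "u = 1 + acost b + t1"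
    by (auto elim: run_CondE)
  with run_Cond_false.IH show ?case by metis
next
  case (run_While_true b s c t s' t' r)
  from run_While_true.prems obtain t1 s1 t2 where
    "run c s t1 s1" "run (While b c) s1 t2 s''" "u = 1 + acost b + t1 + t2"
    by (rule run_WhileE) (use run_While_true.hyps(1) in simp_all)
  with run_While_true.IH show ?case by metis
next
  case (run_While_false b s c)
  from run_While_false.prems run_While_false.hyps show ?case
    by (auto elim: run_WhileE)
qed


section \<open>Instances and their encoding\<close>

text \<open>
  An instance is a graph with vertex set \<open>{0..<n}\<close> together with a number \<open>k\<close>. The machine receives
  \<open>n\<close>, \<open>k\<close> and the adjacency matrix in row-major order; all other cells are initially zero.
\<close>

definition encode :: "nat \<Rightarrow> nat set set \<Rightarrow> nat \<Rightarrow> memory" where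
  "encode n E k = (\<lambda>_ _. 0)
     (''n'' := (\<lambda>_. 0)(0 := n),
      ''k'' := (\<lambda>_. 0)(0 := k),
      ''adj'' := (\<lambda>p. of_bool (\<exists>i<n. \<exists>j<n. p = i * n + j \<and> {i, j} \<in> E)))"

definition answer :: "memory \<Rightarrow> nat" where
  "answer s = s ''answer'' 0"

end

theory Submission
  imports Defs
begin

text \<open>
  A split graph is a threshold graph iff it has no induced path on four vertices, that is, iff the
  neighbourhoods of its clique vertices in the independent part form a chain. Let \<open>T\<close> consist of the
  vertices of greedily chosen disjoint induced paths. Every solution touches a vertex of each of these
  paths, but \<open>k\<close> contractions touch at most \<open>2 * k\<close> vertices. So if \<open>k\<close> contractions suffice, the choice
  ends after at most \<open>2 * k\<close> paths, and the graph without \<open>T\<close> is a threshold graph.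
  Call two other vertices of the same type if they have the same neighbours in \<open>T\<close> (and are both
  simplicial or both not); there are \<open>2 ^ O(k)\<close> types, and the neighbourhoods of each type form a
  chain. An exchange argument shows that only vertices close to the ends of these chains, or close
  below an independent vertex that is itself close to an end, need to be merged. This leaves
  \<open>2 ^ O(k)\<close> candidates. The algorithm runs through all \<open>2 ^ O(k\<^sup>2)\<close> sequences of \<open>k\<close> contractions, each
  of which is either between two candidates or along an end edge of the induced path found by a fixed
  search.
\<close>

section \<open>Time-bounded execution\<close>

text \<open>The vertices to be deleted from the independent part need not be candidates, so a second
  source of choices is required. Merges inside the clique are therefore done first. Once every class
  is a singleton, the chain condition forces each remaining induced path to have a deleted end, and
  the fixed search names a path with only two ends to choose from.

  The machine is not given the partition. Simpliciality replaces it in the types: independent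
  vertices are simplicial, and a simplicial clique vertex never has to be merged. A test for an edge
  before each contraction makes every sequence sound, so the set \<open>T\<close> and the candidates
  need their guarantees only when a solution exists.

  The recurring bound \<open>2 * k\<close> limits touched and deleted vertices together: a merged
  class of \<open>s\<close> vertices costs \<open>s - 1\<close> contractions, at least half its
  size. Among more than \<open>2 * k\<close> vertices one is hence left alone by the solution, and
  the exchange argument works with such vertices.\<close>

text \<open>
  The parameter \<open>S \<ge> 4\<close> exceeds every loop bound. Budgets are powers of \<open>S\<close>, so that the constant
  costs of a loop body are absorbed by increasing the exponent and no running time has to be
  computed explicitly.
\<close>

definition ok :: "nat \<Rightarrow> nat \<Rightarrow> com \<Rightarrow> memory \<Rightarrow> (memory \<Rightarrow> bool) \<Rightarrow> bool" where
  "ok S j c s Q \<longleftrightarrow> (\<exists>t s'. run c s t s' \<and> t \<le> S ^ j \<and> Q s')"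

primrec reads :: "aexp \<Rightarrow> arr_name set" where
  "reads (Const c) = {}"
| "reads (Cell x a) = insert x (reads a)"
| "reads (Add a b) = reads a \<union> reads b"
| "reads (Sub a b) = reads a \<union> reads b"

primrec writes :: "com \<Rightarrow> arr_name set" where
  "writes Skip = {}"
| "writes (Assign x i a) = {x}"
| "writes (Seq c d) = writes c \<union> writes d"
| "writes (Cond b c d) = writes c \<union> writes d"
| "writes (While b c) = writes c"

definition agree :: "arr_name set \<Rightarrow> memory \<Rightarrow> memory \<Rightarrow> bool" where
  "agree X s s' \<longleftrightarrow> (\<forall>x. x \<notin> X \<longrightarrow> s' x = s x)"

lemma agree_refl [simp]: "agree X s s"
  by (simp add: agree_def)

lemma agree_trans: "agree X s s' \<Longrightarrow> agree Y s' s'' \<Longrightarrow> X \<union> Y \<subseteq> Z \<Longrightarrow> agree Z s s''"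
  by (metis agree_def UnCI subset_iff)

lemma aval_agree: "agree X s s' \<Longrightarrow> reads a \<inter> X = {} \<Longrightarrow> aval a s' = aval a s"
  by (induction a) (auto simp: agree_def Int_Un_distrib2)

lemma run_agree: "run c s t s' \<Longrightarrow> agree (writes c) s s'"
  by (induction rule: run.induct) (auto simp: agree_def)

lemma ok_conseq:
  assumes "ok S i c s P" "i \<le> j" "0 < S"
    and "\<And>s'. P s' \<Longrightarrow> agree (writes c) s s' \<Longrightarrow> Q s'"
  shows "ok S j c s Q"
proof -
  obtain t s' where *: "run c s t s'" "t \<le> S ^ i" "P s'" using assms(1) by (auto simp: ok_def)
  moreover have "S ^ i \<le> S ^ j" using assms(2,3) by (intro power_increasing) auto
  ultimately show ?thesis
    unfolding ok_def using assms(4)[OF *(3) run_agree[OF *(1)]] le_trans by blast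
qed

text \<open>This makes 5 the least useful exponent: \<open>4 ^ 5 = 1024\<close> pays for any single
  assignment or test whose expressions cost at most 1000.\<close>

lemma power4_5:
  assumes "(4::nat) \<le> S" "5 \<le> j"
  shows "1024 \<le> S ^ j"
proof -
  have "1024 = (4::nat) ^ 5" by simp
  also have "\<dots> \<le> S ^ 5" using assms by (intro power_mono) auto
  also have "\<dots> \<le> S ^ j" using assms by (intro power_increasing) auto
  finally show ?thesis .
qed

lemma ok_Skip:
  assumes "4 \<le> S" "5 \<le> j" "Q s"
  shows "ok S j Skip s Q"
  unfolding ok_def using power4_5[of S j] assms run_Skip[of s] by fastforce

lemma ok_Assign:
  assumes "4 \<le> S" "5 \<le> j" "acost i + acost a \<le> 1000"
    and "Q (s(x := (s x)(aval i s := aval a s)))"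
  shows "ok S j (Assign x i a) s Q"
proof -
  have "1 + acost i + acost a \<le> S ^ j" using power4_5[of S j] assms by linarith
  then show ?thesis unfolding ok_def using assms(4) run_Assign by blast
qed

text \<open>The postcondition of the first half is the claim about the second half, so straight-line
  code needs no intermediate assertions.\<close>

lemma ok_Seq:
  assumes "4 \<le> S" "0 < j" "ok S (j - 1) c s (\<lambda>s'. ok S (j - 1) d s' Q)"
  shows "ok S j (Seq c d) s Q"
proof -
  obtain t s' t' s'' where *: "run c s t s'" "t \<le> S ^ (j-1)" "run d s' t' s''" "t' \<le> S ^ (j-1)"
      "Q s''"
    using assms(3) by (auto simp: ok_def)
  have "S ^ j = S * S ^ (j - 1)" using assms(2) by (cases j) auto
  then have "t + t' \<le> S ^ j"
    using * mult_le_mono1[of 2 S "S ^ (j-1)"] assms by linarith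
  then show ?thesis using run_Seq[OF *(1,3)] * unfolding ok_def by blast
qed

lemma ok_Cond:
  assumes "4 \<le> S" "6 \<le> j" "acost b \<le> 1000"
    and "aval b s \<noteq> 0 \<Longrightarrow> ok S (j - 1) c s Q"
    and "aval b s = 0 \<Longrightarrow> ok S (j - 1) d s Q"
  shows "ok S j (Cond b c d) s Q"
proof -
  have a: "S ^ j = S * S ^ (j - 1)" using assms(2) by (cases j) auto
  have "1024 \<le> S ^ (j - 1)" using assms by (intro power4_5) auto
  then have le: "1 + acost b + t \<le> S ^ j" if "t \<le> S ^ (j - 1)" for t
    using that mult_le_mono1[of 2 S "S ^ (j-1)"] assms a by linarith
  show ?thesis
  proof (cases "aval b s = 0")
    case True
    then obtain t s' where "run d s t s'" "t \<le> S ^ (j-1)" "Q s'"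
      using assms(5) by (auto simp: ok_def)
    then show ?thesis unfolding ok_def using run_Cond_false[of b s d t s' c] True le by blast
  next
    case False
    then obtain t s' where "run c s t s'" "t \<le> S ^ (j-1)" "Q s'"
      using assms(4) by (auto simp: ok_def)
    then show ?thesis unfolding ok_def using run_Cond_true[of b s c t s' d] False le by blast
  qed
qed

text \<open>Indexing the invariant by the number of finished rounds yields termination, running time
  and correctness at once. Unlike in the counting loops below, \<open>N\<close> need not be smaller
  than the base of the time budgets, as required for the loop over all certificates.\<close>

lemma run_While_count:
  assumes "Inv i s" "i \<le> N"
    and "\<And>i s. Inv i s \<Longrightarrow> i < N \<Longrightarrow> aval b s \<noteq> 0 \<and> (\<exists>t s'. run c s t s' \<and> t \<le> T \<and> Inv (Suc i) s')"
    and "\<And>s. Inv N s \<Longrightarrow> aval b s = 0"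
  shows "\<exists>t s'. run (While b c) s t s' \<and> t \<le> (N - i) * (1 + acost b + T) + (1 + acost b) \<and> Inv N s'"
  using assms(1,2)
proof (induction "N - i" arbitrary: i s)
  case 0
  then have "Inv N s" by simp
  then show ?case using assms(4) run_While_false[of b s c] by fastforce
next
  case (Suc d)
  have "i < N" using Suc by simp
  with assms(3)[OF Suc(3)] obtain t s' where *: "aval b s \<noteq> 0" "run c s t s'" "t \<le> T" "Inv (Suc i) s'"
    by blast
  have "\<exists>t s''. run (While b c) s' t s'' \<and> t \<le> (N - Suc i) * (1 + acost b + T) + (1 + acost b) \<and>
      Inv N s''"
    using Suc *(4) by (intro Suc(1)) auto
  then obtain t' s'' where w: "run (While b c) s' t' s''"
      "t' \<le> (N - Suc i) * (1 + acost b + T) + (1 + acost b)" "Inv N s''"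
    by blast
  have "N - i = Suc (N - Suc i)" using \<open>i < N\<close> by simp
  then have "1 + acost b + t + t' \<le> (N - i) * (1 + acost b + T) + (1 + acost b)"
    using * w by simp
  then show ?case using run_While_true[OF *(1,2) w(1)] w(3) by blast
qed

section \<open>Counting loops, sums and array filling\<close>

abbreviation Var :: "arr_name \<Rightarrow> aexp" where
  "Var x \<equiv> Cell x (Const 0)"

abbreviation SetVar :: "arr_name \<Rightarrow> aexp \<Rightarrow> com" where
  "SetVar x a \<equiv> Assign x (Const 0) a"

definition For :: "arr_name \<Rightarrow> aexp \<Rightarrow> com \<Rightarrow> com" where
  "For x e c = Seq (SetVar x (Const 0)) (While (Sub e (Var x)) (Seq c (SetVar x (Add (Var x) (Const 1)))))"

lemma writes_For [simp]: "writes (For x e c) = insert x (writes c)"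
  by (auto simp: For_def)

text \<open>Two exponents are spent: one factor \<open>S\<close> pays for the fewer than
  \<open>S\<close> rounds and the final test, the other for the constant overhead of a round. As
  \<open>e\<close> reads nothing that the loop writes, it has the same value at every test.\<close>

lemma ok_For:
  assumes S: "4 \<le> S" "7 \<le> j" "acost e \<le> 100" "N < S"
    and e: "reads e \<inter> insert x (writes c) = {}" "aval e s = N"
    and x: "x \<notin> writes c" "\<And>i s' v. Inv i s' \<Longrightarrow> Inv i (s'(x := v))"
    and init: "Inv 0 s"
    and step: "\<And>i s'. i < N \<Longrightarrow> Inv i s' \<Longrightarrow> s' x 0 = i \<Longrightarrow> agree (insert x (writes c)) s s' \<Longrightarrow>
      ok S (j - 2) c s' (Inv (Suc i))"
    and fin: "\<And>s'. Inv N s' \<Longrightarrow> agree (insert x (writes c)) s s' \<Longrightarrow> Q s'"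
  shows "ok S j (For x e c) s Q"
proof -
  define J where "J i s' \<longleftrightarrow> Inv i s' \<and> s' x 0 = i \<and> agree (insert x (writes c)) s s'" for i s'
  define s0 where "s0 = s(x := (s x)(0 := 0))"
  define b where "b = Sub e (Var x)"
  have eN: "aval e s' = N" if "agree (insert x (writes c)) s s'" for s'
    using aval_agree[OF that e(1)] e(2) by simp
  have J0: "J 0 s0"
    using x(2) init by (auto simp: J_def s0_def agree_def)
  have cb: "acost b \<le> 103" using S by (simp add: b_def)
  define d where "d = Seq c (SetVar x (Add (Var x) (Const 1)))"
  have "\<exists>t s'. run (While b d) s0 t s' \<and>
      t \<le> (N - 0) * (1 + acost b + (S ^ (j - 2) + 10)) + (1 + acost b) \<and> J N s'"
  proof (rule run_While_count[where Inv = J])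
    show "aval b s' = 0" if "J N s'" for s'
      using that eN by (simp add: J_def b_def)
  next
    fix i s' assume J: "J i s'" and i: "i < N"
    have ag: "agree (insert x (writes c)) s s'" using J by (simp add: J_def)
    have nz: "aval b s' \<noteq> 0"
      using J i eN[OF ag] by (simp add: J_def b_def)
    obtain t s'' where r: "run c s' t s''" "t \<le> S ^ (j-2)" "Inv (Suc i) s''"
      using step[OF i _ _ ag] J by (auto simp: J_def ok_def)
    have a2: "agree (writes c) s' s''" using run_agree r(1) by blast
    have xi: "s'' x 0 = i" using a2 x(1) J by (simp add: agree_def J_def)
    have "run d s' (t + (1 + 1 + (1 + (1 + 1) + 1))) (s''(x := (s'' x)(0 := Suc i)))"
      unfolding d_def
      using run_Seq[OF r(1) run_Assign[of x "Const 0" "Add (Var x) (Const 1)" s'']] xi by simp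
    moreover have "J (Suc i) (s''(x := (s'' x)(0 := Suc i)))"
      using x r(3) a2 ag by (auto simp: J_def agree_def)
    moreover have "t + (1 + 1 + (1 + (1 + 1) + 1)) \<le> S ^ (j - 2) + 10" using r(2) by simp
    ultimately show "aval b s' \<noteq> 0 \<and> (\<exists>t s''. run d s' t s'' \<and> t \<le> S ^ (j - 2) + 10 \<and> J (Suc i) s'')"
      using nz by blast
  qed (use J0 in auto)
  then obtain t s' where w: "run (While b d) s0 t s'"
      "t \<le> N * (1 + acost b + (S ^ (j - 2) + 10)) + (1 + acost b)" "J N s'"
    by auto
  have r: "run (For x e c) s (1 + 1 + 1 + t) s'"
    unfolding For_def b_def[symmetric] d_def[symmetric]
    using run_Seq[OF run_Assign[of x "Const 0" "Const 0" s] ] w(1) by (simp add: s0_def)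
  have p: "1024 \<le> S ^ (j - 2)" using S by (intro power4_5) auto
  have "1 + 1 + 1 + t \<le> N * (2 * S ^ (j - 2)) + 2 * S ^ (j - 2)"
  proof -
    have "N * (1 + acost b + (S ^ (j - 2) + 10)) \<le> N * (2 * S ^ (j - 2))"
      using p cb by (intro mult_le_mono2) linarith
    then show ?thesis using w(2) p cb by linarith
  qed
  also have "\<dots> = Suc N * (2 * S ^ (j - 2))" by simp
  also have "\<dots> \<le> S * (S * S ^ (j - 2))"
    using S by (intro mult_le_mono) auto
  also have "\<dots> = S ^ j"
  proof -
    have "j = Suc (Suc (j - 2))" using S by simp
    then show ?thesis by (metis power_Suc)
  qed
  finally show ?thesis
    unfolding ok_def using r w(3) fin by (auto simp: J_def)
qed

definition SumUp :: "arr_name \<Rightarrow> arr_name \<Rightarrow> com \<Rightarrow> aexp \<Rightarrow> com" where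
  "SumUp acc x c e = Seq (SetVar acc (Const 0)) (For x (Var ''n'') (Seq c (SetVar acc (Add (Var acc) e))))"

lemma writes_SumUp [simp]: "writes (SumUp acc x c e) = {acc, x} \<union> writes c"
  by (auto simp: SumUp_def)

text \<open>The exponent drops by 4: two for the loop and one for each of the two sequential
  compositions.\<close>

lemma ok_SumUp:
  assumes S: "4 \<le> S" "10 \<le> j" "acost e \<le> 900" "s ''n'' 0 < S"
    and d: "''n'' \<notin> {acc, x} \<union> writes c" "acc \<noteq> x" "x \<notin> writes c" "acc \<notin> writes c"
    and step: "\<And>i s'. i < s ''n'' 0 \<Longrightarrow> s' x 0 = i \<Longrightarrow> agree ({acc, x} \<union> writes c) s s' \<Longrightarrow>
      ok S (j - 4) c s' (\<lambda>s''. aval e s'' = h i)"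
    and fin: "\<And>s'. s' acc 0 = (\<Sum>i<s ''n'' 0. h i) \<Longrightarrow> agree ({acc, x} \<union> writes c) s s' \<Longrightarrow> Q s'"
  shows "ok S j (SumUp acc x c e) s Q"
  unfolding SumUp_def
proof (rule ok_Seq, simp_all add: S del: One_nat_def)
  show "0 < j" using S by simp
  show "ok S (j - 1) (SetVar acc (Const 0)) s
     (\<lambda>s'. ok S (j - 1) (For x (Var ''n'') (Seq c (SetVar acc (Add (Var acc) e)))) s' Q)"
  proof (rule ok_Assign, simp_all add: S del: One_nat_def)
    show "5 \<le> j - 1" using S by simp
    let ?s = "s(acc := (s acc)(0 := 0))"
    show "ok S (j - 1) (For x (Var ''n'') (Seq c (SetVar acc (Add (Var acc) e)))) ?s Q"
    proof (rule ok_For[where N = "s ''n'' 0" and Inv = "\<lambda>i s'. s' acc 0 = (\<Sum>k<i. h k)"])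
      fix i s' assume i: "i < s ''n'' 0" "s' acc 0 = (\<Sum>k<i. h k)" "s' x 0 = i"
        "agree (insert x (writes (Seq c (SetVar acc (Add (Var acc) e))))) ?s s'"
      have ag: "agree ({acc, x} \<union> writes c) s s'" using i(4) by (auto simp: agree_def)
      show "ok S (j - 1 - 2) (Seq c (SetVar acc (Add (Var acc) e))) s' (\<lambda>s'. s' acc 0 = (\<Sum>k<Suc i. h k))"
      proof (rule ok_Seq)
        show "ok S (j - 1 - 2 - 1) c s' (\<lambda>s'. ok S (j - 1 - 2 - 1) (SetVar acc (Add (Var acc) e)) s' (\<lambda>s'. s' acc 0 = (\<Sum>k<Suc i. h k)))"
        proof (rule ok_conseq[OF step[OF i(1,3) ag]])
          fix s'' assume *: "aval e s'' = h i" "agree (writes c) s' s''"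
          have "s'' acc 0 = s' acc 0" using * d by (simp add: agree_def)
          then show "ok S (j - 1 - 2 - 1) (SetVar acc (Add (Var acc) e)) s'' (\<lambda>s'. s' acc 0 = (\<Sum>k<Suc i. h k))"
            using S i * by (intro ok_Assign) auto
        qed (use S in auto)
      qed (use S in auto)
    next
      fix s' assume *: "s' acc 0 = (\<Sum>k<s ''n'' 0. h k)"
          "agree (insert x (writes (Seq c (SetVar acc (Add (Var acc) e))))) ?s s'"
      show "Q s'" by (rule fin) (use * in \<open>auto simp: agree_def\<close>)
    qed (use S d in auto)
  qed
qed

definition Fill :: "arr_name \<Rightarrow> arr_name \<Rightarrow> aexp \<Rightarrow> com \<Rightarrow> aexp \<Rightarrow> com" where
  "Fill arr x ix c e = For x (Var ''n'') (Seq c (Assign arr ix e))"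

lemma writes_Fill [simp]: "writes (Fill arr x ix c e) = {arr, x} \<union> writes c"
  by (auto simp: Fill_def)

text \<open>Injectivity of \<open>g\<close> protects earlier entries from later writes. That cells
  outside the range of \<open>g\<close> are unchanged is what allows a matrix to be filled row by
  row.\<close>

lemma ok_Fill:
  assumes S: "4 \<le> S" "9 \<le> j" "acost e + acost ix \<le> 900" "s ''n'' 0 < S"
    and d: "''n'' \<notin> {arr, x} \<union> writes c" "arr \<noteq> x" "x \<notin> writes c" "arr \<notin> writes c"
    and inj: "inj_on g {..<s ''n'' 0}"
    and step: "\<And>i s'. i < s ''n'' 0 \<Longrightarrow> s' x 0 = i \<Longrightarrow> agree ({arr, x} \<union> writes c) s s' \<Longrightarrow>
      ok S (j - 3) c s' (\<lambda>s''. aval ix s'' = g i \<and> aval e s'' = h i)"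
    and fin: "\<And>s'. (\<And>i. i < s ''n'' 0 \<Longrightarrow> s' arr (g i) = h i) \<Longrightarrow>
      (\<And>p. p \<notin> g ` {..<s ''n'' 0} \<Longrightarrow> s' arr p = s arr p) \<Longrightarrow>
      agree ({arr, x} \<union> writes c) s s' \<Longrightarrow> Q s'"
  shows "ok S j (Fill arr x ix c e) s Q"
  unfolding Fill_def
proof (rule ok_For[where N = "s ''n'' 0" and Inv = "\<lambda>i s'. (\<forall>k<i. s' arr (g k) = h k) \<and>
      (\<forall>p. p \<notin> g ` {..<s ''n'' 0} \<longrightarrow> s' arr p = s arr p)"])
  fix i s' assume i: "i < s ''n'' 0" "(\<forall>k<i. s' arr (g k) = h k) \<and>
      (\<forall>p. p \<notin> g ` {..<s ''n'' 0} \<longrightarrow> s' arr p = s arr p)" "s' x 0 = i"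
      "agree (insert x (writes (Seq c (Assign arr ix e)))) s s'"
  have ag: "agree ({arr, x} \<union> writes c) s s'" using i(4) by (auto simp: agree_def)
  show "ok S (j - 2) (Seq c (Assign arr ix e)) s' (\<lambda>s'. (\<forall>k<Suc i. s' arr (g k) = h k) \<and>
      (\<forall>p. p \<notin> g ` {..<s ''n'' 0} \<longrightarrow> s' arr p = s arr p))"
  proof (rule ok_Seq)
    show "ok S (j - 2 - 1) c s' (\<lambda>s'. ok S (j - 2 - 1) (Assign arr ix e) s' (\<lambda>s'. (\<forall>k<Suc i. s' arr (g k) = h k) \<and>
      (\<forall>p. p \<notin> g ` {..<s ''n'' 0} \<longrightarrow> s' arr p = s arr p)))"
    proof (rule ok_conseq[OF step[OF i(1,3) ag]])
      fix s'' assume *: "aval ix s'' = g i \<and> aval e s'' = h i" "agree (writes c) s' s''"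
      have "s'' arr = s' arr" using * d by (simp add: agree_def)
      moreover have "g k \<noteq> g i" if "k < i" for k
        using inj that i(1) by (auto dest: inj_onD)
      ultimately show "ok S (j - 2 - 1) (Assign arr ix e) s'' (\<lambda>s'. (\<forall>k<Suc i. s' arr (g k) = h k) \<and>
      (\<forall>p. p \<notin> g ` {..<s ''n'' 0} \<longrightarrow> s' arr p = s arr p))"
        using S i * by (intro ok_Assign) (auto simp: less_Suc_eq)
    qed (use S in auto)
  qed (use S in auto)
next
  fix s' assume "(\<forall>k<s ''n'' 0. s' arr (g k) = h k) \<and> (\<forall>p. p \<notin> g ` {..<s ''n'' 0} \<longrightarrow>
      s' arr p = s arr p)"
    "agree (insert x (writes (Seq c (Assign arr ix e)))) s s'"
  then show "Q s'" by (intro fin) (auto simp: agree_def)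
qed (use S d in auto)

text \<open>The machine cannot multiply, so a table \<open>row\<close> of the multiples of
  \<open>n\<close> supplies the row offsets.\<close>

abbreviation Entry :: "arr_name \<Rightarrow> arr_name \<Rightarrow> arr_name \<Rightarrow> aexp" where
  "Entry arr x y \<equiv> Cell arr (Add (Cell ''row'' (Var x)) (Var y))"

definition MFill :: "arr_name \<Rightarrow> arr_name \<Rightarrow> arr_name \<Rightarrow> com \<Rightarrow> aexp \<Rightarrow> com" where
  "MFill arr x y c e = For x (Var ''n'') (Fill arr y (Add (Cell ''row'' (Var x)) (Var y)) c e)"

lemma writes_MFill [simp]: "writes (MFill arr x y c e) = {arr, x, y} \<union> writes c"
  by (auto simp: MFill_def)

lemma matrix_index_eq:
  assumes "(i::nat) < n" "j < n" "i' < n" "j' < n"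
  shows "i * n + j = i' * n + j' \<longleftrightarrow> i = i' \<and> j = j'"
proof
  assume "i * n + j = i' * n + j'"
  then have "(i * n + j) div n = (i' * n + j') div n" "(i * n + j) mod n = (i' * n + j') mod n"
    by simp_all
  then show "i = i' \<and> j = j'" using assms by simp
qed auto

lemma ok_MFill:
  assumes S: "4 \<le> S" "11 \<le> j" "acost e \<le> 800" "s ''n'' 0 < S"
    and d: "{''n'', ''row''} \<inter> ({arr, x, y} \<union> writes c) = {}" "distinct [arr, x, y]"
        "{arr, x, y} \<inter> writes c = {}"
    and row: "\<And>i. i < s ''n'' 0 \<Longrightarrow> s ''row'' i = i * s ''n'' 0"
    and step: "\<And>i k s'. i < s ''n'' 0 \<Longrightarrow> k < s ''n'' 0 \<Longrightarrow> s' x 0 = i \<Longrightarrow> s' y 0 = k \<Longrightarrow>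
       agree ({arr, x, y} \<union> writes c) s s' \<Longrightarrow> ok S (j - 5) c s' (\<lambda>s''. aval e s'' = h i k)"
    and fin: "\<And>s'. (\<And>i k. i < s ''n'' 0 \<Longrightarrow> k < s ''n'' 0 \<Longrightarrow> s' arr (i * s ''n'' 0 + k) = h i k) \<Longrightarrow>
      agree ({arr, x, y} \<union> writes c) s s' \<Longrightarrow> Q s'"
  shows "ok S j (MFill arr x y c e) s Q"
proof -
  define n where "n = s ''n'' 0"
  show ?thesis
    unfolding MFill_def
  proof (rule ok_For[where N = n and Inv = "\<lambda>i s'. \<forall>p<i. \<forall>q<n. s' arr (p * n + q) = h p q"])
    fix i s' assume i: "i < n" "\<forall>p<i. \<forall>q<n. s' arr (p * n + q) = h p q" "s' x 0 = i"
      "agree (insert x (writes (Fill arr y (Add (Cell ''row'' (Var x)) (Var y)) c e))) s s'"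
    have ag: "agree ({arr, x, y} \<union> writes c) s s'" using i(4) by (auto simp: agree_def)
    have n': "s' ''n'' 0 = n" "s' ''row'' = s ''row''" using ag d by (auto simp: agree_def n_def)
    show "ok S (j - 2) (Fill arr y (Add (Cell ''row'' (Var x)) (Var y)) c e) s'
        (\<lambda>s'. \<forall>p<Suc i. \<forall>q<n. s' arr (p * n + q) = h p q)"
    proof (rule ok_Fill[where g = "\<lambda>k. i * n + k" and h = "h i"])
      fix k s'' assume k: "k < s' ''n'' 0" "s'' y 0 = k" "agree ({arr, y} \<union> writes c) s' s''"
      have x'': "s'' x 0 = i" using k i d by (auto simp: agree_def)
      have ag': "agree ({arr, x, y} \<union> writes c) s s''" using k ag by (auto simp: agree_def)
      have n'': "s'' ''n'' 0 = n" "s'' ''row'' = s ''row''" using ag' d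
          by (auto simp: agree_def n_def)
      show "ok S (j - 2 - 3) c s'' (\<lambda>s''. aval (Add (Cell ''row'' (Var x)) (Var y)) s'' = i * n + k \<and> aval e s'' = h i k)"
      proof (rule ok_conseq[OF step[OF _ _ x'' k(2) ag']])
        fix t assume t: "aval e t = h i k" "agree (writes c) s'' t"
        have "t x = s'' x" "t y = s'' y" "t ''row'' = s ''row''"
          using t(2) d n'' by (auto simp: agree_def)
        then show "aval (Add (Cell ''row'' (Var x)) (Var y)) t = i * n + k \<and> aval e t = h i k"
          using t row[of i] i(1) x'' k by (simp add: n_def)
      qed (use S i k n' in \<open>auto simp: n_def\<close>)
    next
      fix t assume t: "\<And>k. k < s' ''n'' 0 \<Longrightarrow> t arr (i * n + k) = h i k"
        "\<And>p. p \<notin> (\<lambda>k. i * n + k) ` {..<s' ''n'' 0} \<Longrightarrow> t arr p = s' arr p"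
      show "\<forall>p<Suc i. \<forall>q<n. t arr (p * n + q) = h p q"
      proof (intro allI impI)
        fix p q assume pq: "p < Suc i" "q < n"
        show "t arr (p * n + q) = h p q"
        proof (cases "p = i")
          case True
          then show ?thesis using t(1) pq n' by simp
        next
          case False
          then have "p * n + q \<notin> (\<lambda>k. i * n + k) ` {..<s' ''n'' 0}"
            using matrix_index_eq[of p n q i] pq i(1) n' by auto
          then show ?thesis using t(2) i(2) False pq by simp
        qed
      qed
    qed (use S d n' in \<open>auto simp: n_def inj_on_def\<close>)
  next
    fix s' assume "\<forall>p<n. \<forall>q<n. s' arr (p * n + q) = h p q"
      "agree (insert x (writes (Fill arr y (Add (Cell ''row'' (Var x)) (Var y)) c e))) s s'"
    then show "Q s'" by (intro fin) (auto simp: agree_def n_def)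
  qed (use S d in \<open>auto simp: n_def\<close>)
qed

section \<open>Contractions of split graphs\<close>

type_synonym rel2 = "nat \<Rightarrow> nat \<Rightarrow> bool"

text \<open>
  In \<open>splits n C R\<close> a contracted vertex stays in \<open>{..<n}\<close> as an isolated vertex outside \<open>C\<close>, so the
  vertex set never changes. In \<open>p4\<close> the path is \<open>b - a - c - d\<close>, with \<open>a\<close> and \<open>c\<close> in the clique.
\<close>

definition splits :: "nat \<Rightarrow> nat set \<Rightarrow> rel2 \<Rightarrow> bool" where
  "splits n C R \<longleftrightarrow> C \<subseteq> {..<n} \<and> symp R \<and> (\<forall>x y. R x y \<longrightarrow> x < n \<and> y < n \<and> x \<noteq> y) \<and>
     (\<forall>x\<in>C. \<forall>y\<in>C. x \<noteq> y \<longrightarrow> R x y) \<and> (\<forall>x y. x \<notin> C \<longrightarrow> y \<notin> C \<longrightarrow> \<not> R x y)"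

definition p4 :: "rel2 \<Rightarrow> nat \<Rightarrow> nat \<Rightarrow> nat \<Rightarrow> nat \<Rightarrow> bool" where
  "p4 R a b c d \<longleftrightarrow> R a b \<and> R a c \<and> R c d \<and> \<not> R a d \<and> \<not> R c b \<and> \<not> R b d"

definition contr :: "rel2 \<Rightarrow> nat \<Rightarrow> nat \<Rightarrow> nat \<Rightarrow> nat \<Rightarrow> bool" where
  "contr R u v x y \<longleftrightarrow> x \<noteq> y \<and> x \<noteq> v \<and> y \<noteq> v \<and> (R x y \<or> x = u \<and> R v y \<or> y = u \<and> R x v)"

lemma splD:
  assumes "splits n C R"
  shows "R x y \<Longrightarrow> R y x" "R x y \<Longrightarrow> x < n" "R x y \<Longrightarrow> y < n" "\<not> R x x"
    "x \<in> C \<Longrightarrow> y \<in> C \<Longrightarrow> x \<noteq> y \<Longrightarrow> R x y" "R x y \<Longrightarrow> x \<in> C \<or> y \<in> C" "x \<in> C \<Longrightarrow> x < n"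
    "finite C"
proof -
  show "R x y \<Longrightarrow> R y x" using assms unfolding splits_def by (blast dest: sympD)
qed (use assms finite_subset in \<open>auto simp: splits_def\<close>)

lemma p4_split:
  assumes "splits n C R" "p4 R a b c d"
  shows "a \<in> C" "c \<in> C" "b \<notin> C" "d \<notin> C" "a \<noteq> c" "b \<noteq> d"
proof -
  note sp = splD[OF assms(1)]
  have p: "R a b" "R a c" "R c d" "\<not> R a d" "\<not> R c b" "\<not> R b d" using assms(2) by (auto simp: p4_def)
  show ac: "a \<noteq> c" "b \<noteq> d" using p by auto
  have ne: "a \<noteq> d" "c \<noteq> b"
    using p sp(1)[of a b] sp(1)[of c d] by auto
  have *: "\<not> (a \<in> C \<and> d \<in> C)" "\<not> (c \<in> C \<and> b \<in> C)"
    using sp(5)[of a d] sp(5)[of c b] ne p by blast+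
  moreover have "a \<in> C \<or> b \<in> C" "c \<in> C \<or> d \<in> C" "a \<in> C \<or> c \<in> C"
    using sp(6)[OF p(1)] sp(6)[OF p(2)] sp(6)[OF p(3)] by blast+
  moreover have "\<not> (b \<in> C \<and> d \<in> C)" using sp(5)[of b d] ac p(6) by blast
  ultimately show "a \<in> C" "c \<in> C" "b \<notin> C" "d \<notin> C" by blast+
qed

text \<open>If only \<open>v\<close> is in the clique, the merged vertex \<open>u\<close> inherits
  its adjacency to all of the clique and takes its place. Both orientations are needed, since an
  arbitrary sequence of contractions may name the ends of an edge in either order.\<close>

lemma splits_contr:
  assumes "splits n C R" "R u v"
  shows "splits n (insert u C - {v}) (contr R u v)"
proof -
  note sp = splD[OF assms(1)]
  have uv: "u \<in> C \<or> v \<in> C" "u \<noteq> v" "u < n"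
      using sp(2)[OF assms(2)] sp(6)[OF assms(2)] sp(4)[of u] assms(2) by metis+
  have u: "R u y \<or> R v y" if "y \<in> C" "y \<noteq> u" "y \<noteq> v" for y
    using uv(1) that sp(5) by blast
  show ?thesis
    unfolding splits_def
  proof (intro conjI allI impI ballI sympI)
    fix x y assume "contr R u v x y"
    then show "contr R u v y x"
      using sp(1)[of x y] sp(1)[of v y] sp(1)[of x v] by (auto simp: contr_def)
  next
    fix x y assume "contr R u v x y"
    then show "x < n" "y < n" "x \<noteq> y"
      using sp(1)[of x y] sp(1)[of v y] sp(1)[of x v] sp(2)[of x y] sp(3)[of x y] sp(3)[of v y] sp(2)[of x v] uv
      by (auto simp: contr_def)
  next
    fix x y assume "x \<in> insert u C - {v}" "y \<in> insert u C - {v}" "x \<noteq> y"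
    then show "contr R u v x y"
      using u[of x] u[of y] sp(1)[of u x] sp(1)[of v x] sp(5)[of x y] by (auto simp: contr_def)
  next
    fix x y assume xy: "x \<notin> insert u C - {v}" "y \<notin> insert u C - {v}"
    show "\<not> contr R u v x y"
      using xy sp(6)[of x y] by (auto simp: contr_def)
  qed (use sp(7) uv in auto)
qed

lemma splits_contr_C:
  assumes "splits n C R" "R u v" "u \<in> C"
  shows "splits n (C - {v}) (contr R u v)"
  using splits_contr[OF assms(1,2)] insert_absorb[OF assms(3)] by metis

section \<open>Contracted graphs as quotients and as relations\<close>

definition quot :: "'a graph \<Rightarrow> 'a graph \<Rightarrow> ('a \<Rightarrow> 'a) \<Rightarrow> bool" where
  "quot = (\<lambda>(V, E) (W, F) h. h ` V = W \<and> F = {{h x, h y} |x y. {x, y} \<in> E \<and> h x \<noteq> h y} \<and>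
     (\<forall>x\<in>V. \<forall>y\<in>V. x \<noteq> y \<longrightarrow> h x = h y \<longrightarrow> (\<exists>z. {x, z} \<in> E \<and> h z = h x)))"

text \<open>In place of connected fibres, \<open>quot\<close> only records that a vertex sharing its
  fibre has a neighbour in it. This weaker property is easy to maintain and suffices: in a split
  graph such a neighbour of an independent vertex lies in the clique.\<close>

lemma quot_contract_edge:
  assumes q: "quot (V, E) G h" and c: "contract_edge G H" and VE: "\<And>e. e \<in> E \<Longrightarrow> e \<subseteq> V"
    and fin: "finite V"
  shows "\<exists>h'. quot (V, E) H h' \<and> card (fst G) = Suc (card (fst H))"
  using c
proof cases
  case (1 u v F w W)
  have W: "h ` V = W" and F: "F = {{h x, h y} |x y. {x, y} \<in> E \<and> h x \<noteq> h y}"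
    and fib: "\<And>x y. x \<in> V \<Longrightarrow> y \<in> V \<Longrightarrow> x \<noteq> y \<Longrightarrow> h x = h y \<Longrightarrow> \<exists>z. {x, z} \<in> E \<and> h z = h x"
    using q 1 by (auto simp: quot_def)
  define h' where "h' x = (if h x = u \<or> h x = v then w else h x)" for x
  have edge: "x \<in> V" "y \<in> V" if "{x, y} \<in> E" for x y
    using VE[OF that] by auto
  have FW: "a \<in> W" "b \<in> W" if "{a, b} \<in> F" for a b
    using that edge W F by (auto simp: doubleton_eq_iff)
  have uv: "u \<in> W" "v \<in> W" using FW 1 by auto
  have hw: "h x \<noteq> w" if "x \<in> V" for x using that W \<open>w \<notin> W\<close> by auto
  obtain x0 y0 where xy0: "{x0, y0} \<in> E" "h x0 = u" "h y0 = v"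
    using \<open>{u, v} \<in> F\<close> F by (auto simp: doubleton_eq_iff) (metis insert_commute)
  have FI: "{h x, h y} \<in> F" if "{x, y} \<in> E" "h x \<noteq> h y" for x y
    using that F by auto
  have "h' ` V = insert w (W - {u, v})"
    using W xy0 edge by (auto simp: h'_def image_iff)
  moreover have "{{h' x, h' y} |x y. {x, y} \<in> E \<and> h' x \<noteq> h' y} =
     {e \<in> F. u \<notin> e \<and> v \<notin> e} \<union> {{w, x} | x. x \<in> W - {u, v} \<and> ({u, x} \<in> F \<or> {v, x} \<in> F)}" (is "?A = ?B")
  proof (intro set_eqI iffI)
    fix e assume "e \<in> ?A"
    then obtain x y where e: "e = {h' x, h' y}" "{x, y} \<in> E" "h' x \<noteq> h' y" by auto
    have V: "h x \<in> W" "h y \<in> W" using edge[OF e(2)] W by auto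
    have ne: "h x \<noteq> h y" 
    proof
      assume "h x = h y"
      then have "h' x = h' y" by (simp add: h'_def)
      then show False using e(3) by simp
    qed
    note f = FI[OF e(2) ne]
    then have f': "{h y, h x} \<in> F" by (simp add: insert_commute)
    consider "h x \<in> {u, v}" | "h x \<notin> {u, v}" "h y \<in> {u, v}" | "h x \<notin> {u, v}" "h y \<notin> {u, v}" by blast
    then show "e \<in> ?B"
    proof cases
      case 1
      then have "h y \<notin> {u, v}" using e by (auto simp: h'_def)
      then have "e = {w, h y}" using 1 e by (auto simp: h'_def)
      then show ?thesis using 1 f V \<open>h y \<notin> {u, v}\<close> by auto
    next
      case 2
      then have "e = {w, h x}" using e by (auto simp: h'_def)
      then show ?thesis using 2 f' V by auto
    next
      case 3
      then have "e = {h x, h y}" using e by (auto simp: h'_def)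
      then show ?thesis using 3 f by auto
    qed
  next
    fix e assume "e \<in> ?B"
    then consider "e \<in> F" "u \<notin> e" "v \<notin> e" | x where "e = {w, x}" "x \<in> W - {u, v}" "{u, x} \<in> F \<or>
        {v, x} \<in> F"
      by blast
    then show "e \<in> ?A"
    proof cases
      case 1
      then obtain x y where "e = {h x, h y}" "{x, y} \<in> E" "h x \<noteq> h y" using F by auto
      then show ?thesis using 1 by (intro CollectI exI[of _ x] exI[of _ y]) (auto simp: h'_def)
    next
      case 2
      then obtain u' where u': "u' \<in> {u, v}" "{u', x} \<in> F" by auto
      then obtain p q where pq: "{u', x} = {h p, h q}" "{p, q} \<in> E" "h p \<noteq> h q" using F by auto
      then have "\<exists>p q. h p = u' \<and> h q = x \<and> {p, q} \<in> E"
        by (auto simp: doubleton_eq_iff) (metis insert_commute)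
      then obtain p q where pq: "h p = u'" "h q = x" "{p, q} \<in> E" by auto
      have "h' p = w" "h' q = x" using pq u' 2 by (auto simp: h'_def)
      moreover have "w \<noteq> x" using 2 \<open>w \<notin> W\<close> by auto
      ultimately show ?thesis using pq 2 by (intro CollectI exI[of _ p] exI[of _ q]) auto
    qed
  qed
  \<comment> \<open>A fibre that already had a second vertex keeps its witness. A singleton fibre
    can only grow if it belongs to \<open>u\<close> or \<open>v\<close>, and then the ends
    \<open>x0\<close>, \<open>y0\<close> of an original edge behind the contracted one serve each
    other as neighbours.\<close>
  moreover have "\<exists>z. {x, z} \<in> E \<and> h' z = h' x" if x: "x \<in> V" "y \<in> V" "x \<noteq> y" "h' x = h' y" for x y
  proof (cases "\<exists>y'\<in>V. y' \<noteq> x \<and> h y' = h x")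
    case True
    then obtain z where "{x, z} \<in> E" "h z = h x" using fib[OF x(1)] by metis
    then show ?thesis by (intro exI[of _ z]) (simp add: h'_def)
  next
    case False
    have "h x \<in> {u, v}"
    proof (rule ccontr)
      assume n: "h x \<notin> {u, v}"
      then have "h' x = h x" by (simp add: h'_def)
      moreover have "h y \<noteq> h x" using False x(2,3) by metis
      moreover have "h' y = w \<or> h' y = h y" by (simp add: h'_def)
      ultimately show False using x(4) hw[OF x(1)] by argo
    qed
    moreover have "x = x0" if "h x = u" using False xy0 edge(1)[OF xy0(1)] that by auto
    moreover have "x = y0" if "h x = v" using False xy0 edge(2)[OF xy0(1)] that by auto
    ultimately have "x = x0 \<or> x = y0" by blast
    then show ?thesis
    proof
      assume "x = x0" then show ?thesis using xy0 by (intro exI[of _ y0]) (auto simp: h'_def)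
    next
      assume "x = y0" then show ?thesis using xy0
        by (intro exI[of _ x0]) (auto simp: h'_def insert_commute)
    qed
  qed
  ultimately have "quot (V, E) H h'"
    unfolding quot_def 1 by auto
  moreover have "finite W" using W fin by auto
  then have "card W = Suc (card (insert w (W - {u, v})))"
  proof -
    have "card (W - {u, v}) = card W - 2" using \<open>finite W\<close> uv \<open>u \<noteq> v\<close>
      by (subst card_Diff_subset) auto
    moreover have "2 \<le> card W" using card_mono[of W "{u, v}"] uv \<open>u \<noteq> v\<close> \<open>finite W\<close> by auto
    ultimately show ?thesis using \<open>finite W\<close> \<open>w \<notin> W\<close> by auto
  qed
  ultimately show ?thesis using 1 by auto
qed

lemma quot_contract_edges:
  assumes "(contract_edge ^^ j) (V, E) H" "\<And>e. e \<in> E \<Longrightarrow> e \<subseteq> V \<and> card e = 2" "finite V"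
  shows "\<exists>h. quot (V, E) H h \<and> card V = j + card (fst H)"
  using assms(1)
proof (induction j arbitrary: H)
  case 0
  have "\<exists>x y. e = {x, y} \<and> {x, y} \<in> E \<and> x \<noteq> y" if "e \<in> E" for e
    using assms(2)[OF that] that by (auto simp: card_2_iff)
  then have "quot (V, E) (V, E) (\<lambda>x. x)"
    using assms(2) by (fastforce simp: quot_def)
  then show ?case using 0 by auto
next
  case (Suc j)
  then obtain G where G: "(contract_edge ^^ j) (V, E) G" "contract_edge G H" by auto
  from Suc.IH[OF G(1)] obtain h where "quot (V, E) G h" "card V = j + card (fst G)" by auto
  with quot_contract_edge[OF _ G(2)] assms(2,3) show ?case by fastforce
qed

text \<open>\<open>A\<close> holds the vertices still alive. The bijection absorbs the arbitrary
  fresh names of \<open>contract_edge\<close>, so that the merged vertex can keep the name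
  \<open>u\<close> in the relation.\<close>

definition repr :: "nat graph \<Rightarrow> nat set \<Rightarrow> rel2 \<Rightarrow> bool" where
  "repr H A R \<longleftrightarrow> finite A \<and> symp R \<and> (\<forall>x y. R x y \<longrightarrow> x \<in> A \<and> y \<in> A \<and> x \<noteq> y) \<and>
     (\<exists>\<phi>. bij_betw \<phi> A (fst H) \<and> snd H = {{\<phi> x, \<phi> y} |x y. R x y})"

lemma repr_contr:
  assumes "repr H A R" "R u v"
  shows "\<exists>H'. contract_edge H H' \<and> repr H' (A - {v}) (contr R u v)"
proof -
  obtain W F where H: "H = (W, F)" by (cases H)
  obtain \<phi> where A: "finite A" "bij_betw \<phi> A W" "F = {{\<phi> x, \<phi> y} |x y. R x y}"
    and R: "\<And>x y. R x y \<Longrightarrow> x \<in> A \<and> y \<in> A \<and> x \<noteq> y" and sym: "symp R"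
    using assms(1) by (auto simp: repr_def H)
  have inj: "\<phi> x = \<phi> y \<longleftrightarrow> x = y" if "x \<in> A" "y \<in> A" for x y
    using A(2) that by (auto simp: bij_betw_def inj_on_def)
  have W: "W = \<phi> ` A" using A(2) by (auto simp: bij_betw_def)
  have "finite W" using A W by auto
  then obtain w where w: "w \<notin> W" using ex_new_if_finite infinite_UNIV_nat by blast
  have wA: "\<phi> x \<noteq> w" if "x \<in> A" for x using that w W by auto
  have uv: "u \<in> A" "v \<in> A" "u \<noteq> v" using R assms(2) by auto
  have FR: "{\<phi> x, \<phi> y} \<in> F \<longleftrightarrow> R x y" if "x \<in> A" "y \<in> A" for x y
  proof
    assume "{\<phi> x, \<phi> y} \<in> F"
    then obtain p q where pq: "{\<phi> x, \<phi> y} = {\<phi> p, \<phi> q}" "R p q" using A(3) by auto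
    then have "p \<in> A" "q \<in> A" using R by auto
    then have "x = p \<and> y = q \<or> x = q \<and> y = p" using pq(1) inj that by (auto simp: doubleton_eq_iff)
    then show "R x y" using pq(2) sympD[OF sym] by auto
  qed (use A(3) in auto)
  define H' where "H' = (insert w (W - {\<phi> u, \<phi> v}), {e \<in> F. \<phi> u \<notin> e \<and> \<phi> v \<notin> e} \<union>
      {{w, x} | x. x \<in> W - {\<phi> u, \<phi> v} \<and> ({\<phi> u, x} \<in> F \<or> {\<phi> v, x} \<in> F)})"
  define \<psi> where "\<psi> = \<phi>(u := w)"
  have "contract_edge H H'"
    unfolding H'_def H using uv inj[of u v] FR[of u v] assms(2) w by (intro contract_edge.intros) auto
  moreover have "bij_betw \<psi> (A - {v}) (fst H')"
  proof -
    have "inj_on \<psi> (A - {v})"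
      using inj wA by (auto simp: inj_on_def \<psi>_def)
    moreover have "\<psi> ` (A - {v}) = insert w (W - {\<phi> u, \<phi> v})"
      using inj uv W by (auto simp: \<psi>_def image_iff)
    ultimately show ?thesis by (simp add: bij_betw_def H'_def)
  qed
  moreover have "snd H' = {{\<psi> x, \<psi> y} |x y. contr R u v x y}" (is "_ = ?B")
  proof (intro set_eqI iffI)
    fix e assume "e \<in> snd H'"
    then consider "e \<in> F" "\<phi> u \<notin> e" "\<phi> v \<notin> e" | x where "e = {w, \<phi> x}" "x \<in> A" "\<phi> x \<notin> {\<phi> u, \<phi> v}"
        "{\<phi> u, \<phi> x} \<in> F \<or> {\<phi> v, \<phi> x} \<in> F"
      by (auto simp: H'_def W)
    then show "e \<in> ?B"
    proof cases
      case 1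
      then obtain x y where "e = {\<phi> x, \<phi> y}" "R x y" using A by auto
      then show ?thesis using 1 R uv
        by (intro CollectI exI[of _ x] exI[of _ y]) (auto simp: \<psi>_def contr_def)
    next
      case 2
      then have "x \<noteq> u" "x \<noteq> v" by auto
      moreover have "R u x \<or> R v x" using 2 FR uv by auto
      ultimately show ?thesis using 2
        by (intro CollectI exI[of _ u] exI[of _ x]) (auto simp: \<psi>_def contr_def uv)
    qed
  next
    fix e assume "e \<in> ?B"
    then obtain x y where e: "e = {\<psi> x, \<psi> y}" "contr R u v x y" by auto
    have *: "{w, \<phi> z} \<in> snd H'" if "R u z \<or> R v z" "z \<noteq> u" "z \<noteq> v" for z
    proof -
      have "z \<in> A" using that R by auto
      then show ?thesis using that uv inj W FR by (auto simp: H'_def)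
    qed
    consider "x = u" | "y = u" | "x \<noteq> u" "y \<noteq> u" by blast
    then show "e \<in> snd H'"
    proof cases
      case 1
      then have "e = {w, \<phi> y}" using e by (auto simp: \<psi>_def contr_def)
      then show ?thesis using * e 1 by (auto simp: contr_def)
    next
      case 2
      then have "e = {w, \<phi> x}" using e by (auto simp: \<psi>_def contr_def)
      moreover have "R u x \<or> R v x" "x \<noteq> u" "x \<noteq> v"
        using e(2) 2 sympD[OF sym, of x u] sympD[OF sym, of x v] by (auto simp: contr_def)
      ultimately show ?thesis using * by simp
    next
      case 3
      then have "e = {\<phi> x, \<phi> y}" "R x y" "x \<noteq> v" "y \<noteq> v" using e by (auto simp: \<psi>_def contr_def)
      moreover have "x \<in> A" "y \<in> A" using R \<open>R x y\<close> by auto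
      ultimately show ?thesis using 3 uv inj FR by (auto simp: H'_def)
    qed
  qed
  moreover have "\<forall>x y. contr R u v x y \<longrightarrow> x \<in> A - {v} \<and> y \<in> A - {v} \<and> x \<noteq> y"
    using R uv by (auto simp: contr_def)
  moreover have "symp (contr R u v)"
    using sympD[OF sym] by (intro sympI) (auto simp: contr_def)
  ultimately show ?thesis
    using A(1) unfolding repr_def by blast
qed

section \<open>Threshold graphs and induced paths\<close>

lemma threshold_no_p4:
  assumes "threshold_graph (V, E)" "{a, b} \<in> E" "{c, d} \<in> E" "{a, d} \<notin> E" "{c, b} \<notin> E"
    "{a, b, c, d} \<subseteq> V" "a \<noteq> b" "c \<noteq> d" "a \<noteq> d" "c \<noteq> b"
  shows False
proof -
  obtain r t where rt: "\<And>X. X \<subseteq> V \<Longrightarrow> indep X E \<longleftrightarrow> (\<Sum>v\<in>X. r v) \<le> (t :: real)"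
    using assms(1) by (auto simp: threshold_graph_def)
  have *: "{x, y} \<in> E \<longleftrightarrow> t < r x + r y" if "{x, y} \<subseteq> V" "x \<noteq> y" for x y
  proof -
    have "indep {x, y} E \<longleftrightarrow> {x, y} \<notin> E"
      using that by (auto simp: indep_def insert_commute)
    then show ?thesis using rt[OF that(1)] that(2) by auto
  qed
  \<comment> \<open>The two edges push the total weight of the four vertices above
    \<open>2 * t\<close>, the two non-edges keep it at most \<open>2 * t\<close>.\<close>
  show False using *[of a b] *[of c d] *[of a d] *[of c b] assms by auto
qed

text \<open>Without an induced path, each independent neighbour of a clique vertex has larger degree
  than each of its independent non-neighbours. With weights exponential in the degree, one neighbour
  outweighs all non-neighbours together, and a clique vertex leaves exactly the room that its
  non-neighbours need.\<close>

lemma threshold_graph_repr: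
  assumes "repr (W, F) A R" "splits n C R" "\<And>a b c d. \<not> p4 R a b c d"
  shows "threshold_graph (W, F)"
proof -
  obtain \<phi> where A: "finite A" "bij_betw \<phi> A W" "F = {{\<phi> x, \<phi> y} |x y. R x y}"
    and R: "\<And>x y. R x y \<Longrightarrow> x \<in> A \<and> y \<in> A \<and> x \<noteq> y"
    using assms(1) by (auto simp: repr_def)
  have inj: "inj_on \<phi> A" and W: "W = \<phi> ` A" using A(2) by (auto simp: bij_betw_def)
  note sp = splD[OF assms(2)]
  define N where "N = card A"
  define deg where "deg b = card {c \<in> C. R c b}" for b
  define I where "I = A - C"
  \<comment> \<open>The base \<open>Suc N\<close> beats the at most \<open>N\<close> non-neighbours
    of smaller degree.\<close>
  define r0 where "r0 b = real (Suc N) ^ deg b" for b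
  \<comment> \<open>A clique vertex loses at most half of \<open>t - 1\<close> from its weight, so
    two clique vertices still exceed \<open>t\<close>.\<close>
  define t where "t = 2 * (\<Sum>b\<in>I. r0 b) + 1"
  define r where "r x = (if x \<in> C then t - (\<Sum>b\<in>{b\<in>I. \<not> R x b}. r0 b) else r0 x)" for x
  have finI: "finite I" using A by (auto simp: I_def)
  have r0: "0 \<le> r0 b" for b by (simp add: r0_def)
  have part: "(\<Sum>b\<in>Y. r0 b) \<le> (\<Sum>b\<in>I. r0 b)" if "Y \<subseteq> I" for Y
    using that finI r0 by (intro sum_mono2) auto
  have S0: "0 \<le> (\<Sum>b\<in>I. r0 b)" using r0 by (intro sum_nonneg) auto
  have key: "(\<Sum>b'\<in>{b'\<in>I. \<not> R c b'}. r0 b') < r0 b" if c: "c \<in> C" "b \<notin> C" "R c b" for c b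
  proof -
    have less: "deg b' < deg b" if b': "b' \<in> I" "\<not> R c b'" for b'
    proof -
      have "{c \<in> C. R c b'} \<subset> {c \<in> C. R c b}"
      proof
        show "{c \<in> C. R c b'} \<subseteq> {c \<in> C. R c b}"
        proof clarify
          fix c' assume c': "c' \<in> C" "R c' b'"
          then have "c \<noteq> c'" using b' by auto
          then have "R c c'" using sp(5) c c' by blast
          then show "R c' b" using assms(3)[of c b c' b'] c c' b' sp(6)[of b b']
              by (auto simp: p4_def I_def)
        qed
      qed (use c b' in auto)
      then show ?thesis unfolding deg_def using sp(8) by (intro psubset_card_mono) auto
    qed
    have "deg b > 0" using c sp(8) by (auto simp: deg_def card_gt_0_iff)
    have "(\<Sum>b'\<in>{b'\<in>I. \<not> R c b'}. r0 b') \<le> (\<Sum>b'\<in>{b'\<in>I. \<not> R c b'}. real (Suc N) ^ (deg b - 1))"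
      using less unfolding r0_def by (intro sum_mono power_increasing) fastforce+
    also have "\<dots> = real (card {b'\<in>I. \<not> R c b'}) * real (Suc N) ^ (deg b - 1)" by simp
    also have "\<dots> < real (Suc N) * real (Suc N) ^ (deg b - 1)"
    proof -
      have "card {b'\<in>I. \<not> R c b'} \<le> N" unfolding N_def using A by (intro card_mono) (auto simp: I_def)
      then show ?thesis by (intro mult_strict_right_mono) auto
    qed
    also have "\<dots> = r0 b" unfolding r0_def using \<open>deg b > 0\<close>
      by (metis power_Suc Suc_pred')
    finally show ?thesis .
  qed
  have rpos: "0 \<le> r x" for x
  proof (cases "x \<in> C")
    case True
    then show ?thesis using part[of "{b\<in>I. \<not> R x b}"] S0 by (auto simp: r_def t_def)
  next
    case False then show ?thesis using r0 by (simp add: r_def)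
  qed
  have edge: "t < r x + r y" if "R x y" for x y
  proof -
    have *: "t < r x + r y" if "R x y" "x \<in> C" for x y
    proof (cases "y \<in> C")
      case True
      then show ?thesis using that part[of "{b\<in>I. \<not> R x b}"] part[of "{b\<in>I. \<not> R y b}"]
        by (auto simp: r_def t_def)
    next
      case False
      then show ?thesis using key[OF that(2) False that(1)] that by (auto simp: r_def)
    qed
    show ?thesis using *[OF that] *[of y x] sp(1)[OF that] sp(6)[OF that] by (auto simp: add.commute)
  qed
  have main: "(\<forall>x\<in>Y. \<forall>y\<in>Y. \<not> R x y) \<longleftrightarrow> (\<Sum>x\<in>Y. r x) \<le> t" if Y: "Y \<subseteq> A" for Y
  proof
    have fY: "finite Y" using Y A finite_subset by auto
    assume ind: "\<forall>x\<in>Y. \<forall>y\<in>Y. \<not> R x y"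
    show "(\<Sum>x\<in>Y. r x) \<le> t"
    proof (cases "Y \<inter> C = {}")
      case True
      then have "(\<Sum>x\<in>Y. r x) = (\<Sum>x\<in>Y. r0 x)" by (intro sum.cong) (auto simp: r_def)
      also have "\<dots> \<le> (\<Sum>x\<in>I. r0 x)" using True Y by (intro part) (auto simp: I_def)
      finally show ?thesis using S0 by (simp add: t_def)
    next
      case False
      then obtain c where c: "c \<in> Y" "c \<in> C" by auto
      have "x = c" if "x \<in> Y" "x \<in> C" for x using ind c that sp(5) by metis
      then have YC: "Y - {c} \<subseteq> {b\<in>I. \<not> R c b}" using ind c Y unfolding I_def by blast
      have "(\<Sum>x\<in>Y. r x) = r c + (\<Sum>x\<in>Y-{c}. r x)" using c fY by (simp add: sum.remove)
      also have "(\<Sum>x\<in>Y-{c}. r x) = (\<Sum>x\<in>Y-{c}. r0 x)"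
        using YC by (intro sum.cong) (auto simp: r_def I_def)
      also have "\<dots> \<le> (\<Sum>x\<in>{b\<in>I. \<not> R c b}. r0 x)"
        using YC finI r0 by (intro sum_mono2) auto
      finally show ?thesis using c by (simp add: r_def)
    qed
  next
    have fY: "finite Y" using Y A finite_subset by auto
    assume le: "(\<Sum>x\<in>Y. r x) \<le> t"
    show "\<forall>x\<in>Y. \<forall>y\<in>Y. \<not> R x y"
    proof (intro ballI notI)
      fix x y assume xy: "x \<in> Y" "y \<in> Y" "R x y"
      then have "x \<noteq> y" using R by auto
      have "r x + r y = (\<Sum>x\<in>{x,y}. r x)" using \<open>x \<noteq> y\<close> by simp
      also have "\<dots> \<le> (\<Sum>x\<in>Y. r x)" using xy rpos fY by (intro sum_mono2) auto
      finally show False using edge[OF xy(3)] le by simp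
    qed
  qed
  define \<rho> where "\<rho> w = r (inv_into A \<phi> w)" for w
  have "indep X F \<longleftrightarrow> (\<Sum>v\<in>X. \<rho> v) \<le> t" if X: "X \<subseteq> W" for X
  proof -
    define Y where "Y = {x\<in>A. \<phi> x \<in> X}"
    have XY: "X = \<phi> ` Y" using X W by (auto simp: Y_def)
    have YA: "Y \<subseteq> A" by (auto simp: Y_def)
    have injY: "inj_on \<phi> Y" using inj YA inj_on_subset by auto
    have "(\<Sum>v\<in>X. \<rho> v) = (\<Sum>x\<in>Y. r x)"
      unfolding XY sum.reindex[OF injY] using YA inj by (intro sum.cong) (auto simp: \<rho>_def)
    moreover have "indep X F \<longleftrightarrow> (\<forall>x\<in>Y. \<forall>y\<in>Y. \<not> R x y)"
    proof
      assume i: "indep X F"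
      show "\<forall>x\<in>Y. \<forall>y\<in>Y. \<not> R x y"
      proof (intro ballI notI)
        fix x y assume xy: "x \<in> Y" "y \<in> Y" "R x y"
        then have "\<phi> x \<noteq> \<phi> y" using R injY by (auto simp: inj_on_def)
        moreover have "{\<phi> x, \<phi> y} \<in> F" using xy A by auto
        ultimately show False using i xy XY by (auto simp: indep_def)
      qed
    next
      assume i: "\<forall>x\<in>Y. \<forall>y\<in>Y. \<not> R x y"
      show "indep X F" unfolding indep_def
      proof (intro ballI impI notI)
        fix v w assume vw: "v \<in> X" "w \<in> X" "v \<noteq> w" "{v, w} \<in> F"
        then obtain x y where xy: "{v, w} = {\<phi> x, \<phi> y}" "R x y" using A by auto
        then have "\<phi> x \<in> X" "\<phi> y \<in> X" using vw by (auto simp: doubleton_eq_iff)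
        then have "x \<in> Y" "y \<in> Y" using R xy by (auto simp: Y_def)
        then show False using i xy by auto
      qed
    qed
    ultimately show ?thesis using main[OF YA] by simp
  qed
  then show ?thesis unfolding threshold_graph_def using rpos
    by (auto simp: \<rho>_def intro!: exI[of _ \<rho>] exI[of _ t])
qed

section \<open>Solutions and candidates\<close>

text \<open>
  Contracting an edge at a vertex of the independent part has the effect of deleting that vertex, and
  contracting an edge inside the clique replaces two neighbourhoods by their union. A solution
  therefore consists of a labelling \<open>f\<close> whose fibres on \<open>C\<close> are the classes to be merged and a set
  \<open>D\<close> of deleted vertices; it succeeds if the neighbourhoods of the classes outside \<open>D\<close> form a chain.
\<close>

abbreviation nested :: "'a set \<Rightarrow> 'a set \<Rightarrow> 'a set \<Rightarrow> bool" where
  "nested D A B \<equiv> A - D \<subseteq> B \<or> B - D \<subseteq> A"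

definition nbhd :: "nat set \<Rightarrow> rel2 \<Rightarrow> (nat \<Rightarrow> nat) \<Rightarrow> nat \<Rightarrow> nat set" where
  "nbhd C R f c = {b. b \<notin> C \<and> (\<exists>a\<in>C. f a = f c \<and> R a b)}"

definition sol :: "nat \<Rightarrow> nat set \<Rightarrow> rel2 \<Rightarrow> (nat \<Rightarrow> nat) \<Rightarrow> nat set \<Rightarrow> nat \<Rightarrow> bool" where
  "sol n C R f D j \<longleftrightarrow> D \<subseteq> {..<n} - C \<and> (card C - card (f ` C)) + card D \<le> j \<and>
     (\<forall>c\<in>C. \<forall>c'\<in>C. nested D (nbhd C R f c) (nbhd C R f c'))"

definition touched :: "nat set \<Rightarrow> (nat \<Rightarrow> nat) \<Rightarrow> nat set" where
  "touched C f = {c\<in>C. \<exists>a\<in>C. a \<noteq> c \<and> f a = f c}"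

text \<open>A class of \<open>s\<close> vertices with \<open>s\<close> at least 2 accounts for
  \<open>s - 1\<close> lost labels, and \<open>s\<close> is at most
  \<open>2 * (s - 1)\<close>.\<close>

lemma card_touched:
  assumes "finite C"
  shows "card (touched C f) \<le> 2 * (card C - card (f ` C))"
  using assms
proof (induction C rule: finite_induct)
  case empty
  then show ?case by (simp add: touched_def)
next
  case (insert x C)
  have le: "card (f ` C) \<le> card C" using insert by (simp add: card_image_le)
  have fin: "finite (touched C f)" using insert by (simp add: touched_def)
  show ?case
  proof (cases "f x \<in> f ` C")
    case True
    then obtain y where y: "y \<in> C" "f y = f x" by auto
    have "touched (insert x C) f \<subseteq> touched C f \<union> {x, y}"
      using y by (fastforce simp: touched_def)
    then have "card (touched (insert x C) f) \<le> card (touched C f \<union> {x, y})"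
      using fin by (intro card_mono) auto
    also have "\<dots> \<le> card (touched C f) + card {x, y}" by (rule card_Un_le)
    also have "\<dots> \<le> card (touched C f) + 2" by (simp add: card_insert_if)
    finally show ?thesis using insert True le by (simp add: insert_absorb)
  next
    case False
    then have "touched (insert x C) f \<subseteq> touched C f"
      by (auto simp: touched_def) (metis imageI)
    then have "card (touched (insert x C) f) \<le> card (touched C f)"
      using fin by (intro card_mono) auto
    then show ?thesis using insert False le by simp
  qed
qed

lemma sol_card_touched:
  assumes "sol n C R f D k" "finite C"
  shows "card (touched C f) + card D \<le> 2 * k"
  using assms card_touched[of C f] by (auto simp: sol_def)

lemma sol_violation:
  assumes "sol n C R f D k" "c \<in> C" "c' \<in> C"
    "b \<in> nbhd C R f c" "b \<notin> nbhd C R f c'" "b' \<in> nbhd C R f c'" "b' \<notin> nbhd C R f c" "b \<notin> D" "b' \<notin> D"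
  shows False
  using assms unfolding sol_def by blast

lemma nbhd_untouched:
  assumes "c \<in> C" "c \<notin> touched C f"
  shows "nbhd C R f c = {b. b \<notin> C \<and> R c b}"
  using assms by (auto simp: nbhd_def touched_def)

text \<open>Untouched clique vertices keep their own neighbourhoods as those of their classes, so
  the undeleted ends \<open>b\<close> and \<open>d\<close> would witness an incomparability.\<close>

lemma p4_sol:
  assumes "splits n C R" "sol n C R f D k" "p4 R a b c d"
  shows "{a, b, c, d} \<inter> (touched C f \<union> D) \<noteq> {}"
proof
  assume *: "{a, b, c, d} \<inter> (touched C f \<union> D) = {}"
  note p = p4_split[OF assms(1,3)]
  have q: "R a b" "R c d" "\<not> R a d" "\<not> R c b" using assms(3) by (auto simp: p4_def)
  have "nbhd C R f a = {b. b \<notin> C \<and> R a b}" "nbhd C R f c = {b. b \<notin> C \<and> R c b}"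
    using * p by (auto intro!: nbhd_untouched)
  then show False using sol_violation[OF assms(2), of a c b d] p q * by auto
qed

section \<open>Types and ranks of vertices\<close>

definition nonsimp :: "rel2 \<Rightarrow> nat \<Rightarrow> bool" where
  "nonsimp R v \<longleftrightarrow> (\<exists>x y. x < y \<and> R v x \<and> R v y \<and> \<not> R x y)"

text \<open>Orders vertices by degree; the summand \<open>v < n\<close> only breaks ties.\<close>

definition key :: "nat \<Rightarrow> rel2 \<Rightarrow> nat \<Rightarrow> nat" where
  "key n R v = v + n * card {x. x < n \<and> R v x}"

text \<open>Types refer to simpliciality rather than to the clique because this can be computed
  without knowing the partition. A simplicial type may mix independent vertices with simplicial
  clique vertices; a non-simplicial type lies within the clique.\<close>

definition below :: "nat \<Rightarrow> rel2 \<Rightarrow> nat set \<Rightarrow> nat \<Rightarrow> nat \<Rightarrow> bool" where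
  "below n R T x y \<longleftrightarrow> x < n \<and> y < n \<and> x \<notin> T \<and> y \<notin> T \<and> nonsimp R x = nonsimp R y \<and>
     (\<forall>t\<in>T. R x t = R y t) \<and> key n R x < key n R y"

definition low :: "nat \<Rightarrow> rel2 \<Rightarrow> nat set \<Rightarrow> nat \<Rightarrow> nat \<Rightarrow> bool" where
  "low n R T k y \<longleftrightarrow> card {x. below n R T x y} \<le> 2 * k"

text \<open>The third clause comes from the exchange argument: an incomparability of
  \<open>x\<close> at an independent vertex \<open>b\<close> has to be carried over to an untouched
  vertex above \<open>x\<close> that also misses \<open>b\<close>. The rank is therefore taken among
  the non-neighbours of \<open>b\<close>, and more than \<open>2 * k\<close> of them include an
  untouched one.\<close>

definition candidate :: "nat \<Rightarrow> rel2 \<Rightarrow> nat set \<Rightarrow> nat \<Rightarrow> nat \<Rightarrow> bool" where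
  "candidate n R T k x \<longleftrightarrow> low n R T k x \<or> card {y. below n R T x y} \<le> 2 * k \<or>
     (\<exists>b<n. low n R T k b \<and> \<not> R b x \<and> card {y. below n R T x y \<and> \<not> R b y} \<le> 2 * k)"

lemma finite_below [simp]: "finite {x. below n R T x y}" "finite {y. below n R T x y}"
  "finite {y. below n R T x y \<and> P y}"
  by (rule finite_subset[of _ "{..<n}"], auto simp: below_def)+

lemma below_trans: "below n R T x y \<Longrightarrow> below n R T y z \<Longrightarrow> below n R T x z"
  by (auto simp: below_def)

lemma key_less: "card {x. x < n \<and> R v x} < card {x. x < n \<and> R w x} \<Longrightarrow> v < n \<Longrightarrow> key n R v < key n R w"
  unfolding key_def
  using mult_le_mono2[of "Suc (card {x. x < n \<and> R v x})" "card {x. x < n \<and> R w x}" n] by simp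

text \<open>\<open>Cnb\<close> gives every clique vertex degree at least \<open>card C\<close>,
  whereas an independent vertex missing some clique vertex has smaller degree. Degrees thus separate
  the two within a simplicial type. \<open>free\<close> is what the packing of induced paths
  provides.\<close>

locale packed =
  fixes n :: nat and C :: "nat set" and R :: "nat \<Rightarrow> nat \<Rightarrow> bool" and T :: "nat set" and k :: nat
  assumes splits: "splits n C R"
    and Cnb: "\<And>c. c \<in> C \<Longrightarrow> \<exists>b. b \<notin> C \<and> R c b"
    and free: "\<And>a b c d. {a, b, c, d} \<inter> T = {} \<Longrightarrow> \<not> p4 R a b c d"
begin

lemmas sp = splD[OF splits]

lemma nonsimp_C: assumes "nonsimp R x" shows "x \<in> C"
proof (rule ccontr)
  assume x: "x \<notin> C"
  obtain y z where "y < z" "R x y" "R x z" "\<not> R y z" using assms by (auto simp: nonsimp_def)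
  then show False using sp(6)[of x y] sp(6)[of x z] sp(5)[of y z] x by auto
qed

lemma free_C:
  assumes "x \<in> C" "y \<in> C" "b \<notin> C" "d \<notin> C" "x \<notin> T" "y \<notin> T" "b \<notin> T" "d \<notin> T"
    "R x b" "\<not> R x d" "R y d"
  shows "R y b"
proof (rule ccontr)
  assume "\<not> R y b"
  moreover have "x \<noteq> y" using assms by auto
  then have "R x y" using sp(5) assms by auto
  moreover have "\<not> R b d" using sp(6)[of b d] assms by auto
  ultimately show False using free[of x b y d] assms by (auto simp: p4_def)
qed

lemma card_nb_C:
  assumes "c \<in> C"
  shows "card {x. x < n \<and> R c x} = card C - 1 + card {b. b \<notin> C \<and> R c b}"
proof -
  have "{x. x < n \<and> R c x} = (C - {c}) \<union> {b. b \<notin> C \<and> R c b}"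
    using sp(5)[OF assms] sp(7) sp(3) sp(4) by blast
  also have "card \<dots> = card (C - {c}) + card {b. b \<notin> C \<and> R c b}"
    using sp(8) sp(3) by (intro card_Un_disjoint) (auto intro: finite_subset[of _ "{..<n}"])
  also have "card (C - {c}) = card C - 1" using sp(8) assms by simp
  finally show ?thesis .
qed

text \<open>Vertices of one type agree on \<open>T\<close>, and off \<open>T\<close> the lack of
  induced paths makes the neighbourhoods of clique vertices comparable, so the order by degree is
  inclusion. Equal degrees then mean equal neighbourhoods, which makes the tie-break
  harmless.\<close>

lemma below_C:
  assumes "below n R T x y" "nonsimp R x" "b \<notin> C" "R x b"
  shows "R y b"
proof (rule ccontr)
  assume ny: "\<not> R y b"
  have xy: "x \<in> C" "y \<in> C" using assms nonsimp_C by (auto simp: below_def)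
  have pat: "R x t = R y t" if "t \<in> T" for t using assms that by (auto simp: below_def)
  have b: "b \<notin> T" using pat ny assms by auto
  have "{b. b \<notin> C \<and> R y b} \<subset> {b. b \<notin> C \<and> R x b}"
  proof
    show "{b. b \<notin> C \<and> R y b} \<subseteq> {b. b \<notin> C \<and> R x b}"
    proof clarify
      fix d assume d: "d \<notin> C" "R y d"
      show "R x d"
      proof (cases "d \<in> T")
        case True then show ?thesis using pat d by auto
      next
        case False
        then show ?thesis using free_C[of x y b d] xy assms b d ny by (auto simp: below_def)
      qed
    qed
  qed (use assms ny in auto)
  moreover have "finite {b. b \<notin> C \<and> R x b}" by (rule finite_subset[of _ "{..<n}"]) (use sp(3) in auto)
  ultimately have "card {b. b \<notin> C \<and> R y b} < card {b. b \<notin> C \<and> R x b}"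
    by (simp add: psubset_card_mono)
  then have "key n R y < key n R x"
    using card_nb_C xy sp(7) by (intro key_less) auto
  then show False using assms by (simp add: below_def)
qed

text \<open>Dual to \<open>below_C\<close>, with one extra danger: the type of \<open>b\<close> may
  contain simplicial clique vertices. Such a vertex has degree at least \<open>card C\<close>, more
  than \<open>b\<close>, which misses \<open>x\<close>; hence it cannot be below
  \<open>b\<close>.\<close>

lemma below_I:
  assumes "below n R T z b" "b \<notin> C" "x \<in> C" "\<not> R x b"
  shows "z \<notin> C" "\<not> R x z"
proof -
  have fin: "finite {x. x < n \<and> P x}" for P by auto
  have zb: "z < n" "b < n" using assms by (auto simp: below_def)
  have pat: "R z t = R b t" if "t \<in> T" for t using assms that by (auto simp: below_def)
  have bC: "{x. x < n \<and> R b x} \<subseteq> C - {x}"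
    using sp(6)[of b] sp(1)[of b x] assms by auto
  have le: "card {x. x < n \<and> R b x} \<le> card C - 1"
    using card_mono[OF _ bC] sp(8) assms by simp
  show z: "z \<notin> C"
  proof
    assume zC: "z \<in> C"
    then obtain d where "d \<notin> C" "R z d" using Cnb by auto
    then have "card {b. b \<notin> C \<and> R z b} > 0"
      using sp(3) by (auto simp: card_gt_0_iff intro: finite_subset[of _ "{..<n}"])
    then have "card {x. x < n \<and> R b x} < card {x. x < n \<and> R z x}"
      using le card_nb_C[OF zC] by simp
    then have "key n R b < key n R z" using zb by (intro key_less)
    then show False using assms by (simp add: below_def)
  qed
  show "\<not> R x z"
  proof
    assume xz: "R x z"
    then have zx: "R z x" "\<not> R b x" using sp(1) assms by blast+
    then have xT: "x \<notin> T" using pat by auto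
    have "{x. x < n \<and> R b x} \<subset> {x. x < n \<and> R z x}"
    proof
      show "{x. x < n \<and> R b x} \<subseteq> {x. x < n \<and> R z x}"
      proof clarify
        fix y assume y: "y < n" "R b y"
        show "R z y"
        proof (cases "y \<in> T")
          case True then show ?thesis using pat y by auto
        next
          case False
          have "y \<in> C" "R y b" using sp(6)[of b y] sp(1)[of b y] y assms by auto
          then have "R y z"
            using free_C[of x y z b] assms z False xT xz by (auto simp: below_def)
          then show ?thesis using sp(1) by blast
        qed
      qed
    qed (use zx sp(3) in auto)
    then have "card {x. x < n \<and> R b x} < card {x. x < n \<and> R z x}"
      using fin by (simp add: psubset_card_mono)
    then have "key n R b < key n R z" using zb by (intro key_less)
    then show False using assms by (simp add: below_def)
  qed
qed

section \<open>The exchange argument\<close>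

lemma below_ex_untouched:
  assumes s: "sol n C R f D k" and x: "nonsimp R x" and Y: "2 * k < card {y. below n R T x y \<and> P y}"
  shows "\<exists>y. below n R T x y \<and> P y \<and> y \<in> C \<and> y \<notin> touched C f"
proof (rule ccontr)
  assume "\<not> ?thesis"
  moreover have "y \<in> C" if "below n R T x y" for y using that x nonsimp_C by (auto simp: below_def)
  ultimately have "{y. below n R T x y \<and> P y} \<subseteq> touched C f" by auto
  moreover have "finite (touched C f)" using sp(8) by (simp add: touched_def)
  ultimately have "card {y. below n R T x y \<and> P y} \<le> card (touched C f)" by (rule card_mono[rotated])
  then show False using sol_card_touched[OF s sp(8)] Y by simp
qed

lemma below_ex_untouched':
  assumes s: "sol n C R f D k" and x: "nonsimp R x" and Y: "2 * k < card {y. below n R T y x}"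
  shows "\<exists>y. below n R T y x \<and> y \<in> C \<and> y \<notin> touched C f"
proof (rule ccontr)
  assume "\<not> ?thesis"
  moreover have "y \<in> C" if "below n R T y x" for y using that x nonsimp_C by (auto simp: below_def)
  ultimately have "{y. below n R T y x} \<subseteq> touched C f" by auto
  moreover have "finite (touched C f)" using sp(8) by (simp add: touched_def)
  ultimately have "card {y. below n R T y x} \<le> card (touched C f)" by (rule card_mono[rotated])
  then show False using sol_card_touched[OF s sp(8)] Y by simp
qed

text \<open>
  An incomparability with \<open>x\<close> at \<open>b\<close>, \<open>b'\<close> is transferred to an untouched vertex of the same type as
  \<open>x\<close>, where it contradicts the chain condition; if \<open>b\<close> has too many vertices of its type below it,
  it is first replaced by one of low rank.
\<close>

lemma not_candidate_comparable:
  assumes s: "sol n C R f D k" and x: "nonsimp R x" "\<not> candidate n R T k x"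
    and c: "c \<in> C" and b: "b \<in> nbhd C R f c" "\<not> R x b" "b \<notin> D"
    and b': "R x b'" "b' \<notin> C" "b' \<notin> D" "b' \<notin> nbhd C R f c"
  shows False
proof -
  have xC: "x \<in> C" using x nonsimp_C by auto
  have xn: "x < n" using xC sp(7) by auto
  have high: "2 * k < card {y. below n R T x y}" and lowx: "2 * k < card {y. below n R T y x}"
    using x(2) by (auto simp: candidate_def low_def)
  have up: False if y: "below n R T x y" "y \<in> C" "y \<notin> touched C f" "\<not> R y b''" "R y b'"
     "b'' \<in> nbhd C R f c" "b'' \<notin> D" for y b''
    using sol_violation[OF s c y(2), of b'' b'] y b' nbhd_untouched[OF y(2,3), of R] by auto
  \<comment> \<open>For a low \<open>b''\<close> the failing third clause of
    \<open>candidate\<close> supplies an untouched vertex above \<open>x\<close> that still misses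
    \<open>b''\<close>.\<close>
  have A: False if "b'' \<in> nbhd C R f c" "\<not> R x b''" "b'' \<notin> D" "low n R T k b''" for b''
  proof -
    have b'': "b'' \<notin> C" "b'' < n" using that(1) sp(3) by (auto simp: nbhd_def)
    have "\<not> R b'' x" using that(2) sp(1) by blast
    then have "2 * k < card {y. below n R T x y \<and> \<not> R b'' y}"
      using x(2) that b'' by (auto simp: candidate_def not_le)
    from below_ex_untouched[OF s x(1) this] obtain y where
      y: "below n R T x y" "\<not> R b'' y" "y \<in> C" "y \<notin> touched C f" by blast
    moreover have "\<not> R y b''" using y(2) sp(1) by blast
    ultimately show False using up[of y b''] below_C[OF y(1) x(1) b'(2,1)] that by blast
  qed
  have bC: "b \<notin> C" using b by (simp add: nbhd_def)
  \<comment> \<open>On \<open>T\<close> adjacency passes within a type in both directions, off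
    \<open>T\<close> only along the order. So for \<open>b\<close> in \<open>T\<close> a vertex
    above \<open>x\<close> inherits the incomparability, and for \<open>b'\<close> in
    \<open>T\<close> a vertex below.\<close>
  consider "b \<in> T" | "b' \<in> T" | "b \<notin> T" "b' \<notin> T" by blast
  then show False
  proof cases
    case 1
    obtain y where y: "below n R T x y" "y \<in> C" "y \<notin> touched C f"
      using below_ex_untouched[OF s x(1), of "\<lambda>_. True"] high by auto
    then show False using up[of y b] below_C[OF y(1) x(1) b'(2,1)] b 1 by (auto simp: below_def)
  next
    case 2
    obtain y where y: "below n R T y x" "y \<in> C" "y \<notin> touched C f"
      using below_ex_untouched'[OF s x(1) lowx] by auto
    have "nonsimp R y" using y(1) x(1) by (auto simp: below_def)
    then have "\<not> R y b" using below_C[OF y(1), of b] bC b by auto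
    moreover have "R y b'" using y(1) 2 b' by (auto simp: below_def)
    ultimately show False using sol_violation[OF s c y(2), of b b'] y b b' nbhd_untouched[OF y(2,3), of R]
      by auto
  next
    case 3
    obtain a where a: "a \<in> C" "f a = f c" "R a b" using b by (auto simp: nbhd_def)
    \<comment> \<open>Off \<open>T\<close> the vertices \<open>b'\<close>, \<open>x\<close>,
      \<open>a\<close>, \<open>b\<close> do not form an induced path, so \<open>a\<close> would be
      adjacent to \<open>b'\<close>, contrary to the choice of \<open>b'\<close>.\<close>
    have aT: "a \<in> T \<or> x \<in> T"
    proof (rule ccontr)
      assume "\<not> (a \<in> T \<or> x \<in> T)"
      then have "R a b'" using free_C[of x a b' b] 3 a b b' bC xC by auto
      then show False using a b' by (auto simp: nbhd_def)
    qed
    moreover have "x \<notin> T"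
    proof
      assume "x \<in> T"
      then have "{y. below n R T x y} = {}" by (auto simp: below_def)
      then show False using high by simp
    qed
    ultimately have aT: "a \<in> T" by simp
    show False
    proof (cases "low n R T k b")
      case True then show ?thesis using A b by auto
    next
      case False
      define Z where "Z = {z. below n R T z b \<and> z \<notin> D}"
      have fin: "finite Z" unfolding Z_def
          by (rule finite_subset[OF _ finite_below(1)[of n R T b]]) auto
      have finD: "finite D" using s by (auto simp: sol_def intro: finite_subset)
      have D: "card D \<le> 2 * k" using sol_card_touched[OF s sp(8)] by simp
      have "Z \<noteq> {}"
      proof
        assume "Z = {}"
        then have "{z. below n R T z b} \<subseteq> D" by (auto simp: Z_def)
        then have "card {z. below n R T z b} \<le> card D" using finD by (intro card_mono)
        then show False using False D by (simp add: low_def)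
      qed
      \<comment> \<open>The lowest undeleted vertex below \<open>b\<close> is low, since all
        vertices below it are deleted. It can stand in for \<open>b\<close>: it is adjacent to
        \<open>a\<close> because \<open>a\<close> lies in \<open>T\<close>, and \<open>x\<close>
        misses it by \<open>below_I\<close>.\<close>
      then obtain z where z: "z \<in> Z" "\<And>z'. z' \<in> Z \<Longrightarrow> key n R z \<le> key n R z'"
        using fin ex_min_if_finite[of "key n R ` Z"]
            by (metis (no_types, lifting) arg_min_if_finite(1) arg_min_least)
      have zb: "below n R T z b" "z \<notin> D" using z by (auto simp: Z_def)
      note zI = below_I[OF zb(1) bC xC b(2)]
      have "{w. below n R T w z} \<subseteq> D"
      proof clarify
        fix w assume w: "below n R T w z"
        show "w \<in> D"
        proof (rule ccontr)
          assume "w \<notin> D"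
          then have "w \<in> Z" using below_trans[OF w zb(1)] by (simp add: Z_def)
          then show False using z(2)[of w] w by (simp add: below_def)
        qed
      qed
      then have "card {w. below n R T w z} \<le> card D" using finD by (intro card_mono)
      then have lz: "low n R T k z" using D by (simp add: low_def)
      have "R b a" using a sp(1) by blast
      then have "R z a" using zb aT by (auto simp: below_def)
      then have "R a z" using sp(1) by blast
      then have "z \<in> nbhd C R f c" using a zI by (auto simp: nbhd_def)
      then show False using A[of z] zI zb lz by auto
    qed
  qed
qed

text \<open>Serves the exchange, where the vertex released from its class contributes the one new
  neighbourhood \<open>N\<close>, and modulo \<open>D\<close> all other classes have neighbourhoods
  that occurred before.\<close>

lemma chain_insert:
  assumes W: "\<And>c c'. c \<in> C \<Longrightarrow> c' \<in> C \<Longrightarrow> nested D (W c) (W c')"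
    and N: "\<And>c. c \<in> C \<Longrightarrow> nested D (N) (W c)"
    and V: "\<And>c. c \<in> C \<Longrightarrow> V c - D = N - D \<or> (\<exists>c'\<in>C. V c - D = W c' - D)"
    and c: "c \<in> C" "c' \<in> C"
  shows "nested D (V c) (V c')"
proof -
  define F where "F = insert (N - D) ((\<lambda>c. W c - D) ` C)"
  have "X \<subseteq> Y \<or> Y \<subseteq> X" if "X \<in> F" "Y \<in> F" for X Y
  proof -
    have "X = N - D \<or> (\<exists>c\<in>C. X = W c - D)" "Y = N - D \<or> (\<exists>c\<in>C. Y = W c - D)"
      using that by (auto simp: F_def)
    then show ?thesis
      using W N by (elim disjE bexE) blast+
  qed
  moreover have "V c - D \<in> F" "V c' - D \<in> F"
    using V[OF c(1)] V[OF c(2)] by (auto simp: F_def)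
  ultimately have "V c - D \<subseteq> V c' - D \<or> V c' - D \<subseteq> V c - D" by blast
  then show ?thesis by blast
qed

lemma sol_comparable:
  assumes s: "sol n C R f D k" and x: "nonsimp R x" "\<not> candidate n R T k x" and c: "c \<in> C"
  shows "nested D ({b. b \<notin> C \<and> R x b}) (nbhd C R f c)"
proof (rule ccontr)
  assume "\<not> ?thesis"
  then obtain b b' where b: "b' \<notin> C" "R x b'" "b' \<notin> D" "b' \<notin> nbhd C R f c"
    and b': "b \<in> nbhd C R f c" "b \<notin> D" "\<not> (b \<notin> C \<and> R x b)" by blast
  have "b \<notin> C" using b' by (simp add: nbhd_def)
  then show False using not_candidate_comparable[OF s x c, of b b'] b b' by blast
qed

text \<open>An independent neighbour of a simplicial clique vertex is adjacent to the whole clique.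
  So \<open>x\<close> contributes nothing to its class, its own neighbourhood lies within every
  other one, and a fresh label for it does not raise the cost.\<close>

lemma sol_exchange_simplicial:
  assumes s: "sol n C R f D k" and x: "x \<in> touched C f" "\<not> nonsimp R x"
  shows "\<exists>f'. sol n C R f' D k \<and> touched C f' \<subseteq> touched C f - {x}"
proof -
  have finC: "finite C" by (rule sp(8))
  have xC: "x \<in> C" using x by (simp add: touched_def)
  obtain m where m: "m \<notin> f ` C" using ex_new_if_finite[OF infinite_UNIV_nat finite_imageI[OF finC]]
      by metis
  define f' where "f' = f(x := m)"
  have m': "m \<noteq> f a" if "a \<in> C" for a using m that by auto
  have t: "touched C f' \<subseteq> touched C f - {x}"
  proof
    fix c assume "c \<in> touched C f'"
    then obtain a where a: "c \<in> C" "a \<in> C" "a \<noteq> c" "f' a = f' c" by (auto simp: touched_def)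
    have "c \<noteq> x" "a \<noteq> x" using a m'[of a] m'[of c] by (auto simp: f'_def)
    then show "c \<in> touched C f - {x}" using a by (auto simp: f'_def touched_def)
  qed
  have univ: "R c b" if c: "c \<in> C" "R x b" "b \<notin> C" for c b
  proof (cases "c = x")
    case False
    then have "R x c" using sp(5) xC c by auto
    have "c \<noteq> b" using c by auto
    then have "c < b \<or> b < c" by auto
    then show ?thesis
      using x(2) c \<open>R x c\<close> sp(1)[of b c] unfolding nonsimp_def by blast
  qed (use that in auto)
  have W: "nbhd C R f' c = nbhd C R f c" if "c \<in> C" "c \<noteq> x" for c
  proof (intro set_eqI iffI)
    fix b assume "b \<in> nbhd C R f c"
    then obtain a where a: "b \<notin> C" "a \<in> C" "f a = f c" "R a b" by (auto simp: nbhd_def)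
    show "b \<in> nbhd C R f' c"
    proof (cases "a = x")
      case True
      then have "R c b" using univ a that by auto
      then show ?thesis using a that by (auto simp: nbhd_def)
    next
      case False
      then show ?thesis using a that by (auto simp: nbhd_def f'_def)
    qed
  next
    fix b assume "b \<in> nbhd C R f' c"
    then show "b \<in> nbhd C R f c" using that m' by (auto simp: nbhd_def f'_def split: if_splits)
  qed
  have Wx: "nbhd C R f' x \<subseteq> nbhd C R f' c" if "c \<in> C" for c
  proof
    fix b assume "b \<in> nbhd C R f' x"
    then obtain a where "b \<notin> C" "a \<in> C" "f' a = f' x" "R a b" by (auto simp: nbhd_def)
    then have "R x b" "b \<notin> C" using m' by (auto simp: f'_def split: if_splits)
    then show "b \<in> nbhd C R f' c" using univ that by (auto simp: nbhd_def)
  qed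
  have ch: "nested D (nbhd C R f' c) (nbhd C R f' c')" if "c \<in> C" "c' \<in> C" for c c'
  proof (cases "c = x \<or> c' = x")
    case True then show ?thesis using Wx that by blast
  next
    case False then show ?thesis using W s that by (auto simp: sol_def)
  qed
  obtain y where y: "y \<in> C" "y \<noteq> x" "f y = f x" using x by (auto simp: touched_def)
  have "f ` C \<subseteq> f' ` C"
  proof clarify
    fix a assume "a \<in> C"
    then show "f a \<in> f' ` C" using y by (cases "a = x") (force simp: f'_def intro: rev_image_eqI)+
  qed
  then have "card (f ` C) \<le> card (f' ` C)" using finC by (intro card_mono) auto
  then have "sol n C R f' D k" using s ch by (auto simp: sol_def)
  then show ?thesis using t by blast
qed

text \<open>
  Here \<open>x\<close> is exchanged with an untouched vertex \<open>y\<close> above it. The class of \<open>x\<close> then gets the union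
  of its old neighbourhood and that of \<open>y\<close>, which is one of the two by the chain condition.
\<close>

lemma sol_exchange:
  assumes s: "sol n C R f D k" and x: "x \<in> touched C f" "nonsimp R x" "\<not> candidate n R T k x"
  shows "\<exists>f' y. sol n C R f' D k \<and> candidate n R T k y \<and> touched C f' \<subseteq> insert y (touched C f - {x})"
proof -
  have finC: "finite C" by (rule sp(8))
  have xC: "x \<in> C" using x by (simp add: touched_def)
  define Y where "Y = {y. below n R T x y \<and> y \<in> C \<and> y \<notin> touched C f}"
  have "2 * k < card {y. below n R T x y}" using x(3) by (auto simp: candidate_def)
  then have "Y \<noteq> {}" using below_ex_untouched[OF s x(2), of "\<lambda>_. True"] by (auto simp: Y_def)
  moreover have "finite Y" unfolding Y_def by simp
  ultimately have "finite (key n R ` Y)" "key n R ` Y \<noteq> {}" by auto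
  \<comment> \<open>Maximality makes \<open>y\<close> a candidate: every vertex above it in its type
    is touched, so there are at most \<open>2 * k\<close> of them.\<close>
  from Max_in[OF this] Max_ge[OF this(1)] obtain y where
    y: "y \<in> Y" "\<And>y'. y' \<in> Y \<Longrightarrow> key n R y' \<le> key n R y" by auto
  have xy: "below n R T x y" "y \<in> C" "y \<notin> touched C f" using y by (auto simp: Y_def)
  have xney: "x \<noteq> y" using x xy by auto
  have cy: "candidate n R T k y"
  proof -
    have "{w. below n R T y w} \<subseteq> touched C f"
    proof clarify
      fix w assume w: "below n R T y w"
      show "w \<in> touched C f"
      proof (rule ccontr)
        assume "w \<notin> touched C f"
        moreover have "below n R T x w" using xy w below_trans by blast
        moreover have "w \<in> C" using nonsimp_C[of w] x(2) \<open>below n R T x w\<close> by (auto simp: below_def)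
        ultimately have "w \<in> Y" by (simp add: Y_def)
        then show False using y(2)[of w] w by (simp add: below_def)
      qed
    qed
    then have "card {w. below n R T y w} \<le> card (touched C f)"
      using finC by (intro card_mono) (auto simp: touched_def)
    then show ?thesis using sol_card_touched[OF s finC] by (simp add: candidate_def)
  qed
  \<comment> \<open>Swapping two labels preserves the number of classes, and \<open>x\<close>
    inherits the singleton class of the untouched \<open>y\<close>.\<close>
  define f' where "f' = f(x := f y, y := f x)"
  define N where "N = {b. b \<notin> C \<and> R x b}"
  have Nxy: "R y b" if "b \<notin> C" "R x b" for b using below_C[OF xy(1) x(2)] that by auto
  have fy: "a = y" if "a \<in> C" "f a = f y" for a using xy that by (auto simp: touched_def)
  have fxy: "f x \<noteq> f y" using fy xC xney by auto
  have Wy: "nbhd C R f y = {b. b \<notin> C \<and> R y b}" using nbhd_untouched xy by auto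
  have t: "touched C f' \<subseteq> insert y (touched C f - {x})"
  proof
    fix c assume "c \<in> touched C f'"
    then obtain a where a: "c \<in> C" "a \<in> C" "a \<noteq> c" "f' a = f' c" by (auto simp: touched_def)
    have "c \<noteq> x" using a fy[of a] fxy by (auto simp: f'_def split: if_splits)
    moreover have "\<exists>a\<in>C. a \<noteq> c \<and> f a = f c" if "c \<noteq> x" "c \<noteq> y"
    proof (cases "a = y")
      case True
      then show ?thesis using that a xC xney by (intro bexI[of _ x]) (auto simp: f'_def)
    next
      case False
      then show ?thesis using that a fy[of c]
          by (intro bexI[of _ a]) (auto simp: f'_def split: if_splits)
    qed
    ultimately show "c \<in> insert y (touched C f - {x})" using a(1) by (auto simp: touched_def)
  qed
  have V1: "nbhd C R f' x = N"
    using xC xney fy fxy unfolding nbhd_def N_def f'_def by (auto split: if_splits)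
  have V2: "nbhd C R f' c = nbhd C R f x \<union> nbhd C R f y" if c: "c \<in> C" "f' c = f x" for c
  proof (intro set_eqI iffI)
    fix b assume "b \<in> nbhd C R f' c"
    then obtain a where a: "b \<notin> C" "a \<in> C" "f' a = f x" "R a b" using c by (auto simp: nbhd_def)
    then show "b \<in> nbhd C R f x \<union> nbhd C R f y"
      using xC xy fxy by (auto simp: nbhd_def f'_def split: if_splits)
  next
    fix b assume "b \<in> nbhd C R f x \<union> nbhd C R f y"
    then consider a where "b \<notin> C" "a \<in> C" "f a = f x" "R a b" | "b \<notin> C" "R y b"
      unfolding Wy by (auto simp: nbhd_def)
    then show "b \<in> nbhd C R f' c"
    proof cases
      case (1 a)
      show ?thesis
      proof (cases "a = x")
        case True
        then have "R y b" using Nxy 1 by auto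
        then show ?thesis using 1 xy c by (auto simp: nbhd_def f'_def intro!: bexI[of _ y])
      next
        case False
        then have "f' a = f' c" using 1 fxy c by (auto simp: f'_def)
        then show ?thesis using 1 by (auto simp: nbhd_def)
      qed
    next
      case 2
      then show ?thesis using xy c by (auto simp: nbhd_def f'_def intro!: bexI[of _ y])
    qed
  qed
  have V3: "nbhd C R f' c = nbhd C R f c" if c: "c \<in> C" "c \<noteq> x" "f' c \<noteq> f x" for c
  proof -
    have "c \<noteq> y" using c by (auto simp: f'_def)
    then have "f c \<noteq> f x" "f c \<noteq> f y" "f' c = f c" using c fy by (auto simp: f'_def)
    then have "(f' a = f' c) = (f a = f c)" for a by (auto simp: f'_def)
    then show ?thesis by (simp add: nbhd_def)
  qed
  have W: "nested D (nbhd C R f c) (nbhd C R f c')" if "c \<in> C" "c' \<in> C" for c c'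
    using s that by (auto simp: sol_def)
  have V: "nbhd C R f' c - D = N - D \<or> (\<exists>c'\<in>C. nbhd C R f' c - D = nbhd C R f c' - D)"
      if c: "c \<in> C" for c
  proof -
    consider "c = x" | "f' c = f x" | "c \<noteq> x" "f' c \<noteq> f x" by blast
    then show ?thesis
    proof cases
      case 2
      have "nbhd C R f' c - D = nbhd C R f x - D \<or> nbhd C R f' c - D = nbhd C R f y - D"
        unfolding V2[OF c 2] using W[OF xC xy(2)] by blast
      then show ?thesis using xC xy by blast
    qed (use V1 V3 c in auto)
  qed
  have ch: "nested D (nbhd C R f' c) (nbhd C R f' c')" if "c \<in> C" "c' \<in> C" for c c'
    by (rule chain_insert[where W = "nbhd C R f" and N = N])
      (use W V that sol_comparable[OF s x(2,3)] in \<open>auto simp: N_def\<close>)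
  have "f' ` C = f ` C"
    using xC xy xney by (auto simp: f'_def image_iff)
  then have "sol n C R f' D k" using s ch by (auto simp: sol_def)
  then show ?thesis using t cy by blast
qed

text \<open>Either exchange releases one touched non-candidate and touches at most one new vertex,
  which is a candidate, so the number of offending vertices drops.\<close>

theorem sol_candidates:
  assumes "sol n C R f D k"
  shows "\<exists>f'. sol n C R f' D k \<and> (\<forall>x\<in>touched C f'. candidate n R T k x)"
  using assms
proof (induction "card {x\<in>touched C f. \<not> candidate n R T k x}" arbitrary: f rule: less_induct)
  case less
  show ?case
  proof (cases "\<forall>x\<in>touched C f. candidate n R T k x")
    case True then show ?thesis using less by blast
  next
    case False
    then obtain x where x: "x \<in> touched C f" "\<not> candidate n R T k x" by auto
    have "\<exists>f'. sol n C R f' D k \<and> {x\<in>touched C f'. \<not> candidate n R T k x} \<subseteq> {x\<in>touched C f. \<not> candidate n R T k x} - {x}"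
      using sol_exchange_simplicial[OF less(2) x(1)] sol_exchange[OF less(2) x(1) _ x(2)] by blast
    then obtain f' where f': "sol n C R f' D k"
      "{x\<in>touched C f'. \<not> candidate n R T k x} \<subseteq> {x\<in>touched C f. \<not> candidate n R T k x} - {x}"
          by blast
    moreover have fin: "finite {x\<in>touched C f. \<not> candidate n R T k x}" using sp(8)
        by (simp add: touched_def)
    ultimately have "{x\<in>touched C f'. \<not> candidate n R T k x} \<subset> {x\<in>touched C f. \<not> candidate n R T k x}" using x by blast
    then have "card {x\<in>touched C f'. \<not> candidate n R T k x} < card {x\<in>touched C f. \<not> candidate n R T k x}"
      using fin by (simp add: psubset_card_mono)
    then show ?thesis using less(1) f' by blast
  qed
qed

end

section \<open>The algorithm\<close>

text \<open>The default \<open>[0, 0, 0, 0]\<close> is harmless: \<open>algstep\<close> never contracts a loop.\<close>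

definition search :: "nat \<Rightarrow> rel2 \<Rightarrow> nat \<times> nat list" where
  "search n R = fold (\<lambda>a. fold (\<lambda>b. fold (\<lambda>c. fold (\<lambda>d q.
     if p4 R a b c d then (1, [a, b, c, d]) else q) [0..<n]) [0..<n]) [0..<n]) [0..<n] (0, [0, 0, 0, 0])"

definition searches :: "('q \<Rightarrow> bool) \<Rightarrow> ('q \<Rightarrow> 'q) \<Rightarrow> bool \<Rightarrow> bool" where
  "searches P g E \<longleftrightarrow> (\<forall>q. if E then P (g q) else g q = q)"

text \<open>A fold of such steps is such a step again, so all four levels of the search are handled
  alike. \<open>searches\<close> ranges over all states because a later hit may overwrite an earlier
  one.\<close>

lemma searches_fold:
  assumes "\<And>x. x \<in> set xs \<Longrightarrow> searches P (g x) (E x)"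
  shows "searches P (fold g xs) (\<exists>x\<in>set xs. E x)"
  using assms
proof (induction xs)
  case Nil
  then show ?case by (simp add: searches_def)
next
  case (Cons x xs)
  then have "searches P (fold g xs) (\<exists>x\<in>set xs. E x)" "searches P (g x) (E x)" by auto
  then show ?case
    by (cases "\<exists>x\<in>set xs. E x"; cases "E x") (simp_all add: searches_def)
qed

lemma search_cases:
  obtains "search n R = (0, [0, 0, 0, 0])" "\<And>a b c d. a < n \<Longrightarrow> b < n \<Longrightarrow> c < n \<Longrightarrow> d < n \<Longrightarrow> \<not> p4 R a b c d"
  | a b c d where "a < n" "b < n" "c < n" "d < n" "search n R = (1, [a, b, c, d])" "p4 R a b c d"
proof -
  define P where "P q \<longleftrightarrow> (\<exists>a<n. \<exists>b<n. \<exists>c<n. \<exists>d<n. q = (1::nat, [a, b, c, d]) \<and> p4 R a b c d)" for q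
  have "searches P (\<lambda>q. if p4 R a b c d then (1, [a, b, c, d]) else q) (p4 R a b c d)"
    if "a \<in> set [0..<n]" "b \<in> set [0..<n]" "c \<in> set [0..<n]" "d \<in> set [0..<n]" for a b c d
    using that unfolding searches_def P_def by auto
  then have "searches P (fold (\<lambda>a. fold (\<lambda>b. fold (\<lambda>c. fold (\<lambda>d q.
     if p4 R a b c d then (1, [a, b, c, d]) else q) [0..<n]) [0..<n]) [0..<n]) [0..<n])
     (\<exists>a\<in>set [0..<n]. \<exists>b\<in>set [0..<n]. \<exists>c\<in>set [0..<n]. \<exists>d\<in>set [0..<n]. p4 R a b c d)"
    by (intro searches_fold)
  then have *: "if \<exists>a\<in>set [0..<n]. \<exists>b\<in>set [0..<n]. \<exists>c\<in>set [0..<n]. \<exists>d\<in>set [0..<n]. p4 R a b c d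
     then P (search n R) else search n R = (0, [0, 0, 0, 0])"
    unfolding searches_def search_def by blast
  show thesis
  proof (cases "\<exists>a\<in>set [0..<n]. \<exists>b\<in>set [0..<n]. \<exists>c\<in>set [0..<n]. \<exists>d\<in>set [0..<n]. p4 R a b c d")
    case True
    then have "P (search n R)" using * by simp
    then show thesis unfolding P_def using that(2) by blast
  next
    case False
    then have "search n R = (0, [0, 0, 0, 0])" using * by simp
    moreover have "\<not> p4 R a b c d" if "a < n" "b < n" "c < n" "d < n" for a b c d
    proof -
      have "a \<in> set [0..<n]" "b \<in> set [0..<n]" "c \<in> set [0..<n]" "d \<in> set [0..<n]" using that
          by simp_all
      then show ?thesis using False by blast
    qed
    ultimately show thesis by (rule that(1))
  qed
qed

lemma p4_less:
  assumes "splits n C R" "p4 R a b c d"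
  shows "a < n \<and> b < n \<and> c < n \<and> d < n"
  using splD(2,3)[OF assms(1), of a b] splD(2,3)[OF assms(1), of c d] assms(2) by (simp add: p4_def)

lemma search_p4_free:
  assumes "splits n C R"
  shows "fst (search n R) = 0 \<longleftrightarrow> (\<forall>a b c d. \<not> p4 R a b c d)"
proof (rule search_cases[of n R])
  assume *: "search n R = (0, [0, 0, 0, 0])"
    "\<And>a b c d. a < n \<Longrightarrow> b < n \<Longrightarrow> c < n \<Longrightarrow> d < n \<Longrightarrow> \<not> p4 R a b c d"
  have "\<not> p4 R a b c d" for a b c d using p4_less[OF assms] *(2) by blast
  then show ?thesis using *(1) by simp
next
  fix a b c d assume "search n R = (1, [a, b, c, d])" "p4 R a b c d"
  then show ?thesis by auto
qed

section \<open>Simulating a sequence of contractions\<close>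

definition algstep :: "nat \<Rightarrow> nat list \<Rightarrow> nat \<Rightarrow> nat \<Rightarrow> rel2 \<Rightarrow> nat \<Rightarrow> nat \<Rightarrow> bool" where
  "algstep n cl x y R = (let l = snd (search n R) @ cl in if R (l ! x) (l ! y) then contr R (l ! x) (l ! y) else R)"

primrec simul :: "nat \<Rightarrow> nat list \<Rightarrow> (nat \<Rightarrow> nat) \<Rightarrow> rel2 \<Rightarrow> nat \<Rightarrow> nat \<Rightarrow> nat \<Rightarrow> bool" where
  "simul n cl g R 0 = R"
| "simul n cl g R (Suc i) = algstep n cl (g (i + i)) (g (Suc (i + i))) (simul n cl g R i)"

lemma simul_cong: "(\<And>p. p < i + i \<Longrightarrow> g p = h p) \<Longrightarrow> simul n cl g R i = simul n cl h R i"
  by (induction i) auto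

text \<open>The edge test in \<open>algstep\<close> turns every pair of digits into a genuine
  contraction or an idle round. Hence \<open>cl\<close> and \<open>g\<close> are arbitrary here;
  their choice matters for completeness only.\<close>

lemma simul_sound:
  assumes "repr H0 A R" "splits n C R"
  shows "\<exists>j\<le>i. \<exists>H A' C'. (contract_edge ^^ j) H0 H \<and> repr H A' (simul n cl g R i) \<and>
      splits n C' (simul n cl g R i)"
proof (induction i)
  case 0
  show ?case using assms by (intro exI[of _ 0] conjI exI[of _ H0] exI[of _ A] exI[of _ C]) auto
next
  case (Suc i)
  then obtain j H A' C' where j: "j \<le> i" "(contract_edge ^^ j) H0 H" "repr H A' (simul n cl g R i)"
    "splits n C' (simul n cl g R i)" by blast
  define R' where "R' = simul n cl g R i"
  define l where "l = snd (search n R') @ cl"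
  define u v where "u = l ! g (i + i)" and "v = l ! g (Suc (i + i))"
  have eq: "simul n cl g R (Suc i) = (if R' u v then contr R' u v else R')"
    by (simp add: algstep_def R'_def l_def u_def v_def Let_def)
  show ?case
  proof (cases "R' u v")
    case True
    obtain H' where H': "contract_edge H H'" "repr H' (A' - {v}) (contr R' u v)"
      using repr_contr[OF j(3)] True R'_def by blast
    have "(contract_edge ^^ Suc j) H0 H'" using relpowp_Suc_I[OF j(2) H'(1)] .
    moreover have "splits n (insert u C' - {v}) (contr R' u v)" using splits_contr j(4) True R'_def
        by blast
    moreover have "Suc j \<le> Suc i" using j by simp
    moreover have "simul n cl g R (Suc i) = contr R' u v" using eq True by simp
    ultimately show ?thesis using H'(2)
      by (intro exI[of _ "Suc j"] conjI exI[of _ H'] exI[of _ "A' - {v}"] exI[of _ "insert u C' - {v}"])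
        (simp_all only:)
  next
    case False
    then have "simul n cl g R (Suc i) = simul n cl g R i" using eq R'_def by simp
    then show ?thesis using j
      by (intro exI[of _ j] conjI exI[of _ H] exI[of _ A'] exI[of _ C']) (simp_all only: le_SucI)
  qed
qed

text \<open>The list \<open>cl\<close> is computed once for the input graph but must serve after
  every contraction. This works because merged vertices keep old names and the set of touched
  vertices only shrinks.\<close>

definition solvable :: "nat \<Rightarrow> nat list \<Rightarrow> nat \<Rightarrow> rel2 \<Rightarrow> bool" where
  "solvable n cl j R \<longleftrightarrow> (\<exists>C f D. splits n C R \<and> sol n C R f D j \<and> touched C f \<subseteq> set cl)"

lemma solvable_p4_free:
  assumes "splits n C R" "\<And>a b c d. \<not> p4 R a b c d"
  shows "solvable n cl j R"
proof -
  note sp = splD[OF assms(1)]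
  have t: "touched C id = {}" by (auto simp: touched_def)
  have nb: "nbhd C R id c = {b. b \<notin> C \<and> R c b}" if "c \<in> C" for c
    using nbhd_untouched[of c C id R] that t by simp
  have "nested {} (nbhd C R id c) (nbhd C R id c')" if c: "c \<in> C" "c' \<in> C" for c c'
  proof (rule ccontr)
    assume "\<not> ?thesis"
    then obtain b b' where b: "b \<notin> C" "R c b" "\<not> R c' b" "b' \<notin> C" "R c' b'" "\<not> R c b'"
      using nb c by auto
    then have "R c c'" using sp(5) c by blast
    moreover have "\<not> R b b'" using sp(6) b by blast
    ultimately show False using assms(2)[of c b c' b'] b by (simp add: p4_def)
  qed
  then have "sol n C R id {} j" by (simp add: sol_def)
  then show ?thesis using assms(1) t unfolding solvable_def by blast
qed

lemma solvable_0:
  assumes "solvable n cl 0 R"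
  shows "fst (search n R) = 0"
proof -
  obtain C f D where s: "splits n C R" "sol n C R f D 0" using assms by (auto simp: solvable_def)
  have fin: "finite C" using splD(8)[OF s(1)] .
  have "D = {}" using s(2) by (auto simp: sol_def finite_subset)
  moreover have "touched C f = {}"
    using sol_card_touched[OF s(2) fin] fin by (auto simp: touched_def)
  ultimately show ?thesis using p4_sol[OF s] search_p4_free[OF s(1)] by auto
qed

text \<open>The vertex \<open>v\<close> leaves the clique as an isolated vertex and hands its
  neighbours to \<open>u\<close> in the same class. Labels and class neighbourhoods persist while
  the clique loses a vertex, which saves one unit of cost.\<close>

lemma sol_merge:
  assumes splits: "splits n C R" and s: "sol n C R f D (Suc j)" and uv: "u \<in> C" "v \<in> C" "u \<noteq> v"
      "f u = f v"
  shows "splits n (C - {v}) (contr R u v)" "sol n (C - {v}) (contr R u v) f D j"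
      "touched (C - {v}) f \<subseteq> touched C f"
proof -
  note sp = splD[OF splits]
  have "R u v" using sp(5) uv by blast
  then show "splits n (C - {v}) (contr R u v)" using splits_contr_C[OF splits _ uv(1)] by blast
  show "touched (C - {v}) f \<subseteq> touched C f" by (auto simp: touched_def)
  have nb: "nbhd (C - {v}) (contr R u v) f c = nbhd C R f c" if c: "c \<in> C - {v}" for c
  proof (intro set_eqI iffI)
    fix b assume "b \<in> nbhd (C - {v}) (contr R u v) f c"
    then obtain a where a: "b \<notin> C - {v}" "a \<in> C" "a \<noteq> v" "f a = f c" "contr R u v a b"
      by (auto simp: nbhd_def)
    then have "b \<noteq> v" "R a b \<or> a = u \<and> R v b" using uv by (auto simp: contr_def)
    then show "b \<in> nbhd C R f c" using a uv by (auto simp: nbhd_def)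
  next
    fix b assume "b \<in> nbhd C R f c"
    then obtain a where a: "b \<notin> C" "a \<in> C" "f a = f c" "R a b" by (auto simp: nbhd_def)
    show "b \<in> nbhd (C - {v}) (contr R u v) f c"
    proof (cases "a = v")
      case True
      then have "contr R u v u b" using a uv by (auto simp: contr_def)
      then show ?thesis using a uv True by (auto simp: nbhd_def)
    next
      case False
      then have "contr R u v a b" using a uv by (auto simp: contr_def)
      then show ?thesis using a False by (auto simp: nbhd_def)
    qed
  qed
  have "f x \<in> f ` (C - {v})" if "x \<in> C" for x
    using uv that by (cases "x = v") (auto intro: rev_image_eqI[of u])
  then have "f ` (C - {v}) = f ` C" by blast
  moreover have "card (C - {v}) = card C - 1" using uv sp(8) by simp
  moreover have "card (f ` C) < card C"
  proof -
    have "card (f ` C) = card (f ` (C - {v}))" using \<open>f ` (C - {v}) = f ` C\<close> by simp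
    also have "\<dots> \<le> card (C - {v})" using sp(8) by (intro card_image_le) auto
    also have "\<dots> < card C" using uv sp(8) by (intro psubset_card_mono) auto
    finally show ?thesis .
  qed
  moreover have "v \<notin> D" using s uv by (auto simp: sol_def)
  ultimately show "sol n (C - {v}) (contr R u v) f D j"
    using s nb unfolding sol_def by auto
qed

text \<open>All neighbours of \<open>b\<close> lie in the clique and are thus equal or adjacent to
  \<open>a\<close> already, so contracting this edge amounts to deleting \<open>b\<close>.\<close>

lemma sol_delete:
  assumes splits: "splits n C R" and s: "sol n C R f D (Suc j)" and ab: "a \<in> C" "b \<in> D" "R a b"
  shows "splits n C (contr R a b)" "sol n C (contr R a b) f (D - {b}) j"
proof -
  note sp = splD[OF splits]
  have bC: "b \<notin> C" using s ab by (auto simp: sol_def)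
  then show "splits n C (contr R a b)" using splits_contr_C[OF splits ab(3,1)] by simp
  have "contr R a b x y \<longleftrightarrow> R x y \<and> y \<noteq> b" if "x \<in> C" "y \<notin> C" for x y
    using that bC ab(1) sp(6)[of b y] sp(4)[of x] by (auto simp: contr_def)
  then have nb: "nbhd C (contr R a b) f c = nbhd C R f c - {b}" for c
    unfolding nbhd_def by blast
  have fin: "finite D" using s by (auto simp: sol_def intro: finite_subset)
  then have "card (D - {b}) = card D - 1" "card D > 0" using ab by (auto simp: card_gt_0_iff)
  then have "(card C - card (f ` C)) + card (D - {b}) \<le> j" "D - {b} \<subseteq> {..<n} - C"
    using s by (auto simp: sol_def)
  moreover have "nbhd C R f c - {b} - (D - {b}) \<subseteq> nbhd C R f c' - {b} \<or>
      nbhd C R f c' - {b} - (D - {b}) \<subseteq> nbhd C R f c - {b}"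
    if "c \<in> C" "c' \<in> C" for c c'
  proof -
    have "nested D (nbhd C R f c) (nbhd C R f c')"
      using s that unfolding sol_def by blast
    then show ?thesis using ab(2) by blast
  qed
  ultimately show "sol n C (contr R a b) f (D - {b}) j"
    unfolding sol_def nb by blast
qed

text \<open>Any two members of a class may be contracted at once. When all classes are singletons,
  the path found must have its end \<open>b\<close> or \<open>d\<close> in \<open>D\<close>, and the
  digits 0, 1 or 2, 3 contract the corresponding end edge.\<close>

lemma solvable_step:
  assumes "solvable n cl (Suc j) R"
  shows "\<exists>x<4 + length cl. \<exists>y<4 + length cl. solvable n cl j (algstep n cl x y R)"
proof -
  obtain C f D where s: "splits n C R" "sol n C R f D (Suc j)" "touched C f \<subseteq> set cl"
    using assms by (auto simp: solvable_def)
  note sp = splD[OF s(1)]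
  show ?thesis
  proof (rule search_cases[of n R])
    assume *: "search n R = (0, [0, 0, 0, 0])" "\<And>a b c d. a < n \<Longrightarrow> b < n \<Longrightarrow> c < n \<Longrightarrow> d < n \<Longrightarrow>
        \<not> p4 R a b c d"
    have "solvable n cl j R" using solvable_p4_free[OF s(1)] p4_less[OF s(1)] *(2) by blast
    \<comment> \<open>The number of rounds is fixed; a round left over after success idles on equal
      digits.\<close>
    moreover have "algstep n cl 0 0 R = R" using *(1) sp(4) by (simp add: algstep_def)
    ultimately show ?thesis by (intro exI[of _ 0] conjI) auto
  next
    fix a b c d assume q: "search n R = (1, [a, b, c, d])" "p4 R a b c d"
    show ?thesis
    proof (cases "touched C f = {}")
      case False
      then obtain u v where uv: "u \<in> C" "v \<in> C" "u \<noteq> v" "f u = f v" by (auto simp: touched_def)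
      then have "u \<in> touched C f" "v \<in> touched C f" by (force simp: touched_def)+
      then have "u \<in> set cl" "v \<in> set cl" using s(3) by auto
      then obtain x y where xy: "x < length cl" "cl ! x = u" "y < length cl" "cl ! y = v"
        by (metis in_set_conv_nth)
      have "R u v" using sp(5) uv by blast
      then have "algstep n cl (4 + x) (4 + y) R = contr R u v"
        using q(1) xy by (simp add: algstep_def nth_append)
      moreover have "solvable n cl j (contr R u v)"
        unfolding solvable_def using sol_merge[OF s(1,2) uv] s(3) by blast
      ultimately show ?thesis using xy by (intro exI[of _ "4 + x"] conjI exI[of _ "4 + y"]) auto
    next
      case True
      have p: "R a b" "R c d" using q(2) by (auto simp: p4_def)
      note pC = p4_split[OF s(1) q(2)]
      have "b \<in> D \<or> d \<in> D"
        using p4_sol[OF s(1,2) q(2)] True pC s(2) by (auto simp: sol_def)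
      then show ?thesis
      proof
        assume "b \<in> D"
        then have "solvable n cl j (contr R a b)"
          unfolding solvable_def using sol_delete[OF s(1,2) pC(1) _ p(1)] s(3) by blast
        moreover have "algstep n cl 0 1 R = contr R a b" using q(1) p by (simp add: algstep_def)
        ultimately show ?thesis by (intro exI[of _ 0] conjI exI[of _ 1]) auto
      next
        assume "d \<in> D"
        then have "solvable n cl j (contr R c d)"
          unfolding solvable_def using sol_delete[OF s(1,2) pC(2) _ p(2)] s(3) by blast
        moreover have "algstep n cl 2 3 R = contr R c d" using q(1) p by (simp add: algstep_def)
        ultimately show ?thesis by (intro exI[of _ 2] conjI exI[of _ 3]) auto
      qed
    qed
  qed
qed

lemma solvable_simul:
  assumes "solvable n cl k R" "i \<le> k"
  shows "\<exists>g. (\<forall>p. g p < 4 + length cl) \<and> solvable n cl (k - i) (simul n cl g R i)"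
  using assms(2)
proof (induction i)
  case 0
  then show ?case using assms(1) by (intro exI[of _ "\<lambda>_. 0"]) simp
next
  case (Suc i)
  then obtain g where g: "\<forall>p. g p < 4 + length cl" "solvable n cl (k - i) (simul n cl g R i)" by auto
  have "k - i = Suc (k - Suc i)" using Suc by simp
  then obtain x y where xy: "x < 4 + length cl" "y < 4 + length cl"
    "solvable n cl (k - Suc i) (algstep n cl x y (simul n cl g R i))"
    using solvable_step g(2) by metis
  define h where "h = g(i + i := x, Suc (i + i) := y)"
  have "simul n cl h R i = simul n cl g R i" by (rule simul_cong) (simp add: h_def)
  then have "solvable n cl (k - Suc i) (simul n cl h R (Suc i))" using xy by (simp add: h_def)
  moreover have "\<forall>p. h p < 4 + length cl" using g xy by (simp add: h_def)
  ultimately show ?case by blast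
qed

section \<open>From contractions of the input graph to solutions\<close>

definition adjr :: "nat \<Rightarrow> nat set set \<Rightarrow> nat \<Rightarrow> nat \<Rightarrow> bool" where
  "adjr n E x y \<longleftrightarrow> {x, y} \<in> E"

lemma simple_graphD:
  assumes "simple_graph ({0..<n}, E)"
  shows "e \<in> E \<Longrightarrow> e \<subseteq> {0..<n}" "e \<in> E \<Longrightarrow> card e = 2" "{x, y} \<in> E \<Longrightarrow> x < n \<and> y < n \<and> x \<noteq> y"
  using assms by (fastforce simp: simple_graph_def card_2_iff)+

text \<open>If a clique vertex \<open>c\<close> has no neighbour outside the clique, moving it to
  the independent side repairs all others at once, as each of them is adjacent to
  \<open>c\<close>.\<close>

lemma splits_exists:
  assumes g: "simple_graph ({0..<n}, E)" "split_graph ({0..<n}, E)"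
  shows "\<exists>C. splits n C (adjr n E) \<and> (\<forall>c\<in>C. \<exists>b. b \<notin> C \<and> adjr n E c b)"
proof -
  note sg = simple_graphD[OF g(1)]
  obtain C I where CI: "C \<union> I = {0..<n}" "C \<inter> I = {}" "clique C E" "indep I E"
    using g(2) by (auto simp: split_graph_def)
  have CI1: "x \<in> C \<union> I" if "x < n" for x using that unfolding CI(1) by simp
  have ind: "\<not> adjr n E x y" if "x \<notin> C" "y \<notin> C" for x y
  proof
    assume a: "adjr n E x y"
    then have "x < n \<and> y < n \<and> x \<noteq> y" using sg(3)[of x y] by (simp add: adjr_def)
    then have "x \<in> I" "y \<in> I" "x \<noteq> y" using CI1[of x] CI1[of y] that by auto
    then show False using a CI(4) by (auto simp: indep_def adjr_def)
  qed
  have cl: "adjr n E x y" if "x \<in> C" "y \<in> C" "x \<noteq> y" for x y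
    using CI(3) that by (auto simp: clique_def adjr_def)
  have sym: "symp (adjr n E)" by (auto simp: symp_def adjr_def insert_commute)
  have "C \<subseteq> C \<union> I" by simp
  then have C: "C \<subseteq> {..<n}" unfolding CI(1) by (simp add: lessThan_atLeast0)
  show ?thesis
  proof (cases "\<forall>c\<in>C. \<exists>b. b \<notin> C \<and> adjr n E c b")
    case True
    moreover have "splits n C (adjr n E)"
      unfolding splits_def using C sym ind cl sg(3) by (auto simp: adjr_def)
    ultimately show ?thesis by blast
  next
    case False
    then obtain c where c: "c \<in> C" "\<And>b. b \<notin> C \<Longrightarrow> \<not> adjr n E c b" by auto
    have "\<not> adjr n E x y" if xy: "x \<notin> C - {c}" "y \<notin> C - {c}" for x y
    proof -
      consider "x = c" "y = c" | "x = c" "y \<notin> C" | "y = c" "x \<notin> C" | "x \<notin> C" "y \<notin> C" using xy by blast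
      then show ?thesis
      proof cases
        case 1 then show ?thesis using sg(3)[of c c] by (auto simp: adjr_def)
      next
        case 3 then show ?thesis using c(2)[of x] sympD[OF sym, of x y] by auto
      qed (use c ind in auto)
    qed
    then have "splits n (C - {c}) (adjr n E)"
      unfolding splits_def using C sym cl sg(3) by (auto simp: adjr_def)
    moreover have "\<exists>b. b \<notin> C - {c} \<and> adjr n E x b" if "x \<in> C - {c}" for x
      using cl[of x c] that c(1) by auto
    ultimately show ?thesis by blast
  qed
qed

lemma repr_adjr:
  assumes "simple_graph ({0..<n}, E)"
  shows "repr ({0..<n}, E) {..<n} (adjr n E)"
proof -
  note sg = simple_graphD[OF assms]
  have "E = {{x, y} |x y. {x, y} \<in> E}"
  proof (intro set_eqI iffI)
    fix e assume e: "e \<in> E"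
    then obtain x y where "e = {x, y}" using sg(2)[OF e] by (auto simp: card_2_iff)
    then show "e \<in> {{x, y} |x y. {x, y} \<in> E}" using e by blast
  qed blast
  moreover have "symp (adjr n E)" by (auto simp: symp_def adjr_def insert_commute)
  moreover have "bij_betw id {..<n} {0..<n}" by (simp add: lessThan_atLeast0)
  ultimately show ?thesis
    unfolding repr_def using sg(3) by (intro conjI exI[of _ id]) (auto simp: adjr_def)
qed

text \<open>The quotient map is the labelling, and \<open>D\<close> collects the independent
  vertices merged with any other vertex. An independent vertex outside \<open>D\<close> is alone in
  its fibre, so its adjacency in the quotient is membership in a class neighbourhood, and an
  incomparability would be a pattern forbidden in threshold graphs.\<close>

lemma sol_of_contraction:
  assumes g: "simple_graph ({0..<n}, E)" and splits: "splits n C (adjr n E)"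
    and H: "(contract_edge ^^ j) ({0..<n}, E) H" "threshold_graph H" "j \<le> k"
  shows "\<exists>f D. sol n C (adjr n E) f D k"
proof -
  note sg = simple_graphD[OF g]
  note sp = splD[OF splits]
  obtain W F where WF: "H = (W, F)" by (cases H)
  obtain h where q: "quot ({0..<n}, E) (W, F) h" and cd: "n = j + card W"
    using quot_contract_edges[OF H(1)] sg WF by auto
  have W: "W = h ` {0..<n}" and F: "F = {{h x, h y} |x y. {x, y} \<in> E \<and> h x \<noteq> h y}"
    and fib: "\<And>x y. x < n \<Longrightarrow> y < n \<Longrightarrow> x \<noteq> y \<Longrightarrow> h x = h y \<Longrightarrow> \<exists>z. {x, z} \<in> E \<and> h z = h x"
    using q by (auto simp: quot_def)
  define I where "I = {..<n} - C"
  define D where "D = {b\<in>I. \<exists>x<n. x \<noteq> b \<and> h x = h b}"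
  have I1: "x = b" if "b \<in> I - D" "x < n" "h x = h b" for b x using that by (auto simp: D_def)
  have edge: "{h c, h b} \<in> F \<longleftrightarrow> b \<in> nbhd C (adjr n E) h c" if c: "c \<in> C" and b: "b \<in> I - D" for b c
  proof
    assume "{h c, h b} \<in> F"
    then obtain x y where xy: "{h c, h b} = {h x, h y}" "{x, y} \<in> E" using F by auto
    moreover have "{y, x} \<in> E" using xy(2) by (simp add: insert_commute)
    ultimately have "\<exists>x y. h x = h c \<and> h y = h b \<and> {x, y} \<in> E"
      unfolding doubleton_eq_iff by metis
    then obtain x y where xy: "h x = h c" "h y = h b" "{x, y} \<in> E" by blast
    then have "y = b" using I1[OF b] sg(3) by blast
    then have "x \<in> C" using sp(6)[of x b] xy b by (auto simp: adjr_def I_def)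
    then show "b \<in> nbhd C (adjr n E) h c" using xy \<open>y = b\<close> b by (auto simp: nbhd_def adjr_def I_def)
  next
    assume "b \<in> nbhd C (adjr n E) h c"
    then obtain a where a: "a \<in> C" "h a = h c" "{a, b} \<in> E" by (auto simp: nbhd_def adjr_def)
    then have "h a \<noteq> h b" using I1[OF b, of a] sg(3)[of a b] by auto
    then have "{h a, h b} \<in> F" using F a(3) by blast
    then show "{h c, h b} \<in> F" using a(2) by simp
  qed
  have chain: "nested D (nbhd C (adjr n E) h c) (nbhd C (adjr n E) h c')"
    if c: "c \<in> C" "c' \<in> C" for c c'
  proof (rule ccontr)
    assume "\<not> ?thesis"
    then obtain b b' where b: "b \<in> nbhd C (adjr n E) h c" "b \<notin> D" "b \<notin> nbhd C (adjr n E) h c'"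
      "b' \<in> nbhd C (adjr n E) h c'" "b' \<notin> D" "b' \<notin> nbhd C (adjr n E) h c" by blast
    have bI: "b \<in> I - D" "b' \<in> I - D" using b sp(3) by (auto simp: nbhd_def I_def)
    have cn: "c < n" "c' < n" using sp(7) c by auto
    have bn: "b < n" "b' < n" "b \<notin> C" "b' \<notin> C" using bI by (auto simp: I_def)
    have ne: "h c \<noteq> h b" "h c' \<noteq> h b'" "h c \<noteq> h b'" "h c' \<noteq> h b"
      using I1[OF bI(1)] I1[OF bI(2)] cn bn c by metis+
    show False
    proof (rule threshold_no_p4[OF H(2)[unfolded WF], of "h c" "h b" "h c'" "h b'"])
      show "{h c, h b, h c', h b'} \<subseteq> W" using W cn bn by auto
    qed (use edge c bI b ne in auto)
  qed
  have finI: "finite I" "finite D" "finite C" using sp(8) by (auto simp: I_def D_def)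
  \<comment> \<open>A deleted vertex has no image of its own, because the neighbour in its fibre
    lies in the clique. Counting images then bounds the cost by the number of contractions.\<close>
  have "W = h ` C \<union> h ` (I - D)"
  proof
    show "W \<subseteq> h ` C \<union> h ` (I - D)"
    proof
      fix w assume "w \<in> W"
      then obtain x where x: "x < n" "w = h x" using W by auto
      show "w \<in> h ` C \<union> h ` (I - D)"
      proof (cases "x \<in> D")
        case True
        then obtain y where "y < n" "y \<noteq> x" "h y = h x" by (auto simp: D_def)
        then obtain z where z: "{x, z} \<in> E" "h z = h x" using fib[of x y] x by metis
        have "z \<in> C" using sp(6)[of x z] z True by (auto simp: adjr_def D_def I_def)
        then show ?thesis using z x by (metis UnI1 imageI)
      next
        case False
        then show ?thesis using x by (cases "x \<in> C") (auto simp: I_def)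
      qed
    qed
    show "h ` C \<union> h ` (I - D) \<subseteq> W" using W sp(7) by (auto simp: I_def)
  qed
  moreover have "h ` C \<inter> h ` (I - D) = {}"
  proof -
    have False if "c \<in> C" "b \<in> I - D" "h c = h b" for c b
      using I1[OF that(2) sp(7)[OF that(1)] that(3)] that by (auto simp: I_def)
    then show ?thesis by blast
  qed
  moreover have "inj_on h (I - D)"
  proof (rule inj_onI)
    fix x y assume "x \<in> I - D" "y \<in> I - D" "h x = h y"
    then show "x = y" using I1[of y x] by (auto simp: I_def)
  qed
  ultimately have "card W = card (h ` C) + card (I - D)"
    using finI by (simp add: card_Un_disjoint card_image)
  moreover have "card (I - D) = card I - card D" "card D \<le> card I"
    using finI by (auto simp: D_def card_Diff_subset card_mono)
  moreover have "n = card C + card I"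
  proof -
    have "C \<subseteq> {..<n}" using sp(7) by auto
    then have "card I = n - card C" "card C \<le> n"
      using finI card_mono[of "{..<n}" C] by (auto simp: I_def card_Diff_subset)
    then show ?thesis by simp
  qed
  moreover have "card (h ` C) \<le> card C" using finI by (simp add: card_image_le)
  ultimately have "(card C - card (h ` C)) + card D \<le> k" using cd H(3) by linarith
  moreover have "D \<subseteq> {..<n} - C" by (auto simp: D_def I_def)
  ultimately have "sol n C (adjr n E) h D k" unfolding sol_def using chain by blast
  then show ?thesis by blast
qed

section \<open>Packing of induced paths\<close>

definition avoiding :: "rel2 \<Rightarrow> nat set \<Rightarrow> nat \<Rightarrow> nat \<Rightarrow> bool" where
  "avoiding R T x y \<longleftrightarrow> R x y \<and> x \<notin> T \<and> y \<notin> T"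

text \<open>The number of rounds is fixed in advance. A round that finds no path adds the default
  vertex \<open>0\<close>; this is harmless, since a larger set avoids no fewer paths and the bound
  of four vertices per round still holds.\<close>

primrec packing :: "nat \<Rightarrow> rel2 \<Rightarrow> nat \<Rightarrow> nat set" where
  "packing n R 0 = {}"
| "packing n R (Suc r) = packing n R r \<union> set (snd (search n (avoiding R (packing n R r))))"

lemma p4_avoiding: "p4 (avoiding R T) a b c d \<longleftrightarrow> p4 R a b c d \<and> {a, b, c, d} \<inter> T = {}"
  by (auto simp: p4_def avoiding_def)

lemma search_length: "length (snd (search n R)) = 4"
  by (rule search_cases[of n R]) auto

lemma search_set: "0 < n \<Longrightarrow> set (snd (search n R)) \<subseteq> {..<n}"
  by (rule search_cases[of n R]) auto

lemma card_packing: "card (packing n R r) \<le> 4 * r" and finite_packing: "finite (packing n R r)"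
proof (induction r)
  case (Suc r)
  { case 1
    have "card (set (snd (search n (avoiding R (packing n R r))))) \<le> 4"
      using card_length[of "snd (search n (avoiding R (packing n R r)))"] search_length by metis
    then show ?case
      using card_Un_le[of "packing n R r" "set (snd (search n (avoiding R (packing n R r))))"] Suc
          by simp
  }
  { case 2 then show ?case using Suc by simp }
qed auto

text \<open>Every path meets \<open>Z\<close>, so each successful round moves a new vertex of
  \<open>Z\<close> into the packing. This can happen at most \<open>2 * k\<close> times, and after
  the first failure no path is left.\<close>

lemma packing_free:
  assumes splits: "splits n C R" and s: "sol n C R f D k" and r: "2 * k < r"
  shows "{a, b, c, d} \<inter> packing n R r = {} \<Longrightarrow> \<not> p4 R a b c d"
proof -
  define Z where "Z = touched C f \<union> D"
  have fin: "finite Z" using s splD(8)[OF splits]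
      by (auto simp: Z_def touched_def sol_def intro: finite_subset)
  have cZ: "card Z \<le> 2 * k"
    using sol_card_touched[OF s splD(8)[OF splits]] card_Un_le[of "touched C f" D]
        by (simp add: Z_def)
  have "(\<forall>a b c d. {a, b, c, d} \<inter> packing n R r = {} \<longrightarrow> \<not> p4 R a b c d) \<or>
      r \<le> card (Z \<inter> packing n R r)" for r
  proof (induction r)
    case (Suc r)
    have sub: "packing n R r \<subseteq> packing n R (Suc r)" by auto
    show ?case
    proof (cases "\<forall>a b c d. {a, b, c, d} \<inter> packing n R r = {} \<longrightarrow> \<not> p4 R a b c d")
      case True
      show ?thesis
      proof (intro disjI1 allI impI)
        fix a b c d assume "{a, b, c, d} \<inter> packing n R (Suc r) = {}"
        then have "{a, b, c, d} \<inter> packing n R r = {}" using sub by blast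
        then show "\<not> p4 R a b c d" using True by blast
      qed
    next
      case False
      then have le: "r \<le> card (Z \<inter> packing n R r)" using Suc by argo
      obtain a b c d where q: "p4 R a b c d" "{a, b, c, d} \<inter> packing n R r = {}" using False by blast
      have "\<exists>a b c d. search n (avoiding R (packing n R r)) = (1, [a, b, c, d]) \<and>
          p4 (avoiding R (packing n R r)) a b c d"
      proof (rule search_cases[of n "avoiding R (packing n R r)"])
        assume H: "\<And>a b c d. a < n \<Longrightarrow> b < n \<Longrightarrow> c < n \<Longrightarrow> d < n \<Longrightarrow>
            \<not> p4 (avoiding R (packing n R r)) a b c d"
        have "p4 (avoiding R (packing n R r)) a b c d" using q by (simp only: p4_avoiding simp_thms)
        then show ?thesis using H[of a b c d] p4_less[OF splits q(1)] by simp
      qed blast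
      then obtain a b c d where *: "search n (avoiding R (packing n R r)) = (1, [a, b, c, d])"
        "p4 R a b c d" "{a, b, c, d} \<inter> packing n R r = {}" unfolding p4_avoiding by blast
      obtain z where z: "z \<in> {a, b, c, d}" "z \<in> Z" using p4_sol[OF splits s *(2)]
          by (auto simp: Z_def)
      have "Z \<inter> packing n R r \<subset> Z \<inter> packing n R (Suc r)"
        using z * by auto
      then have "card (Z \<inter> packing n R r) < card (Z \<inter> packing n R (Suc r))"
        using fin by (intro psubset_card_mono) auto
      then show ?thesis using le by linarith
    qed
  qed auto
  moreover have "card (Z \<inter> packing n R r) \<le> card Z" using fin by (intro card_mono) auto
  ultimately show "{a, b, c, d} \<inter> packing n R r = {} \<Longrightarrow> \<not> p4 R a b c d" using cZ r
      by (meson leD le_trans)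
qed

text \<open>An element is determined by its class \<open>h x\<close> and its rank within the class.\<close>

lemma card_top_ranks:
  fixes w :: "'a \<Rightarrow> int"
  assumes fin: "finite A" and inj: "inj_on w A"
  shows "card {x\<in>A. card {y\<in>A. h x = h y \<and> w x < w y} \<le> K} \<le> card (h ` A) * (K + 1)"
proof -
  define rk where "rk x = card {y\<in>A. h x = h y \<and> w x < w y}" for x
  define B where "B = {x\<in>A. rk x \<le> K}"
  have less: "rk y < rk x" if "x \<in> A" "y \<in> A" "h x = h y" "w x < w y" for x y
    unfolding rk_def using that fin by (intro psubset_card_mono) auto
  have "inj_on (\<lambda>x. (h x, rk x)) B"
  proof (rule inj_onI)
    fix x y assume xy: "x \<in> B" "y \<in> B" "(h x, rk x) = (h y, rk y)"
    show "x = y"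
    proof (rule ccontr)
      assume "x \<noteq> y"
      then have "w x \<noteq> w y" using inj xy by (auto simp: B_def inj_on_def)
      then have "w x < w y \<or> w y < w x" by linarith
      then show False using less[of x y] less[of y x] xy by (auto simp: B_def)
    qed
  qed
  moreover have "(\<lambda>x. (h x, rk x)) ` B \<subseteq> h ` A \<times> {..K}" by (auto simp: B_def)
  ultimately have "card B \<le> card (h ` A \<times> {..K})"
    using fin by (intro card_inj_on_le[of "\<lambda>x. (h x, rk x)"]) auto
  then show ?thesis by (simp add: B_def rk_def card_cartesian_product)
qed

section \<open>Counting the candidates\<close>

lemma key_inj: "inj_on (\<lambda>x. int (key n R x)) {..<n}"
proof (rule inj_onI)
  fix x y assume *: "x \<in> {..<n}" "y \<in> {..<n}" "int (key n R x) = int (key n R y)"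
  have "key n R x = key n R y" using *(3) by (simp only: of_nat_eq_iff)
  moreover have "key n R z mod n = z" if "z < n" for z using that by (simp add: key_def)
  ultimately show "x = y" using *(1,2) by (metis lessThan_iff)
qed

text \<open>There are at most \<open>2 * 2 ^ t\<close> types with \<open>2 * k + 1\<close>
  admissible ranks each. Vertices of \<open>T\<close> are comparable with none and pass every rank
  test, hence the summand \<open>t\<close>. The square stems from the third clause of
  \<open>candidate\<close>, which is counted once for each low \<open>b\<close>.\<close>

lemma card_candidate:
  assumes T: "finite T" "card T \<le> t"
  shows "card {x. x < n \<and> candidate n R T k x} \<le> (t + 2 * 2 ^ t * (2 * k + 1) + 1) ^ 2"
proof -
  define S where "S = {..<n} - T"
  define h where "h x = (nonsimp R x, {t\<in>T. R x t})" for x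
  define M where "M = 2 * 2 ^ t * (2 * k + 1)"
  have below: "below n R T x y \<longleftrightarrow> x \<in> S \<and> y \<in> S \<and> h x = h y \<and> key n R x < key n R y" for x y
    unfolding below_def S_def h_def by auto
  have pat: "card (h ` A) * (2 * k + 1) \<le> M" for A
  proof -
    have "h ` A \<subseteq> UNIV \<times> Pow T" by (auto simp: h_def)
    then have "card (h ` A) \<le> card ((UNIV :: bool set) \<times> Pow T)" using T by (intro card_mono) auto
    also have "\<dots> = 2 * 2 ^ card T" using T by (simp add: card_cartesian_product card_Pow)
    also have "\<dots> \<le> 2 * 2 ^ t" using T by simp
    finally show ?thesis unfolding M_def by (intro mult_le_mono1)
  qed
  have top: "card {x\<in>A. card {y\<in>A. h x = h y \<and> w x < (w y :: int)} \<le> 2 * k} \<le> M"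
    if "A \<subseteq> S" "inj_on w S" for A w
  proof -
    have "finite A" using that finite_subset by (auto simp: S_def)
    moreover have "inj_on w A" using that inj_on_subset by blast
    ultimately show ?thesis using card_top_ranks[of A w h "2 * k"] pat[of A] by linarith
  qed
  \<comment> \<open>Negated keys turn ranks from below into ranks from above, so one counting lemma
    serves both. For this reason its weights are integers.\<close>
  have inj: "inj_on (\<lambda>x. int (key n R x)) S" "inj_on (\<lambda>x. - int (key n R x)) S"
    using inj_on_subset[OF key_inj[of n R], of S] by (auto simp: S_def inj_on_def)
  have plusT: "card X \<le> t + M" if "X \<subseteq> T \<union> Y" "card Y \<le> M" "Y \<subseteq> S" for X Y
  proof -
    have "finite Y" using that(3) finite_subset by (auto simp: S_def)
    then have "card X \<le> card (T \<union> Y)" using that T by (intro card_mono) auto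
    also have "\<dots> \<le> card T + card Y" by (rule card_Un_le)
    finally show ?thesis using that T by linarith
  qed
  define L where "L = {x. x < n \<and> low n R T k x}"
  define U where "U = {x. x < n \<and> card {y. below n R T x y} \<le> 2 * k}"
  define B where "B b = {x. x < n \<and> \<not> R b x \<and> card {y. below n R T x y \<and> \<not> R b y} \<le> 2 * k}" for b
  have L: "card L \<le> t + M"
  proof (rule plusT)
    let ?Y = "{x\<in>S. card {y\<in>S. h x = h y \<and> - int (key n R x) < - int (key n R y)} \<le> 2 * k}"
    show "card ?Y \<le> M" using top[OF _ inj(2)] by blast
    have "{y. below n R T y x} = {y\<in>S. h x = h y \<and> - int (key n R x) < - int (key n R y)}"
        if "x \<in> S" for x
      using that by (auto simp: below)
    then show "L \<subseteq> T \<union> ?Y" by (auto simp: L_def low_def S_def)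
  qed auto
  have U: "card U \<le> t + M"
  proof (rule plusT)
    let ?Y = "{x\<in>S. card {y\<in>S. h x = h y \<and> int (key n R x) < int (key n R y)} \<le> 2 * k}"
    show "card ?Y \<le> M" using top[OF _ inj(1)] by blast
    have "{y. below n R T x y} = {y\<in>S. h x = h y \<and> int (key n R x) < int (key n R y)}" if "x \<in> S"
        for x
      using that by (auto simp: below)
    then show "U \<subseteq> T \<union> ?Y" by (auto simp: U_def S_def)
  qed auto
  have B: "card (B b) \<le> t + M" for b
  proof (rule plusT)
    let ?A = "{x\<in>S. \<not> R b x}"
    let ?Y = "{x\<in>?A. card {y\<in>?A. h x = h y \<and> int (key n R x) < int (key n R y)} \<le> 2 * k}"
    show "card ?Y \<le> M" using top[OF _ inj(1), of ?A] by blast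
    have "{y. below n R T x y \<and> \<not> R b y} = {y\<in>?A. h x = h y \<and> int (key n R x) < int (key n R y)}"
        if "x \<in> S" for x
      using that by (auto simp: below)
    then show "B b \<subseteq> T \<union> ?Y" by (auto simp: B_def S_def)
  qed auto
  have fin: "finite L" "finite U" "finite (B b)" for b by (auto simp: L_def U_def B_def)
  have "{x. x < n \<and> candidate n R T k x} \<subseteq> L \<union> U \<union> (\<Union>b\<in>L. B b)"
    by (auto simp: candidate_def L_def U_def B_def)
  then have "card {x. x < n \<and> candidate n R T k x} \<le> card (L \<union> U \<union> (\<Union>b\<in>L. B b))"
    using fin by (intro card_mono) auto
  also have "\<dots> \<le> card L + card U + card (\<Union>b\<in>L. B b)"
    by (meson add_le_mono1 card_Un_le le_trans)
  also have "card (\<Union>b\<in>L. B b) \<le> (\<Sum>b\<in>L. card (B b))" using fin by (intro card_UN_le)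
  also have "\<dots> \<le> (\<Sum>b\<in>L. t + M)" using B by (intro sum_mono) auto
  also have "\<dots> \<le> (t + M) * (t + M)" using L by simp
  finally have "card {x. x < n \<and> candidate n R T k x} \<le> card L + card U + (t + M) * (t + M)" by simp
  also have "\<dots> \<le> (t + M + 1) ^ 2" using L U by (simp add: power2_eq_square)
  finally show ?thesis by (simp add: M_def)
qed

section \<open>Correctness of the search over contraction sequences\<close>

definition candidates :: "nat \<Rightarrow> rel2 \<Rightarrow> nat \<Rightarrow> nat list" where
  "candidates n R k = filter (candidate n R (packing n R (2 * k + 1)) k) [0..<n]"

theorem abstract_correct:
  fixes n k :: nat
  assumes g: "simple_graph ({0..<n}, E)" "split_graph ({0..<n}, E)"
  defines "R \<equiv> adjr n E"
  defines "cl \<equiv> candidates n R k"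
  shows "threshold_contractible ({0..<n}, E) k \<longleftrightarrow>
    (\<exists>d. (\<forall>p. d p < 4 + length cl) \<and> fst (search n (simul n cl d R k)) = 0)"
proof
  assume "threshold_contractible ({0..<n}, E) k"
  then obtain j H where H: "j \<le> k" "(contract_edge ^^ j) ({0..<n}, E) H" "threshold_graph H"
    by (auto simp: threshold_contractible_def)
  obtain C where C: "splits n C R" "\<And>c. c \<in> C \<Longrightarrow> \<exists>b. b \<notin> C \<and> R c b"
    using splits_exists[OF g] unfolding R_def by blast
  obtain f D where s: "sol n C R f D k"
    using sol_of_contraction[OF g(1) C(1)[unfolded R_def] H(2,3,1)] unfolding R_def by blast
  \<comment> \<open>It is the solution \<open>s\<close> that guarantees that
    \<open>2 * k + 1\<close> rounds of packing leave no path.\<close>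
  interpret packed n C R "packing n R (2 * k + 1)" k
    by standard (use C packing_free[OF C(1) s, of "2 * k + 1"] in auto)
  obtain f' where f': "sol n C R f' D k"
      "\<forall>x\<in>touched C f'. candidate n R (packing n R (2 * k + 1)) k x"
    using sol_candidates[OF s] by blast
  have "touched C f' \<subseteq> set cl"
    unfolding cl_def candidates_def using f'(2) sp(7) by (auto simp: touched_def)
  then have "solvable n cl k R" using C(1) f'(1) unfolding solvable_def by blast
  from solvable_simul[OF this, of k] show "\<exists>d. (\<forall>p. d p < 4 + length cl) \<and>
      fst (search n (simul n cl d R k)) = 0"
    using solvable_0 by auto
next
  assume "\<exists>d. (\<forall>p. d p < 4 + length cl) \<and> fst (search n (simul n cl d R k)) = 0"
  then obtain d where d: "fst (search n (simul n cl d R k)) = 0" by blast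
  obtain C where C: "splits n C R" using splits_exists[OF g] unfolding R_def by blast
  have "repr ({0..<n}, E) {..<n} R" using repr_adjr[OF g(1)] by (simp add: R_def)
  from simul_sound[OF this C] obtain j H A' C' where j: "j \<le> k" "(contract_edge ^^ j) ({0..<n}, E) H"
    "repr H A' (simul n cl d R k)" "splits n C' (simul n cl d R k)" by blast
  have "\<not> p4 (simul n cl d R k) a b c e" for a b c e using search_p4_free[OF j(4)] d by blast
  then have "threshold_graph H" using threshold_graph_repr[of "fst H" "snd H"] j(3,4)
      by (cases H) auto
  then show "threshold_contractible ({0..<n}, E) k" unfolding threshold_contractible_def using j
      by blast
qed

text \<open>Four vertices in each of \<open>2 * k + 1\<close> rounds give
  \<open>t = 8 * k + 4\<close>. The base of the square is then at most
  \<open>2 ^ (t + (k + 4)) = 2 ^ (9 * k + 8)\<close>, and \<open>9 * k + 8\<close> is at most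
  \<open>17 * k\<close> for positive \<open>k\<close>; squaring doubles this to
  \<open>34 * k\<close>.\<close>

lemma length_candidates:
  assumes "0 < k"
  shows "4 + length (candidates n R k) \<le> 2 ^ (34 * k)"
proof -
  define T where "T = packing n R (2 * k + 1)"
  define t where "t = 8 * k + 4"
  define a where "a = t + 2 * 2 ^ t * (2 * k + 1)"
  have "length (candidates n R k) = card {x. x < n \<and> candidate n R T k x}"
    unfolding candidates_def T_def by (subst distinct_card[symmetric]) (auto intro: arg_cong[where f = card])
  also have "\<dots> \<le> (a + 1) ^ 2"
    unfolding a_def using card_candidate[of T t n R k] card_packing[of n R "2 * k + 1"] finite_packing[of n R "2 * k + 1"]
    by (simp add: T_def t_def)
  finally have "4 + length (candidates n R k) \<le> (a + 3) ^ 2"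
      by (simp add: power2_eq_square algebra_simps)
  also have "a + 3 \<le> 2 ^ (17 * k)"
  proof -
    have "t \<le> 2 ^ t" using less_exp[of t] by simp
    moreover have "(3::nat) \<le> 3 * 2 ^ t" by simp
    ultimately have "a + 3 \<le> 2 ^ t + 3 * 2 ^ t + 2 * 2 ^ t * (2 * k + 1)" unfolding a_def by linarith
    also have "\<dots> = 2 ^ t * (4 * k + 6)" by (simp add: algebra_simps)
    also have "4 * k + 6 \<le> 2 ^ (k + 4)"
    proof -
      have "k < 2 ^ k" by (rule less_exp)
      then have "4 * k + 6 \<le> 16 * 2 ^ k" by linarith
      then show ?thesis by (simp add: power_add)
    qed
    finally have "a + 3 \<le> 2 ^ (t + (k + 4))" by (simp add: power_add)
    also have "\<dots> \<le> 2 ^ (17 * k)" using assms by (intro power_increasing) (auto simp: t_def)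
    finally show ?thesis .
  qed
  then have "(a + 3) ^ 2 \<le> (2 ^ (17 * k)) ^ 2" by (intro power_mono) auto
  also have "\<dots> = 2 ^ (34 * k)" by (simp flip: power_mult)
  finally show ?thesis .
qed

lemma ok_SeqI:
  assumes "4 \<le> S" "i < j" "i' < j" "ok S i c s P"
    and "\<And>s'. P s' \<Longrightarrow> agree (writes c) s s' \<Longrightarrow> ok S i' d s' Q"
  shows "ok S j (Seq c d) s Q"
proof (rule ok_Seq)
  show "ok S (j - 1) c s (\<lambda>s'. ok S (j - 1) d s' Q)"
  proof (rule ok_conseq[OF assms(4)])
    fix s' assume "P s'" "agree (writes c) s s'"
    then have "ok S i' d s' Q" by (rule assms(5))
    then show "ok S (j - 1) d s' Q" by (rule ok_conseq) (use assms in auto)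
  qed (use assms in auto)
qed (use assms in auto)

text \<open>\<open>\<alpha>\<close> extracts from memory the state on which the fold acts, while
  \<open>I\<close> protects cells that this state does not describe.\<close>

lemma ok_For_fold:
  assumes S: "4 \<le> S" "7 \<le> j" "acost e \<le> 100" "N < S"
    and e: "reads e \<inter> insert x (writes c) = {}" "aval e s = N"
    and x: "x \<notin> writes c" "\<And>s' v. \<alpha> (s'(x := v)) = \<alpha> s'" "\<And>s' v. I s' \<Longrightarrow> I (s'(x := v))"
    and I: "I s"
    and step: "\<And>i s'. i < N \<Longrightarrow> s' x 0 = i \<Longrightarrow> agree (insert x (writes c)) s s' \<Longrightarrow> I s' \<Longrightarrow>
      ok S (j - 2) c s' (\<lambda>s''. \<alpha> s'' = h i (\<alpha> s') \<and> I s'')"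
    and fin: "\<And>s'. \<alpha> s' = fold h [0..<N] (\<alpha> s) \<Longrightarrow> I s' \<Longrightarrow> agree (insert x (writes c)) s s' \<Longrightarrow> Q s'"
  shows "ok S j (For x e c) s Q"
proof (rule ok_For[where N = N and Inv = "\<lambda>i s'. \<alpha> s' = fold h [0..<i] (\<alpha> s) \<and> I s'"])
  fix i s' assume i: "i < N" "\<alpha> s' = fold h [0..<i] (\<alpha> s) \<and> I s'" "s' x 0 = i"
      "agree (insert x (writes c)) s s'"
  show "ok S (j - 2) c s' (\<lambda>s'. \<alpha> s' = fold h [0..<Suc i] (\<alpha> s) \<and> I s')"
    by (rule ok_conseq[OF step[OF i(1,3,4)]]) (use S i in auto)
qed (use assms in auto)

abbreviation At :: "arr_name \<Rightarrow> arr_name \<Rightarrow> aexp" where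
  "At arr x \<equiv> Cell arr (Var x)"

section \<open>The program\<close>

text \<open>Truth values are 0 and 1. Truncated subtraction provides negation as
  \<open>1 - a\<close> and the comparison \<open>b < a\<close> as a nonzero
  \<open>a - b\<close>.\<close>

definition pos :: "aexp \<Rightarrow> aexp" where "pos e = Sub (Const 1) (Sub (Const 1) e)"
definition neq :: "aexp \<Rightarrow> aexp \<Rightarrow> aexp" where "neq a b = Add (Sub a b) (Sub b a)"
definition eqv :: "aexp \<Rightarrow> aexp \<Rightarrow> aexp" where "eqv a b = Sub (Const 1) (neq a b)"
definition both :: "aexp \<Rightarrow> aexp \<Rightarrow> aexp" where "both a b = Sub (Add a b) (Const 1)"
definition twok :: aexp where "twok = Add (Var ''k'') (Var ''k'')"

lemma aval_pos [simp]: "aval (pos e) s = of_bool (0 < aval e s)" by (simp add: pos_def)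
lemma aval_neq: "aval (neq a b) s = 0 \<longleftrightarrow> aval a s = aval b s" by (auto simp: neq_def)
lemma aval_eqv [simp]: "aval (eqv a b) s = of_bool (aval a s = aval b s)"
  by (auto simp: eqv_def neq_def)
lemma acost_pos [simp]: "acost (pos e) = 4 + acost e" by (simp add: pos_def)
lemma acost_neq [simp]: "acost (neq a b) = 3 + 2 * acost a + 2 * acost b" by (simp add: neq_def)
lemma acost_eqv [simp]: "acost (eqv a b) = 5 + 2 * acost a + 2 * acost b" by (simp add: eqv_def)
lemma acost_both [simp]: "acost (both a b) = 3 + acost a + acost b" by (simp add: both_def)
lemma acost_twok [simp]: "acost twok = 5" by (simp add: twok_def)

definition p_row :: com where
  "p_row = For ''a'' (Var ''n'') (Assign ''row'' (Add (Var ''a'') (Const 1)) (Add (At ''row'' ''a'') (Var ''n'')))"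

text \<open>The inner summand is 1 exactly for non-adjacent neighbours \<open>b < c\<close> of
  \<open>a\<close>: the minuend is at most 1, so any positive subtrahend cancels it.\<close>

definition p_nonsimp :: com where
  "p_nonsimp = Fill ''nons'' ''a'' (Var ''a'')
     (SumUp ''t1'' ''b'' (SumUp ''t2'' ''c'' Skip
        (Sub (Sub (Add (Entry ''adj'' ''a'' ''b'') (Entry ''adj'' ''a'' ''c'')) (Const 1))
           (Add (Entry ''adj'' ''b'' ''c'') (Sub (Const 1) (Sub (Var ''c'') (Var ''b''))))))
        (Var ''t2''))
     (pos (Var ''t1''))"

text \<open>For lack of multiplication, the factor \<open>n\<close> arises by adding the same entry
  \<open>n\<close> times in the inner loop.\<close>

definition p_key :: com where
  "p_key = Fill ''key'' ''a'' (Var ''a'')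
     (SumUp ''t1'' ''b'' (SumUp ''t2'' ''c'' Skip (Entry ''adj'' ''a'' ''b'')) (Var ''t2''))
     (Add (Var ''a'') (Var ''t1''))"

definition p_search :: com where
  "p_search = Seq (SetVar ''found'' (Const 0)) (Seq (Assign ''cand'' (Const 0) (Const 0))
     (Seq (Assign ''cand'' (Const 1) (Const 0)) (Seq (Assign ''cand'' (Const 2) (Const 0))
     (Seq (Assign ''cand'' (Const 3) (Const 0))
     (For ''a'' (Var ''n'') (For ''b'' (Var ''n'') (For ''c'' (Var ''n'') (For ''d'' (Var ''n'')
       (Cond (Sub (Sub (Add (Entry ''cur'' ''a'' ''b'') (Add (Entry ''cur'' ''a'' ''c'') (Entry ''cur'' ''c'' ''d''))) (Const 2))
           (Add (Entry ''cur'' ''a'' ''d'') (Add (Entry ''cur'' ''c'' ''b'') (Entry ''cur'' ''b'' ''d''))))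
         (Seq (SetVar ''found'' (Const 1)) (Seq (Assign ''cand'' (Const 0) (Var ''a''))
         (Seq (Assign ''cand'' (Const 1) (Var ''b'')) (Seq (Assign ''cand'' (Const 2) (Var ''c''))
           (Assign ''cand'' (Const 3) (Var ''d''))))))
         Skip)))))))))"

definition p_restrict :: com where
  "p_restrict = MFill ''cur'' ''a'' ''b'' Skip
     (Sub (Entry ''adj'' ''a'' ''b'') (Add (At ''mark'' ''a'') (At ''mark'' ''b'')))"

definition p_mark :: com where
  "p_mark = Seq (Assign ''mark'' (Cell ''cand'' (Const 0)) (Const 1)) (Seq (Assign ''mark'' (Cell ''cand'' (Const 1)) (Const 1))
     (Seq (Assign ''mark'' (Cell ''cand'' (Const 2)) (Const 1)) (Assign ''mark'' (Cell ''cand'' (Const 3)) (Const 1))))"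

definition p_pack :: com where
  "p_pack = For ''r'' (Add twok (Const 1)) (Seq p_restrict (Seq p_search p_mark))"

text \<open>Each requirement is written as a quantity that vanishes when it holds; subtracting their
  sum from 1 forms the conjunction.\<close>

definition p_below :: com where
  "p_below = MFill ''bel'' ''a'' ''b''
     (SumUp ''t1'' ''c'' Skip (Sub (At ''mark'' ''c'')
        (eqv (Entry ''adj'' ''a'' ''c'') (Entry ''adj'' ''b'' ''c''))))
     (Sub (Const 1) (Add (Var ''t1'') (Add (neq (At ''nons'' ''a'') (At ''nons'' ''b''))
        (Add (Add (At ''mark'' ''a'') (At ''mark'' ''b'')) (Sub (Const 1) (Sub (At ''key'' ''b'') (At ''key'' ''a'')))))))"

definition p_low :: com where
  "p_low = Fill ''low'' ''a'' (Var ''a'') (SumUp ''t1'' ''b'' Skip (Entry ''bel'' ''b'' ''a''))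
     (Sub (Const 1) (Sub (Var ''t1'') twok))"

text \<open>
  Cells \<open>0\<close> to \<open>3\<close> of the array \<open>cand\<close> are reserved for the path found by the last search, so that a
  digit of a certificate selects either a vertex of that path or a candidate.
\<close>

definition p_cand :: com where
  "p_cand = Seq (SetVar ''m'' (Const 4)) (For ''a'' (Var ''n'')
     (Seq (SumUp ''t1'' ''b'' Skip (Entry ''bel'' ''a'' ''b''))
     (Seq (SumUp ''t3'' ''b'' (SumUp ''t2'' ''c'' Skip (Sub (Entry ''bel'' ''a'' ''c'') (Entry ''adj'' ''b'' ''c'')))
        (Sub (Sub (At ''low'' ''b'') (Entry ''adj'' ''b'' ''a'')) (Sub (Var ''t2'') twok)))
     (Cond (Add (At ''low'' ''a'') (Add (Sub (Const 1) (Sub (Var ''t1'') twok)) (Var ''t3'')))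
        (Seq (Assign ''cand'' (Var ''m'') (Var ''a'')) (SetVar ''m'' (Add (Var ''m'') (Const 1))))
        Skip))))"

definition p_copy :: com where
  "p_copy = MFill ''cur'' ''a'' ''b'' Skip (Entry ''adj'' ''a'' ''b'')"

text \<open>The detour through \<open>tmp\<close> is needed because new entries still depend on old
  ones in row and column \<open>v\<close>.\<close>

definition p_contract :: com where
  "p_contract = Seq
     (MFill ''tmp'' ''a'' ''b'' Skip
       (Sub (pos (Add (Entry ''cur'' ''a'' ''b'') (Add (both (eqv (Var ''a'') (Var ''u'')) (Entry ''cur'' ''v'' ''b''))
              (both (eqv (Var ''b'') (Var ''u'')) (Entry ''cur'' ''a'' ''v'')))))
          (Add (eqv (Var ''a'') (Var ''b'')) (Add (eqv (Var ''a'') (Var ''v'')) (eqv (Var ''b'') (Var ''v''))))))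
     (MFill ''cur'' ''a'' ''b'' Skip (Entry ''tmp'' ''a'' ''b''))"

definition p_step :: com where
  "p_step = Seq p_search
     (Seq (SetVar ''u'' (Cell ''cand'' (Cell ''cert'' (Add (Var ''i'') (Var ''i'')))))
     (Seq (SetVar ''v'' (Cell ''cand'' (Cell ''cert'' (Add (Add (Var ''i'') (Var ''i'')) (Const 1)))))
     (Cond (Entry ''cur'' ''u'' ''v'') p_contract Skip)))"

definition p_test :: com where
  "p_test = Seq p_copy (Seq (For ''i'' (Var ''k'') p_step)
     (Seq p_search (Cond (Var ''found'') Skip (SetVar ''answer'' (Const 1)))))"

text \<open>An odometer with \<open>2 * k\<close> digits in base \<open>m\<close>, two digits per
  contraction. A digit that reaches \<open>m\<close> wraps to 0 and leaves the carry set; a carry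
  out of the last digit ends the enumeration.\<close>

definition p_incr :: com where
  "p_incr = Seq (SetVar ''carry'' (Const 1)) (Seq (For ''i'' twok
     (Seq (Assign ''cert'' (Var ''i'') (Add (At ''cert'' ''i'') (Var ''carry'')))
       (Cond (neq (At ''cert'' ''i'') (Var ''m'')) (SetVar ''carry'' (Const 0)) (Assign ''cert'' (Var ''i'') (Const 0)))))
     (Cond (Var ''carry'') (SetVar ''done'' (Const 1)) Skip))"

definition p_pre :: com where
  "p_pre = Seq p_row (Seq p_nonsimp (Seq p_key (Seq p_pack (Seq p_below (Seq p_low p_cand)))))"

text \<open>Without vertices, the default \<open>0\<close> of the search would not name a vertex.
  The empty graph is accepted separately, as it is a threshold graph already.\<close>

definition p_main :: com where
  "p_main = Cond (Var ''n'')
     (Seq p_pre (While (Sub (Const 1) (Var ''done'')) (Seq p_test p_incr)))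
     (SetVar ''answer'' (Const 1))"

lemma writes_p [simp]:
  "writes p_row = {''a'', ''row''}"
  "writes p_nonsimp = {''nons'', ''a'', ''b'', ''c'', ''t1'', ''t2''}"
  "writes p_key = {''key'', ''a'', ''b'', ''c'', ''t1'', ''t2''}"
  "writes p_search = {''found'', ''cand'', ''a'', ''b'', ''c'', ''d''}"
  "writes p_restrict = {''cur'', ''a'', ''b''}"
  "writes p_mark = {''mark''}"
  "writes p_pack = {''r'', ''cur'', ''a'', ''b'', ''c'', ''d'', ''found'', ''cand'', ''mark''}"
  "writes p_below = {''bel'', ''a'', ''b'', ''c'', ''t1''}"
  "writes p_low = {''low'', ''a'', ''b'', ''t1''}"
  "writes p_cand = {''m'', ''a'', ''b'', ''c'', ''t1'', ''t2'', ''t3'', ''cand''}"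
  "writes p_copy = {''cur'', ''a'', ''b''}"
  "writes p_contract = {''tmp'', ''cur'', ''a'', ''b''}"
  "writes p_step = {''found'', ''cand'', ''a'', ''b'', ''c'', ''d'', ''u'', ''v'', ''tmp'', ''cur''}"
  "writes p_test = {''found'', ''cand'', ''a'', ''b'', ''c'', ''d'', ''u'', ''v'', ''tmp'', ''cur'', ''i'', ''answer''}"
  "writes p_incr = {''carry'', ''i'', ''cert'', ''done''}"
  by (auto simp: p_row_def p_nonsimp_def p_key_def p_search_def p_restrict_def p_mark_def p_pack_def p_below_def
      p_low_def p_cand_def p_copy_def p_contract_def p_step_def p_test_def p_incr_def)

section \<open>Memory invariants and correctness of the subprograms\<close>

lemma sum_of_bool_card: "(\<Sum>b<n. of_bool (P b)) = card {b. b < (n::nat) \<and> P b}"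
proof -
  have "(\<Sum>b<n. of_bool (P b)) = (\<Sum>b\<in>{b\<in>{..<n}. P b}. 1 :: nat)"
    by (subst sum.inter_filter) (auto simp: of_bool_def intro: sum.cong)
  then show ?thesis by simp
qed

text \<open>\<open>S\<close> is at least 4 and exceeds the bounds \<open>n\<close>,
  \<open>k\<close>, \<open>2 * k\<close> and \<open>2 * k + 1\<close> of all counting loops, so it
  can serve as the base of their time budgets.\<close>

locale machine =
  fixes n k :: nat and R :: "nat \<Rightarrow> nat \<Rightarrow> bool" and S :: nat
  assumes S: "S = n + 2 * k + 4" and npos: "0 < n"
    and Rn: "\<And>x y. R x y \<Longrightarrow> x < n \<and> y < n"
begin

lemma S4: "4 \<le> S" and nS: "n < S" and kS: "2 * k + 1 < S" using S by auto

definition matrix :: "memory \<Rightarrow> arr_name \<Rightarrow> rel2 \<Rightarrow> bool" where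
  "matrix s A Q \<longleftrightarrow> (\<forall>i<n. \<forall>j<n. s A (i * n + j) = of_bool (Q i j))"

definition base :: "memory \<Rightarrow> bool" where
  "base s \<longleftrightarrow> s ''n'' 0 = n \<and> s ''k'' 0 = k \<and> (\<forall>i<n. s ''row'' i = i * n) \<and> matrix s ''adj'' R"

lemma matD: "matrix s A Q \<Longrightarrow> i < n \<Longrightarrow> j < n \<Longrightarrow> s A (i * n + j) = of_bool (Q i j)"
  by (simp add: matrix_def)

lemma matrix_agree: "matrix s A Q \<Longrightarrow> agree X s s' \<Longrightarrow> A \<notin> X \<Longrightarrow> matrix s' A Q"
  by (simp add: matrix_def agree_def)

lemma base_agree: "base s \<Longrightarrow> agree X s s' \<Longrightarrow> {''n'', ''k'', ''row'', ''adj''} \<inter> X = {} \<Longrightarrow> base s'"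
  by (simp add: base_def matrix_def agree_def)

lemma baseD: "base s \<Longrightarrow> s ''n'' 0 = n" "base s \<Longrightarrow> s ''k'' 0 = k"
  "base s \<Longrightarrow> i < n \<Longrightarrow> s ''row'' i = i * n" "base s \<Longrightarrow> matrix s ''adj'' R"
  by (simp_all add: base_def)

lemma aval_twok [simp]: "base s \<Longrightarrow> aval twok s = 2 * k"
  by (simp add: twok_def baseD)

lemma aval_Entry:
  assumes "base s" "matrix s A Q" "s x 0 = i" "s y 0 = j" "i < n" "j < n"
  shows "aval (Entry A x y) s = of_bool (Q i j)"
  using assms by (simp add: baseD matD)

lemma ok_row:
  assumes "s ''n'' 0 = n" "s ''row'' 0 = 0"
  shows "ok S 10 p_row s (\<lambda>s'. \<forall>i<n. s' ''row'' i = i * n)"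
  unfolding p_row_def
proof (rule ok_For[where N = n and Inv = "\<lambda>i s'. \<forall>p\<le>i. s' ''row'' p = p * n"])
  fix i s' assume "i < n" "\<forall>p\<le>i. s' ''row'' p = p * n" "s' ''a'' 0 = i"
    "agree (insert ''a'' (writes (Assign ''row'' (Add (Var ''a'') (Const 1)) (Add (At ''row'' ''a'') (Var ''n''))))) s s'"
  then show "ok S (10 - 2) (Assign ''row'' (Add (Var ''a'') (Const 1)) (Add (At ''row'' ''a'') (Var ''n''))) s'
     (\<lambda>s'. \<forall>p\<le>Suc i. s' ''row'' p = p * n)"
    using S4 assms by (intro ok_Assign) (auto simp: agree_def le_Suc_eq)
qed (use S4 nS assms in auto)

lemma ok_nonsimp:
  assumes b: "base s"
  shows "ok S 20 p_nonsimp s (\<lambda>s'. \<forall>i<n. s' ''nons'' i = of_bool (nonsimp R i))"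
  unfolding p_nonsimp_def
proof (rule ok_Fill[where g = "\<lambda>i. i" and h = "\<lambda>i. of_bool (nonsimp R i)"], goal_cases)
  case (10 i s1)
  note o = 10
  define h where "h b c = (of_bool (R i b \<and> R i c \<and> \<not> R b c \<and> b < c) :: nat)" for b c
  have b1: "base s1" using base_agree[OF b o(3)] by simp
  have i: "i < n" using o b by (simp add: baseD)
  show ?case
  proof (rule ok_SumUp[where h = "\<lambda>b. \<Sum>c<n. h b c"], goal_cases)
    case (9 b s2)
    have b2: "base s2" using base_agree[OF b1 9(3)] by simp
    have b: "b < n" using 9 b1 by (simp add: baseD)
    have i2: "s2 ''a'' 0 = i" using 9 o by (simp add: agree_def)
    show ?case
    proof (rule ok_SumUp[where h = "h b"], goal_cases)
      case (9 c s3)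
      have b3: "base s3" using base_agree[OF b2 9(3)] by simp
      have c: "c < n" using 9 b2 by (simp add: baseD)
      have i3: "s3 ''a'' 0 = i" "s3 ''b'' 0 = b" "s3 ''c'' 0 = c"
        using 9 \<open>s2 ''b'' 0 = b\<close> i2 by (simp_all add: agree_def)
      show ?case
        using i3 b c i S4 baseD[OF b3] matD[OF baseD(4)[OF b3]] by (intro ok_Skip) (auto simp: h_def)
    next
      case (10 s3) then show ?case using b2 by (simp add: baseD)
    qed (use S4 nS b2 in \<open>auto simp: baseD\<close>)
  next
    case (10 s2)
    have "(\<Sum>b<n. \<Sum>c<n. h b c) = 0 \<longleftrightarrow> \<not> nonsimp R i"
      unfolding nonsimp_def h_def using Rn by fastforce
    then show ?case using 10 b1 o by (auto simp: baseD agree_def)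
  qed (use S4 nS b1 in \<open>auto simp: baseD\<close>)
next
  case (11 s1) then show ?case using b by (simp add: baseD)
qed (use S4 nS b in \<open>auto simp: baseD\<close>)

lemma ok_key:
  assumes b: "base s"
  shows "ok S 20 p_key s (\<lambda>s'. \<forall>i<n. s' ''key'' i = key n R i)"
  unfolding p_key_def
proof (rule ok_Fill[where g = "\<lambda>i. i" and h = "\<lambda>i. key n R i"], goal_cases)
  case (10 i s1)
  note o = 10
  have b1: "base s1" using base_agree[OF b o(3)] by simp
  have i: "i < n" using o b by (simp add: baseD)
  show ?case
  proof (rule ok_SumUp[where h = "\<lambda>b. n * of_bool (R i b)"], goal_cases)
    case (9 b s2)
    have b2: "base s2" using base_agree[OF b1 9(3)] by simp
    have b: "b < n" using 9 b1 by (simp add: baseD)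
    have i2: "s2 ''a'' 0 = i" using 9 o by (simp add: agree_def)
    show ?case
    proof (rule ok_SumUp[where h = "\<lambda>c. of_bool (R i b)"], goal_cases)
      case (9 c s3)
      have b3: "base s3" using base_agree[OF b2 9(3)] by simp
      have i3: "s3 ''a'' 0 = i" "s3 ''b'' 0 = b"
        using 9 \<open>s2 ''b'' 0 = b\<close> i2 by (simp_all add: agree_def)
      show ?case
        using i3 b i S4 baseD[OF b3] matD[OF baseD(4)[OF b3]] by (intro ok_Skip) auto
    next
      case (10 s3) then show ?case using b2 by (simp add: baseD)
    qed (use S4 nS b2 in \<open>auto simp: baseD\<close>)
  next
    case (10 s2)
    have "(\<Sum>b<n. n * of_bool (R i b)) = n * card {x. x < n \<and> R i x}"
      by (simp flip: sum_distrib_left add: sum_of_bool_card)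
    then show ?case using 10 b1 o by (auto simp: baseD agree_def key_def)
  qed (use S4 nS b1 in \<open>auto simp: baseD\<close>)
next
  case (11 s1) then show ?case using b by (simp add: baseD)
qed (use S4 nS b in \<open>auto simp: baseD\<close>)


lemma ok_search:
  assumes b: "base s" and Q: "matrix s ''cur'' Q"
  shows "ok S 26 p_search s (\<lambda>s'. s' ''found'' 0 = fst (search n Q) \<and>
    (\<forall>p. s' ''cand'' p = (if p < 4 then snd (search n Q) ! p else s ''cand'' p)))"
proof -
  define \<alpha> where "\<alpha> s = (s ''found'' 0, [s ''cand'' 0, s ''cand'' 1, s ''cand'' 2, s ''cand'' (3::nat)])" for s :: memory
  \<comment> \<open>The cells from 4 on hold the candidate list and have to survive every
    search.\<close>
  define I where "I s' \<longleftrightarrow> (\<forall>p\<ge>4. s' ''cand'' p = s ''cand'' p)" for s' :: memory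
  have \<alpha>x: "\<alpha> (s'(x := v)) = \<alpha> s'" if "x \<noteq> ''found''" "x \<noteq> ''cand''" for s' x v
    using that by (simp add: \<alpha>_def)
  have Ix: "I s' \<Longrightarrow> I (s'(x := v))" if "x \<noteq> ''cand''" for s' x v
    using that by (simp add: I_def)
  define c0 where "c0 = (Seq (SetVar ''found'' (Const 1)) (Seq (Assign ''cand'' (Const 0) (Var ''a''))
         (Seq (Assign ''cand'' (Const 1) (Var ''b'')) (Seq (Assign ''cand'' (Const 2) (Var ''c''))
           (Assign ''cand'' (Const 3) (Var ''d''))))))"
  define e0 where "e0 = (Sub (Sub (Add (Entry ''cur'' ''a'' ''b'') (Add (Entry ''cur'' ''a'' ''c'') (Entry ''cur'' ''c'' ''d''))) (Const 2))
           (Add (Entry ''cur'' ''a'' ''d'') (Add (Entry ''cur'' ''c'' ''b'') (Entry ''cur'' ''b'' ''d''))))"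
  define W where "W = {''found'', ''cand'', ''a'', ''b'', ''c'', ''d''}"
  have w0: "writes c0 = {''found'', ''cand''}" by (auto simp: c0_def)
  have keep: "base s'" "matrix s' ''cur'' Q" if "agree W s s'" for s'
    using base_agree[OF b that] matrix_agree[OF Q that] by (simp_all add: W_def)
  have body: "ok S 11 (Cond e0 c0 Skip) s' (\<lambda>s''. \<alpha> s'' = (if p4 Q x y z w then (1, [x, y, z, w]) else \<alpha> s') \<and> I s'')"
    if "x < n" "y < n" "z < n" "w < n" "s' ''a'' 0 = x" "s' ''b'' 0 = y" "s' ''c'' 0 = z"
        "s' ''d'' 0 = w"
      "agree W s s'" "I s'" for s' x y z w
  proof -
    have k: "base s'" "matrix s' ''cur'' Q" using keep that by auto
    have e0: "aval e0 s' = of_bool (p4 Q x y z w)"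
      using that baseD[OF k(1)] matD[OF k(2)] by (auto simp: e0_def p4_def)
    show ?thesis
    proof (rule ok_Cond)
      assume "aval e0 s' \<noteq> 0"
      then have "p4 Q x y z w" using e0 by simp
      then show "ok S (11 - 1) c0 s' (\<lambda>s''. \<alpha> s'' = (if p4 Q x y z w then (1, [x, y, z, w]) else \<alpha> s') \<and> I s'')"
        unfolding c0_def using S4 that by (intro ok_Seq ok_Assign) (auto simp: \<alpha>_def I_def)
    next
      assume "aval e0 s' = 0"
      then show "ok S (11 - 1) Skip s' (\<lambda>s''. \<alpha> s'' = (if p4 Q x y z w then (1, [x, y, z, w]) else \<alpha> s') \<and> I s'')"
        using e0 S4 that by (intro ok_Skip) auto
    qed (use S4 in \<open>auto simp: e0_def\<close>)
  qed
  define ld where "ld = For ''d'' (Var ''n'') (Cond e0 c0 Skip)"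
  define lc where "lc = For ''c'' (Var ''n'') ld"
  define lb where "lb = For ''b'' (Var ''n'') lc"
  have wr: "writes ld = {''found'', ''cand'', ''d''}"
      "writes lc = {''found'', ''cand'', ''c'', ''d''}"
    "writes lb = {''found'', ''cand'', ''b'', ''c'', ''d''}"
    by (auto simp: ld_def lc_def lb_def w0)
  define hd where "hd x y z w q = (if p4 Q x y z w then (1, [x, y, z, w]) else q)"
      for x y z w and q :: "nat \<times> nat list"
  have D: "ok S 13 ld s' (\<lambda>s''. \<alpha> s'' = fold (hd x y z) [0..<n] (\<alpha> s') \<and> I s'')"
    if h: "x < n" "y < n" "z < n" "s' ''a'' 0 = x" "s' ''b'' 0 = y" "s' ''c'' 0 = z" "agree W s s'"
        "I s'" for s' x y z
    unfolding ld_def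
  proof (rule ok_For_fold[where N = n and \<alpha> = \<alpha> and I = I and h = "hd x y z"], goal_cases)
    case (11 w s'')
    have "agree W s s''" using h(7) 11(3) by (rule agree_trans) (auto simp: W_def w0)
    then show ?case using body[of x y z w s''] h 11 by (simp add: hd_def agree_def w0)
  qed (use S4 nS h \<alpha>x Ix keep w0 baseD(1)[OF keep(1)] in auto)
  have C: "ok S 15 lc s' (\<lambda>s''. \<alpha> s'' = fold (\<lambda>z. fold (hd x y z) [0..<n]) [0..<n] (\<alpha> s') \<and> I s'')"
    if h: "x < n" "y < n" "s' ''a'' 0 = x" "s' ''b'' 0 = y" "agree W s s'" "I s'" for s' x y
    unfolding lc_def
  proof (rule ok_For_fold[where N = n and \<alpha> = \<alpha> and I = I and h = "\<lambda>z. fold (hd x y z) [0..<n]"], goal_cases)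
    case (11 w s'')
    have "agree W s s''" using h(5) 11(3) by (rule agree_trans) (auto simp: W_def wr)
    then show ?case using D[of x y w s''] h 11 by (simp add: agree_def wr)
  qed (use S4 nS h \<alpha>x Ix keep wr baseD(1)[OF keep(1)] in auto)
  have B: "ok S 17 lb s' (\<lambda>s''. \<alpha> s'' = fold (\<lambda>y. fold (\<lambda>z. fold (hd x y z) [0..<n]) [0..<n]) [0..<n] (\<alpha> s') \<and> I s'')"
    if h: "x < n" "s' ''a'' 0 = x" "agree W s s'" "I s'" for s' x
    unfolding lb_def
  proof (rule ok_For_fold[where N = n and \<alpha> = \<alpha> and I = I and h = "\<lambda>y. fold (\<lambda>z. fold (hd x y z) [0..<n]) [0..<n]"], goal_cases)
    case (11 w s'')
    have "agree W s s''" using h(3) 11(3) by (rule agree_trans) (auto simp: W_def wr)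
    then show ?case using C[of x w s''] h 11 by (simp add: agree_def wr)
  qed (use S4 nS h \<alpha>x Ix keep wr baseD(1)[OF keep(1)] in auto)
  have A: "ok S 19 (For ''a'' (Var ''n'') lb) s' (\<lambda>s''. \<alpha> s'' = search n Q \<and> I s'')"
    if h: "agree W s s'" "I s'" "\<alpha> s' = (0, [0, 0, 0, 0])" for s'
  proof (rule ok_For_fold[where N = n and \<alpha> = \<alpha> and I = I and h = "\<lambda>x. fold (\<lambda>y. fold (\<lambda>z. fold (hd x y z) [0..<n]) [0..<n]) [0..<n]"], goal_cases)
    case (11 w s'')
    have "agree W s s''" using h(1) 11(3) by (rule agree_trans) (auto simp: W_def wr)
    then show ?case using B[of w s''] h 11 by (simp add: agree_def wr)
  next
    case (12 s'')
    then show ?case using h unfolding search_def hd_def by simp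
  qed (use S4 nS h \<alpha>x Ix keep wr baseD(1)[OF keep(1)] in auto)
  have "\<alpha> s' = search n Q \<and> I s' \<Longrightarrow> s' ''found'' 0 = fst (search n Q) \<and>
    (\<forall>p. s' ''cand'' p = (if p < 4 then snd (search n Q) ! p else s ''cand'' p))" for s'
  proof -
    assume h: "\<alpha> s' = search n Q \<and> I s'"
    have "s' ''cand'' p = snd (\<alpha> s') ! p" if "p < 4" for p
    proof -
      have "p = 0 \<or> p = 1 \<or> p = 2 \<or> p = 3" using that by auto
      then show ?thesis by (auto simp: \<alpha>_def)
    qed
    moreover have "s' ''found'' 0 = fst (\<alpha> s')" by (simp add: \<alpha>_def)
    ultimately show ?thesis using h by (auto simp: I_def)
  qed
  note fin = this
  have F: "ok S j (For ''a'' (Var ''n'') lb) s' (\<lambda>s'. s' ''found'' 0 = fst (search n Q) \<and>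
      (\<forall>p. s' ''cand'' p = (if p < 4 then snd (search n Q) ! p else s ''cand'' p)))"
    if "19 \<le> j" "agree W s s'" "I s'" "\<alpha> s' = (0, [0, 0, 0, 0])" for j s'
    by (rule ok_conseq[OF A[OF that(2-4)] that(1)]) (use S4 fin in auto)
  show ?thesis
    unfolding p_search_def c0_def[symmetric] e0_def[symmetric] ld_def[symmetric] lc_def[symmetric] lb_def[symmetric]
    by (intro ok_Seq ok_Assign F) (use S4 in \<open>auto simp: W_def agree_def I_def \<alpha>_def\<close>)
qed

lemma ok_restrict:
  assumes b: "base s" and T: "\<And>x. x < n \<Longrightarrow> s ''mark'' x = of_bool (x \<in> T)"
  shows "ok S 12 p_restrict s (\<lambda>s'. matrix s' ''cur'' (avoiding R T))"
  unfolding p_restrict_def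
proof (rule ok_MFill[where h = "\<lambda>i j. of_bool (avoiding R T i j)"], goal_cases)
  case (9 i j s')
  have b': "base s'" using base_agree[OF b 9(5)] by simp
  have ij: "i < n" "j < n" using 9 b by (auto simp: baseD)
  have "s' ''mark'' x = of_bool (x \<in> T)" if "x < n" for x using T that 9(5) by (simp add: agree_def)
  then show ?case using 9(3,4) ij S4 baseD[OF b'] matD[OF baseD(4)[OF b']]
    by (intro ok_Skip) (auto simp: avoiding_def)
next
  case (10 s') then show ?case using b by (auto simp: matrix_def baseD)
qed (use S4 nS b in \<open>auto simp: baseD\<close>)

lemma ok_copy:
  assumes b: "base s"
  shows "ok S 12 p_copy s (\<lambda>s'. matrix s' ''cur'' R)"
  unfolding p_copy_def
proof (rule ok_MFill[where h = "\<lambda>i j. of_bool (R i j)"], goal_cases)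
  case (9 i j s')
  have b': "base s'" using base_agree[OF b 9(5)] by simp
  have ij: "i < n" "j < n" using 9 b by (auto simp: baseD)
  then show ?case using 9(3,4) S4 baseD[OF b'] matD[OF baseD(4)[OF b']]
    by (intro ok_Skip) auto
next
  case (10 s') then show ?case using b by (auto simp: matrix_def baseD)
qed (use S4 nS b in \<open>auto simp: baseD\<close>)

lemma ok_mark:
  shows "ok S 9 p_mark s (\<lambda>s'. \<forall>x. s' ''mark'' x =
    (if x \<in> {s ''cand'' 0, s ''cand'' 1, s ''cand'' 2, s ''cand'' 3} then 1 else s ''mark'' x))"
  unfolding p_mark_def by (intro ok_Seq ok_Assign) (use S4 in auto)

lemma set4: "length l = 4 \<Longrightarrow> set l = {l ! 0, l ! 1, l ! 2, l ! 3}"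
  by (auto simp: set_conv_nth less_Suc_eq numeral_eq_Suc)

lemma ok_pack:
  assumes b: "base s" and m0: "\<And>x. s ''mark'' x = 0"
  shows "ok S 30 p_pack s (\<lambda>s'. \<forall>x<n. s' ''mark'' x = of_bool (x \<in> packing n R (2 * k + 1)))"
  unfolding p_pack_def
proof (rule ok_For[where N = "2 * k + 1"
    and Inv = "\<lambda>r s'. \<forall>x<n. s' ''mark'' x = of_bool (x \<in> packing n R r)"], goal_cases)
  case (10 r s')
  have b': "base s'" using base_agree[OF b 10(4)] by simp
  define Q where "Q = avoiding R (packing n R r)"
  show ?case
  proof (rule ok_SeqI)
    show "ok S 12 p_restrict s' (\<lambda>s'. matrix s' ''cur'' Q)"
      unfolding Q_def using 10 by (intro ok_restrict b') auto
    fix s1 assume s1: "matrix s1 ''cur'' Q" "agree (writes p_restrict) s' s1"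
    have b1: "base s1" using base_agree[OF b' s1(2)] by simp
    show "ok S 27 (Seq p_search p_mark) s1 (\<lambda>s'. \<forall>x<n. s' ''mark'' x = of_bool (x \<in> packing n R (Suc r)))"
    proof (rule ok_SeqI[OF _ _ _ ok_search[OF b1 s1(1)]])
      fix s2 assume s2: "s2 ''found'' 0 = fst (search n Q) \<and>
        (\<forall>p. s2 ''cand'' p = (if p < 4 then snd (search n Q) ! p else s1 ''cand'' p))" "agree (writes p_search) s1 s2"
      have m: "s2 ''mark'' x = of_bool (x \<in> packing n R r)" if "x < n" for x
        using that 10 s1(2) s2(2) by (simp add: agree_def)
      show "ok S 9 p_mark s2 (\<lambda>s'. \<forall>x<n. s' ''mark'' x = of_bool (x \<in> packing n R (Suc r)))"
      proof (rule ok_conseq[OF ok_mark])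
        have c: "{s2 ''cand'' 0, s2 ''cand'' 1, s2 ''cand'' 2, s2 ''cand'' 3} = set (snd (search n Q))"
          using s2(1) unfolding set4[OF search_length] by simp
        have packing: "x \<in> packing n R (Suc r) \<longleftrightarrow> x \<in> packing n R r \<or> x \<in> set (snd (search n Q))" for x
          by (simp add: Q_def)
        fix s3 assume "\<forall>x. s3 ''mark'' x =
          (if x \<in> {s2 ''cand'' 0, s2 ''cand'' 1, s2 ''cand'' 2, s2 ''cand'' 3} then 1 else s2 ''mark'' x)"
        then show "\<forall>x<n. s3 ''mark'' x = of_bool (x \<in> packing n R (Suc r))"
          unfolding c packing using m by simp
      qed (use S4 in auto)
    qed (use S4 in auto)
  qed (use S4 in auto)
next
  case 8 then show ?case by simp
next
  case 9 then show ?case using m0 by simp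
qed (use S4 kS b in \<open>auto simp: baseD twok_def\<close>)

lemma ok_below:
  assumes b: "base s" and T: "\<And>x. x < n \<Longrightarrow> s ''mark'' x = of_bool (x \<in> T)"
    and nonsimp: "\<And>x. x < n \<Longrightarrow> s ''nons'' x = of_bool (nonsimp R x)"
    and key: "\<And>x. x < n \<Longrightarrow> s ''key'' x = key n R x"
  shows "ok S 20 p_below s (\<lambda>s'. matrix s' ''bel'' (below n R T))"
  unfolding p_below_def
proof (rule ok_MFill[where h = "\<lambda>i j. of_bool (below n R T i j)"], goal_cases)
  case (9 i j s1)
  have b1: "base s1" using base_agree[OF b 9(5)] by simp
  have ij: "i < n" "j < n" using 9 b by (auto simp: baseD)
  have s1: "s1 ''a'' 0 = i" "s1 ''b'' 0 = j" using 9 by auto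
  have ar: "s1 ''mark'' = s ''mark''" "s1 ''nons'' = s ''nons''" "s1 ''key'' = s ''key''"
    using 9(5) by (simp_all add: agree_def)
  define h where "h t = (of_bool (t \<in> T \<and> R i t \<noteq> R j t) :: nat)" for t
  show ?case
  proof (rule ok_SumUp[where h = h], goal_cases)
    case (9 t s2)
    have b2: "base s2" using base_agree[OF b1 9(3)] by simp
    have t: "t < n" using 9 b1 by (simp add: baseD)
    have s2: "s2 ''a'' 0 = i" "s2 ''b'' 0 = j" "s2 ''c'' 0 = t" "s2 ''mark'' = s ''mark''"
      using 9 s1 ar by (simp_all add: agree_def)
    show ?case
      using s2 ij t S4 T baseD[OF b2] matD[OF baseD(4)[OF b2]] by (intro ok_Skip) (auto simp: h_def)
  next
    case (10 s2)
    have s2: "s2 ''a'' 0 = i" "s2 ''b'' 0 = j" "s2 ''mark'' = s ''mark''"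
        "s2 ''nons'' = s ''nons''" "s2 ''key'' = s ''key''"
      using 10 s1 ar by (simp_all add: agree_def)
    have "s2 ''t1'' 0 = (\<Sum>t<n. h t)" using 10 b1 by (simp add: baseD)
    moreover have "(\<Sum>t<n. h t) = 0 \<longleftrightarrow> (\<forall>t\<in>T. R i t = R j t)"
      using Rn by (auto simp: h_def)
    ultimately have t1: "s2 ''t1'' 0 = 0 \<longleftrightarrow> (\<forall>t\<in>T. R i t = R j t)" by simp
    have "aval (neq (At ''nons'' ''a'') (At ''nons'' ''b'')) s2 = 0 \<longleftrightarrow> nonsimp R i = nonsimp R j"
      using s2 ij nonsimp by (auto simp: aval_neq)
    then show ?case using s2 ij T key t1 by (auto simp: below_def)
  qed (use S4 nS b1 in \<open>auto simp: baseD eqv_def neq_def\<close>)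
next
  case (10 s') then show ?case using b by (auto simp: matrix_def baseD)
qed (use S4 nS b in \<open>auto simp: baseD\<close>)

lemma ok_low:
  assumes b: "base s" and B: "matrix s ''bel'' (below n R T)"
  shows "ok S 20 p_low s (\<lambda>s'. \<forall>x<n. s' ''low'' x = of_bool (low n R T k x))"
  unfolding p_low_def
proof (rule ok_Fill[where g = "\<lambda>i. i" and h = "\<lambda>i. of_bool (low n R T k i)"], goal_cases)
  case (10 i s1)
  have b1: "base s1" using base_agree[OF b 10(3)] by simp
  have B1: "matrix s1 ''bel'' (below n R T)" using matrix_agree[OF B 10(3)] by simp
  have i: "i < n" using 10 b by (auto simp: baseD)
  have s1: "s1 ''a'' 0 = i" using 10 by auto
  show ?case
  proof (rule ok_SumUp[where h = "\<lambda>t. of_bool (below n R T t i)"], goal_cases)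
    case (9 t s2)
    have b2: "base s2" using base_agree[OF b1 9(3)] by simp
    have B2: "matrix s2 ''bel'' (below n R T)" using matrix_agree[OF B1 9(3)] by simp
    have t: "t < n" using 9 b1 by (simp add: baseD)
    have s2: "s2 ''a'' 0 = i" using 9 s1 by (simp add: agree_def)
    show ?case
      using s2 i t 9(2) S4 baseD[OF b2] matD[OF B2] by (intro ok_Skip) auto
  next
    case (10 s2)
    have b2: "base s2" using base_agree[OF b1 10(2)] by simp
    have "{t. t < n \<and> below n R T t i} = {t. below n R T t i}" by (auto simp: below_def)
    then have "s2 ''t1'' 0 = card {t. below n R T t i}"
      using 10 b1 by (simp add: baseD sum_of_bool_card)
    then show ?case using 10 s1 b2 by (auto simp: agree_def low_def)
  qed (use S4 nS b1 in \<open>auto simp: baseD\<close>)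
next
  case (11 s1) then show ?case using b by (simp add: baseD)
qed (use S4 nS b in \<open>auto simp: baseD\<close>)


lemma ok_cand:
  assumes b: "base s" and B: "matrix s ''bel'' (below n R T)"
    and low: "\<And>x. x < n \<Longrightarrow> s ''low'' x = of_bool (low n R T k x)"
  defines "cl \<equiv> filter (candidate n R T k) [0..<n]"
  shows "ok S 30 p_cand s (\<lambda>s'. s' ''m'' 0 = 4 + length cl \<and>
      (\<forall>p<length cl. s' ''cand'' (4 + p) = cl ! p))"
  unfolding p_cand_def
proof (rule ok_Seq)
  let ?t1 = "SumUp ''t1'' ''b'' Skip (Entry ''bel'' ''a'' ''b'')"
  let ?t3 = "SumUp ''t3'' ''b'' (SumUp ''t2'' ''c'' Skip (Sub (Entry ''bel'' ''a'' ''c'') (Entry ''adj'' ''b'' ''c''))) 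
    (Sub (Sub (At ''low'' ''b'') (Entry ''adj'' ''b'' ''a'')) (Sub (Var ''t2'') twok))"
  let ?e = "Add (At ''low'' ''a'') (Add (Sub (Const 1) (Sub (Var ''t1'') twok)) (Var ''t3''))"
  let ?add = "Seq (Assign ''cand'' (Var ''m'') (Var ''a'')) (SetVar ''m'' (Add (Var ''m'') (Const 1)))"
  define c where "c i = filter (candidate n R T k) [0..<i]" for i
  let ?I = "\<lambda>i s'. s' ''m'' 0 = 4 + length (c i) \<and> (\<forall>p<length (c i). s' ''cand'' (4 + p) = c i ! p)"
  show "ok S (30 - 1) (SetVar ''m'' (Const 4)) s (\<lambda>s'. ok S (30 - 1) (For ''a'' (Var ''n'')
     (Seq (?t1)
     (Seq (?t3)
     (Cond (?e)
        (?add)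
        Skip)))) s' (\<lambda>s'. s' ''m'' 0 = 4 + length cl \<and> (\<forall>p<length cl. s' ''cand'' (4 + p) = cl ! p)))"
  proof (rule ok_Assign, goal_cases)
    case 4
    define s0 where "s0 = s(''m'' := (s ''m'')(aval (Const 0) s := aval (Const 4) s))"
    have b0: "base s0" and B0: "matrix s0 ''bel'' (below n R T)" and low0: "s0 ''low'' = s ''low''"
      using b B by (simp_all add: s0_def base_def matrix_def)
    show ?case unfolding s0_def[symmetric]
    proof (rule ok_For[where N = n and Inv = ?I], goal_cases)
      case (10 i s1)
      have b1: "base s1" using base_agree[OF b0 10(4)] by simp
      have B1: "matrix s1 ''bel'' (below n R T)" using matrix_agree[OF B0 10(4)] by simp
      have low1: "s1 ''low'' = s ''low''" using 10(4) low0 by (simp add: agree_def)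
      have s1: "s1 ''a'' 0 = i" "i < n" using 10 by auto
      note I1 = 10(2)
      show ?case
      proof (rule ok_SeqI[where i = 12 and i' = 26])
        show "ok S 12 (?t1) s1
          (\<lambda>s'. s' ''t1'' 0 = card {y. below n R T i y})"
        proof (rule ok_SumUp[where h = "\<lambda>t. of_bool (below n R T i t)"], goal_cases)
          case (9 t s2)
          have b2: "base s2" using base_agree[OF b1 9(3)] by simp
          have B2: "matrix s2 ''bel'' (below n R T)" using matrix_agree[OF B1 9(3)] by simp
          have t: "t < n" using 9 b1 by (simp add: baseD)
          have s2: "s2 ''a'' 0 = i" using 9 s1 by (simp add: agree_def)
          show ?case
            using s2 s1 t 9(2) S4 baseD[OF b2] matD[OF B2] by (intro ok_Skip) auto
        next
          case (10 s2)
          have "{t. t < n \<and> below n R T i t} = {t. below n R T i t}" by (auto simp: below_def)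
          then show ?case using 10 b1 by (simp add: baseD sum_of_bool_card)
        qed (use S4 nS b1 in \<open>auto simp: baseD\<close>)
      next
        fix s2 assume t1: "s2 ''t1'' 0 = card {y. below n R T i y}"
          and a2: "agree (writes (?t1)) s1 s2"
        have b2: "base s2" using base_agree[OF b1 a2] by simp
        have B2: "matrix s2 ''bel'' (below n R T)" using matrix_agree[OF B1 a2] by simp
        have s2: "s2 ''a'' 0 = i" "s2 ''low'' = s ''low''" "s2 ''m'' = s1 ''m''"
            "s2 ''cand'' = s1 ''cand''"
          using a2 s1 low1 by (simp_all add: agree_def)
        define P where "P b \<longleftrightarrow> low n R T k b \<and> \<not> R b i \<and> card {y. below n R T i y \<and>
            \<not> R b y} \<le> 2 * k" for b
        show "ok S 26 (Seq (?t3)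
          (Cond (?e)
            (?add)
            Skip)) s2 (?I (Suc i))"
        proof (rule ok_SeqI[where i = 20 and i' = 20])
          show "ok S 20 (?t3) s2
            (\<lambda>s'. s' ''t3'' 0 = card {b. b < n \<and> P b})"
          proof (rule ok_SumUp[where h = "\<lambda>b. of_bool (P b)"], goal_cases)
            case (9 b s3)
            have b3: "base s3" using base_agree[OF b2 9(3)] by simp
            have B3: "matrix s3 ''bel'' (below n R T)" using matrix_agree[OF B2 9(3)] by simp
            have b: "b < n" using 9 b2 by (simp add: baseD)
            have s3: "s3 ''a'' 0 = i" "s3 ''b'' 0 = b" "s3 ''low'' = s ''low''"
              using 9 s2 by (simp_all add: agree_def)
            show ?case
            proof (rule ok_SumUp[where h = "\<lambda>y. of_bool (below n R T i y \<and> \<not> R b y)"], goal_cases)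
              case (9 y s4)
              have b4: "base s4" using base_agree[OF b3 9(3)] by simp
              have B4: "matrix s4 ''bel'' (below n R T)" using matrix_agree[OF B3 9(3)] by simp
              have y: "y < n" using 9 b3 by (simp add: baseD)
              have s4: "s4 ''a'' 0 = i" "s4 ''b'' 0 = b" "s4 ''c'' 0 = y"
                using 9 s3 by (simp_all add: agree_def)
              show ?case
                using s4 s1 b y S4 baseD[OF b4] matD[OF B4] matD[OF baseD(4)[OF b4]]
                by (intro ok_Skip) auto
            next
              case (10 s4)
              have b4: "base s4" using base_agree[OF b3 10(2)] by simp
              have s4: "s4 ''a'' 0 = i" "s4 ''b'' 0 = b" "s4 ''low'' = s ''low''"
                using 10 s3 by (simp_all add: agree_def)
              have "{y. y < n \<and> below n R T i y \<and> \<not> R b y} = {y. below n R T i y \<and> \<not> R b y}"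
                by (auto simp: below_def)
              then have "s4 ''t2'' 0 = card {y. below n R T i y \<and> \<not> R b y}"
                using 10 b3 by (simp add: baseD sum_of_bool_card)
              then show ?case using s4 s1 b low baseD[OF b4] matD[OF baseD(4)[OF b4]] b4
                by (auto simp: P_def)
            qed (use S4 nS b3 in \<open>auto simp: baseD\<close>)
          next
            case (10 s3) then show ?case using b2 by (simp add: baseD sum_of_bool_card)
          qed (use S4 nS b2 in \<open>auto simp: baseD\<close>)
        next
          fix s3 assume t3: "s3 ''t3'' 0 = card {b. b < n \<and> P b}"
            and a3: "agree (writes (?t3)) s2 s3"
          have b3: "base s3" using base_agree[OF b2 a3] by simp
          have s3: "s3 ''a'' 0 = i" "s3 ''low'' = s ''low''" "s3 ''m'' = s1 ''m''"
              "s3 ''cand'' = s1 ''cand''"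
              "s3 ''t1'' 0 = card {y. below n R T i y}"
            using a3 s2 t1 by (simp_all add: agree_def)
          have "card {b. b < n \<and> P b} = 0 \<longleftrightarrow> \<not> (\<exists>b<n. P b)" by auto
          then have e: "aval ?e s3 \<noteq> 0 \<longleftrightarrow> candidate n R T k i"
            using s3 t3 low[of i] s1 b3 by (auto simp: candidate_def P_def)
          show "ok S 20 (Cond ?e (?add)
            Skip) s3 (?I (Suc i))"
          proof (rule ok_Cond)
            assume "aval ?e s3 \<noteq> 0"
            then have "c (Suc i) = c i @ [i]" using e by (simp add: c_def)
            then show "ok S (20 - 1) (?add)
              s3 (?I (Suc i))"
              using s3 I1 S4 by (intro ok_Seq ok_Assign) (auto simp: nth_append less_Suc_eq)
          next
            assume "aval ?e s3 = 0"
            then have "c (Suc i) = c i" using e by (simp add: c_def)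
            then show "ok S (20 - 1) Skip s3 (?I (Suc i))"
              using s3 I1 S4 by (intro ok_Skip) auto
          qed (use S4 in auto)
        qed (use S4 in auto)
      qed (use S4 in auto)
    next
      case (9) then show ?case by (simp add: c_def s0_def)
    next
      case (11 s') then show ?case by (simp add: c_def cl_def)
    qed (use S4 nS b0 in \<open>auto simp: baseD\<close>)
  qed (use S4 in auto)
qed (use S4 in auto)

lemma ok_contract:
  assumes b: "base s" and Q: "matrix s ''cur'' Q" and uv: "s ''u'' 0 = u" "s ''v'' 0 = v" "u < n"
      "v < n"
  shows "ok S 14 p_contract s (\<lambda>s'. matrix s' ''cur'' (contr Q u v))"
  unfolding p_contract_def
proof (rule ok_SeqI[where i = 12 and i' = 12])
  let ?tmp = "MFill ''tmp'' ''a'' ''b'' Skip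
       (Sub (pos (Add (Entry ''cur'' ''a'' ''b'') (Add (both (eqv (Var ''a'') (Var ''u'')) (Entry ''cur'' ''v'' ''b''))
              (both (eqv (Var ''b'') (Var ''u'')) (Entry ''cur'' ''a'' ''v'')))))
          (Add (eqv (Var ''a'') (Var ''b'')) (Add (eqv (Var ''a'') (Var ''v'')) (eqv (Var ''b'') (Var ''v'')))))"
  show "ok S 12 ?tmp s
      (\<lambda>s'. matrix s' ''tmp'' (contr Q u v))"
  proof (rule ok_MFill[where h = "\<lambda>i j. of_bool (contr Q u v i j)"], goal_cases)
    case (9 i j s')
    have b': "base s'" using base_agree[OF b 9(5)] by simp
    have Q': "matrix s' ''cur'' Q" using matrix_agree[OF Q 9(5)] by simp
    have ij: "i < n" "j < n" using 9 b by (auto simp: baseD)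
    have "s' ''u'' 0 = u" "s' ''v'' 0 = v" using 9(5) uv by (simp_all add: agree_def)
    then show ?case using 9(3,4) uv(3,4) ij S4 baseD[OF b'] matD[OF Q']
      by (intro ok_Skip) (auto simp: contr_def both_def)
  next
    case (10 s') then show ?case using b by (auto simp: matrix_def baseD)
  qed (use S4 nS b in \<open>auto simp: baseD\<close>)
  fix s1 assume s1: "matrix s1 ''tmp'' (contr Q u v)" and a: "agree (writes ?tmp) s s1"
  have b1: "base s1" using base_agree[OF b a] by simp
  show "ok S 12 (MFill ''cur'' ''a'' ''b'' Skip (Entry ''tmp'' ''a'' ''b'')) s1 (\<lambda>s'. matrix s' ''cur'' (contr Q u v))"
  proof (rule ok_MFill[where h = "\<lambda>i j. of_bool (contr Q u v i j)"], goal_cases)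
    case (9 i j s')
    have b': "base s'" using base_agree[OF b1 9(5)] by simp
    have Q': "matrix s' ''tmp'' (contr Q u v)" using matrix_agree[OF s1 9(5)] by simp
    have ij: "i < n" "j < n" using 9 b1 by (auto simp: baseD)
    then show ?case using 9(3,4) S4 baseD[OF b'] matD[OF Q'] by (intro ok_Skip) auto
  next
    case (10 s') then show ?case using b1 by (auto simp: matrix_def baseD)
  qed (use S4 nS b1 in \<open>auto simp: baseD\<close>)
qed (use S4 in auto)

definition listed :: "nat list \<Rightarrow> memory \<Rightarrow> bool" where
  "listed cl s \<longleftrightarrow> (\<forall>p<length cl. s ''cand'' (4 + p) = cl ! p)"

lemma search_listed:
  assumes "\<forall>p. s' ''cand'' p = (if p < 4 then snd (search n Q) ! p else s ''cand'' p)" "listed cl s"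
  shows "listed cl s'" "\<And>x. x < 4 + length cl \<Longrightarrow> s' ''cand'' x = (snd (search n Q) @ cl) ! x"
proof -
  show "listed cl s'" using assms by (simp add: listed_def)
  fix x assume "x < 4 + length cl"
  then show "s' ''cand'' x = (snd (search n Q) @ cl) ! x"
    using assms(1) assms(2)[unfolded listed_def, rule_format, of "x - 4"] search_length[of n Q]
    by (auto simp: nth_append)
qed

lemma ok_step:
  assumes b: "base s" and Q: "matrix s ''cur'' Q" and cl: "listed cl s" "set cl \<subseteq> {..<n}"
    and xy: "s ''cert'' (s ''i'' 0 + s ''i'' 0) = x" "s ''cert'' (Suc (s ''i'' 0 + s ''i'' 0)) = y"
      "x < 4 + length cl" "y < 4 + length cl"
  shows "ok S 30 p_step s (\<lambda>s'. matrix s' ''cur'' (algstep n cl x y Q) \<and> listed cl s')"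
  unfolding p_step_def
proof (rule ok_SeqI[OF _ _ _ ok_search[OF b Q], where i' = 22])
  fix s1 assume s1: "s1 ''found'' 0 = fst (search n Q) \<and>
    (\<forall>p. s1 ''cand'' p = (if p < 4 then snd (search n Q) ! p else s ''cand'' p))" "agree (writes p_search) s s1"
  define l where "l = snd (search n Q) @ cl"
  define u v where "u = l ! x" and "v = l ! y"
  have l: "set l \<subseteq> {..<n}" "length l = 4 + length cl"
    using cl search_set[OF npos, of Q] search_length[of n Q] by (auto simp: l_def)
  have uvn: "u < n" "v < n" using subsetD[OF l(1) nth_mem[of x l]] subsetD[OF l(1) nth_mem[of y l]] xy(3,4) l(2)
    by (simp_all add: u_def v_def)
  have cd: "s1 ''cand'' x = u" "s1 ''cand'' y = v" "listed cl s1"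
    using search_listed[of s1 Q s cl] s1(1) cl(1) xy by (simp_all add: u_def v_def l_def)
  have b1: "base s1" using base_agree[OF b s1(2)] by simp
  have Q1: "matrix s1 ''cur'' Q" using matrix_agree[OF Q s1(2)] by simp
  have xy1: "s1 ''cert'' (s1 ''i'' 0 + s1 ''i'' 0) = x"
      "s1 ''cert'' (Suc (s1 ''i'' 0 + s1 ''i'' 0)) = y"
    using s1(2) xy by (simp_all add: agree_def)
  have main: "ok S j (Cond (Entry ''cur'' ''u'' ''v'') p_contract Skip) s2
      (\<lambda>s'. matrix s' ''cur'' (algstep n cl x y Q) \<and> listed cl s')"
    if s2: "s2 = s1(''u'' := (s1 ''u'')(0 := u), ''v'' := (s1 ''v'')(0 := v))" and j: "15 \<le> j"
        for s2 j
  proof -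
    have a2: "agree {''u'', ''v''} s1 s2" by (simp add: s2 agree_def)
    have b2: "base s2" using base_agree[OF b1 a2] by simp
    have Q2: "matrix s2 ''cur'' Q" using matrix_agree[OF Q1 a2] by simp
    have l2: "listed cl s2" using cd by (simp add: listed_def s2)
    have uv2: "s2 ''u'' 0 = u" "s2 ''v'' 0 = v" by (simp_all add: s2)
    have st: "algstep n cl x y Q = (if Q u v then contr Q u v else Q)"
      by (simp add: algstep_def u_def v_def l_def Let_def)
    have e: "aval (Entry ''cur'' ''u'' ''v'') s2 = of_bool (Q u v)"
      using aval_Entry[OF b2 Q2 uv2 uvn] .
    show ?thesis
    proof (rule ok_Cond)
      assume "aval (Entry ''cur'' ''u'' ''v'') s2 \<noteq> 0"
      then have "algstep n cl x y Q = contr Q u v" using e st by simp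
      then show "ok S (j - 1) p_contract s2 (\<lambda>s'. matrix s' ''cur'' (algstep n cl x y Q) \<and>
          listed cl s')"
        using ok_conseq[OF ok_contract[OF b2 Q2 uv2 uvn], of "j - 1"] j S4 l2
        by (auto simp: agree_def listed_def)
    next
      assume "aval (Entry ''cur'' ''u'' ''v'') s2 = 0"
      then have "algstep n cl x y Q = Q" using e st by simp
      then show "ok S (j - 1) Skip s2 (\<lambda>s'. matrix s' ''cur'' (algstep n cl x y Q) \<and> listed cl s')"
        using S4 j Q2 l2 by (intro ok_Skip) auto
    qed (use S4 j in auto)
  qed
  show "ok S 22 (Seq (SetVar ''u'' (Cell ''cand'' (Cell ''cert'' (Add (Var ''i'') (Var ''i'')))))
     (Seq (SetVar ''v'' (Cell ''cand'' (Cell ''cert'' (Add (Add (Var ''i'') (Var ''i'')) (Const 1)))))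
     (Cond (Entry ''cur'' ''u'' ''v'') p_contract Skip))) s1
     (\<lambda>s'. matrix s' ''cur'' (algstep n cl x y Q) \<and> listed cl s')"
    by (intro ok_Seq ok_Assign main) (use S4 xy1 cd in auto)
qed (use S4 in auto)

lemma ok_test:
  assumes b: "base s" and cl: "listed cl s" "set cl \<subseteq> {..<n}"
    and cert: "\<And>p. p < 2 * k \<Longrightarrow> s ''cert'' p < 4 + length cl"
  shows "ok S 36 p_test s (\<lambda>s'. listed cl s' \<and> s' ''answer'' 0 =
    (if fst (search n (simul n cl (s ''cert'') R k)) = 0 then 1 else s ''answer'' 0))"
  unfolding p_test_def
proof (rule ok_SeqI[OF _ _ _ ok_copy[OF b], where i' = 35])
  define d where "d = s ''cert''"
  fix s1 assume s1: "matrix s1 ''cur'' R" "agree (writes p_copy) s s1"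
  have b1: "base s1" using base_agree[OF b s1(2)] by simp
  have l1: "listed cl s1" "s1 ''cert'' = d" "s1 ''answer'' = s ''answer''"
    using s1(2) cl by (auto simp: agree_def listed_def d_def)
  show "ok S 35 (Seq (For ''i'' (Var ''k'') p_step) (Seq p_search (Cond (Var ''found'') Skip (SetVar ''answer'' (Const 1))))) s1
    (\<lambda>s'. listed cl s' \<and> s' ''answer'' 0 =
    (if fst (search n (simul n cl (s ''cert'') R k)) = 0 then 1 else s ''answer'' 0))"
  proof (rule ok_SeqI[where i = 32 and i' = 28])
    show "ok S 32 (For ''i'' (Var ''k'') p_step) s1 (\<lambda>s'. matrix s' ''cur'' (simul n cl d R k) \<and>
        listed cl s')"
    proof (rule ok_For[where N = k and Inv = "\<lambda>i s'. matrix s' ''cur'' (simul n cl d R i) \<and>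
        listed cl s'"], goal_cases)
      case (10 i s2)
      have b2: "base s2" using base_agree[OF b1 10(4)] by simp
      have c2: "s2 ''cert'' = d" using 10(4) l1 by (simp add: agree_def)
      show ?case
        unfolding simul.simps
      proof (rule ok_conseq[OF ok_step[OF b2, where cl = cl]])
        show "s2 ''cert'' (s2 ''i'' 0 + s2 ''i'' 0) = d (i + i)"
            "s2 ''cert'' (Suc (s2 ''i'' 0 + s2 ''i'' 0)) = d (Suc (i + i))"
          using c2 10 by simp_all
        show "d (i + i) < 4 + length cl" "d (Suc (i + i)) < 4 + length cl"
          using cert[of "i + i"] cert[of "Suc (i + i)"] 10(1) by (simp_all add: d_def)
        show "matrix s2 ''cur'' (simul n cl d R i)" using 10 by simp
      qed (use 10 cl S4 in auto)
    next
      case (8 i s' v) then show ?case by (simp add: matrix_def listed_def)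
    next
      case 9 then show ?case using s1 l1 by simp
    qed (use S4 kS b1 in \<open>auto simp: baseD\<close>)
  next
    fix s2 assume s2: "matrix s2 ''cur'' (simul n cl d R k) \<and> listed cl s2"
        "agree (writes (For ''i'' (Var ''k'') p_step)) s1 s2"
    have b2: "base s2" using base_agree[OF b1 s2(2)] by simp
    have a2: "s2 ''answer'' = s ''answer''" using s2(2) l1 by (simp add: agree_def)
    define Q where "Q = simul n cl d R k"
    show "ok S 28 (Seq p_search (Cond (Var ''found'') Skip (SetVar ''answer'' (Const 1)))) s2 (\<lambda>s'. listed cl s' \<and> s' ''answer'' 0 =
        (if fst (search n (simul n cl (s ''cert'') R k)) = 0 then 1 else s ''answer'' 0))"
      unfolding d_def[symmetric] Q_def[symmetric]
    proof (rule ok_SeqI[OF _ _ _ ok_search[OF b2], where i' = 8])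
      show "matrix s2 ''cur'' Q" using s2 by (simp add: Q_def)
      fix s3 assume s3: "s3 ''found'' 0 = fst (search n Q) \<and>
        (\<forall>p. s3 ''cand'' p = (if p < 4 then snd (search n Q) ! p else s2 ''cand'' p))" "agree (writes p_search) s2 s3"
      have a3: "s3 ''answer'' = s ''answer''" "listed cl s3"
        using s3 a2 s2 search_listed(1)[of s3 Q s2 cl] by (auto simp: agree_def)
      show "ok S 8 (Cond (Var ''found'') Skip (SetVar ''answer'' (Const 1))) s3
        (\<lambda>s'. listed cl s' \<and> s' ''answer'' 0 = (if fst (search n Q) = 0 then 1 else s ''answer'' 0))"
        by (intro ok_Cond ok_Skip ok_Assign) (use S4 s3 a3 in \<open>auto simp: listed_def\<close>)
    qed (use S4 in auto)
  qed (use S4 in auto)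
qed (use S4 in auto)

lemma ok_incr:
  assumes b: "base s" and m: "s ''m'' 0 = m" "\<And>p. p < 2 * k \<Longrightarrow> s ''cert'' p < m"
      and d: "s ''done'' 0 = 0"
  defines "val c \<equiv> (\<lambda>s::memory. \<Sum>p<c. s ''cert'' p * m ^ p)"
  shows "ok S 20 p_incr s (\<lambda>s'. (\<forall>p<2*k. s' ''cert'' p < m) \<and> s' ''done'' 0 \<le> 1 \<and>
     val (2 * k) s' + s' ''done'' 0 * m ^ (2 * k) = Suc (val (2 * k) s))"
  unfolding p_incr_def
proof (rule ok_SeqI[where i = 5 and i' = 19])
  let ?Q = "\<lambda>s'. (\<forall>p<2*k. s' ''cert'' p < m) \<and> s' ''done'' 0 \<le> 1 \<and>
    val (2 * k) s' + s' ''done'' 0 * m ^ (2 * k) = Suc (val (2 * k) s)"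
  \<comment> \<open>The digits below \<open>i\<close> have been processed: their value and the
    pending carry at weight \<open>m ^ i\<close> together exceed the old value by one.\<close>
  let ?I = "\<lambda>i s'. (\<forall>p<i. s' ''cert'' p < m) \<and> (\<forall>p\<ge>i. s' ''cert'' p = s ''cert'' p) \<and>
      s' ''carry'' 0 \<le> 1 \<and> s' ''done'' 0 = 0 \<and>
    val i s' + s' ''carry'' 0 * m ^ i = Suc (val i s)"
  let ?body = "Seq (Assign ''cert'' (Var ''i'') (Add (At ''cert'' ''i'') (Var ''carry'')))
    (Cond (neq (At ''cert'' ''i'') (Var ''m'')) (SetVar ''carry'' (Const 0)) (Assign ''cert'' (Var ''i'') (Const 0)))"
  show "ok S 5 (SetVar ''carry'' (Const 1)) s (\<lambda>s'. s' ''carry'' 0 = 1)"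
    using S4 by (intro ok_Assign) auto
  fix s1 assume s1: "s1 ''carry'' 0 = 1" "agree (writes (SetVar ''carry'' (Const 1))) s s1"
  have b1: "base s1" using base_agree[OF b s1(2)] by simp
  have e1: "s1 ''m'' 0 = m" "s1 ''cert'' = s ''cert''" "s1 ''done'' 0 = 0"
    using s1(2) m d by (simp_all add: agree_def)
  show "ok S 19 (Seq (For ''i'' twok
     (?body))
     (Cond (Var ''carry'') (SetVar ''done'' (Const 1)) Skip)) s1 ?Q"
  proof (rule ok_SeqI[where i = 12 and i' = 8])
    show "ok S 12 (For ''i'' twok
     (?body)) s1
      (\<lambda>s'. (\<forall>p<2*k. s' ''cert'' p < m) \<and> s' ''carry'' 0 \<le> 1 \<and> s' ''done'' 0 = 0 \<and>
        val (2 * k) s' + s' ''carry'' 0 * m ^ (2 * k) = Suc (val (2 * k) s))"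
    proof (rule ok_For[where N = "2 * k" and Inv = "?I"], goal_cases)
      case (10 i s2)
      have m2: "s2 ''m'' 0 = m" using 10(4) e1 by (simp add: agree_def)
      define x where "x = s ''cert'' i"
      define c where "c = s2 ''carry'' 0"
      have x: "s2 ''cert'' i = x" "x < m" using 10 m(2) by (auto simp: x_def)
      have c: "c = 0 \<or> c = 1" using 10 by (auto simp: c_def)
      have ih: "(\<Sum>p<i. s2 ''cert'' p * m ^ p) + c * m ^ i = Suc (\<Sum>p<i. s ''cert'' p * m ^ p)"
        using 10(2) by (simp add: val_def c_def)
      define z where "z = m ^ i"
      have A: "x + c \<noteq> m \<Longrightarrow> (\<Sum>p<i. s2 ''cert'' p * m ^ p) + (x + c) * z = Suc ((\<Sum>p<i. s ''cert'' p * m ^ p) + x * z)"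
        using ih by (simp add: algebra_simps z_def)
      have B: "c = 1 \<and> (\<Sum>p<i. s2 ''cert'' p * m ^ p) + m * z = Suc ((\<Sum>p<i. s ''cert'' p * m ^ p) + x * z)"
        if "x + c = m"
      proof -
        have "c = 1" using c x that by auto
        moreover have "m * z = x * z + c * z" using that by (metis add_mult_distrib)
        ultimately show ?thesis using ih by (simp add: z_def)
      qed
      have i0: "s2 ''i'' 0 = i" using 10 by simp
      have sumu: "(\<Sum>p<i. (if p = i then v else f p) * m ^ p) = (\<Sum>p<i. f p * m ^ p)"
          for v and f :: "nat \<Rightarrow> nat"
        by (intro sum.cong) auto
      show ?case
      proof (rule ok_Seq)
        show "ok S (12 - 2 - 1) (Assign ''cert'' (Var ''i'') (Add (At ''cert'' ''i'') (Var ''carry''))) s2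
          (\<lambda>s'. ok S (12 - 2 - 1) (Cond (neq (At ''cert'' ''i'') (Var ''m'')) (SetVar ''carry'' (Const 0))
             (Assign ''cert'' (Var ''i'') (Const 0))) s'
             (?I (Suc i)))"
        proof (rule ok_Assign, goal_cases)
          case 4
          define s3 where "s3 = s2(''cert'' := (s2 ''cert'')(aval (Var ''i'') s2 := aval (Add (At ''cert'' ''i'') (Var ''carry'')) s2))"
          have s3: "s3 ''cert'' = (s2 ''cert'')(i := x + c)" "s3 ''carry'' = s2 ''carry''"
              "s3 ''m'' 0 = m"
            "s3 ''i'' 0 = i" "s3 ''done'' 0 = 0"
            using i0 x m2 10(2) by (simp_all add: s3_def c_def)
          have t: "aval (neq (At ''cert'' ''i'') (Var ''m'')) s3 = 0 \<longleftrightarrow> x + c = m"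
            using s3 by (simp add: aval_neq)
          have xc: "x + c \<le> m" using x c by auto
          show ?case unfolding s3_def[symmetric]
          proof (rule ok_Cond)
            assume "aval (neq (At ''cert'' ''i'') (Var ''m'')) s3 \<noteq> 0"
            then have ne: "x + c \<noteq> m" using t by simp
            show "ok S (12 - 2 - 1 - 1) (SetVar ''carry'' (Const 0)) s3 (?I (Suc i))"
              using S4 10(2) s3 A[OF ne] ne xc
              by (intro ok_Assign) (simp_all add: val_def sumu z_def x_def less_Suc_eq)
          next
            assume "aval (neq (At ''cert'' ''i'') (Var ''m'')) s3 = 0"
            then have eq: "x + c = m" using t by simp
            show "ok S (12 - 2 - 1 - 1) (Assign ''cert'' (Var ''i'') (Const 0)) s3 (?I (Suc i))"
              using S4 10(2) s3 B[OF eq] x c_def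
              by (intro ok_Assign) (simp_all add: val_def sumu z_def x_def less_Suc_eq)
          qed (use S4 in auto)
        qed (use S4 in auto)
      qed (use S4 in auto)
    next
      case (8 i s' v) then show ?case by (simp add: val_def)
    next
      case 9 then show ?case using s1 e1 by (simp add: val_def)
    qed (use S4 kS b1 in \<open>auto simp: twok_def baseD\<close>)
  next
    fix s2 assume s2: "(\<forall>p<2*k. s2 ''cert'' p < m) \<and> s2 ''carry'' 0 \<le> 1 \<and> s2 ''done'' 0 = 0 \<and>
        val (2 * k) s2 + s2 ''carry'' 0 * m ^ (2 * k) = Suc (val (2 * k) s)"
    show "ok S 8 (Cond (Var ''carry'') (SetVar ''done'' (Const 1)) Skip) s2 ?Q"
    proof -
      consider "s2 ''carry'' 0 = 0" | "s2 ''carry'' 0 = 1" using s2 by linarith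
      then show ?thesis
      proof cases
        case 1
        then show ?thesis using S4 s2 by (intro ok_Cond ok_Skip ok_Assign) (simp_all add: val_def)
      next
        case 2
        then have "val (2 * k) s2 + m ^ (2 * k) = Suc (val (2 * k) s)" using s2 by simp
        then show ?thesis using S4 s2 2 by (intro ok_Cond ok_Skip ok_Assign) (simp_all add: val_def)
      qed
    qed
  qed (use S4 in auto)
qed (use S4 in auto)

end

section \<open>Numerals in base m and the loop over all certificates\<close>

lemma digit_sum_less:
  fixes m :: nat
  assumes "\<And>p. p < L \<Longrightarrow> c p < m"
  shows "(\<Sum>p<L. c p * m ^ p) < m ^ L"
  using assms
proof (induction L)
  case (Suc L)
  have "(\<Sum>p<L. c p * m ^ p) < m ^ L" using Suc by simp
  moreover have "Suc (c L) * m ^ L \<le> m * m ^ L" using Suc.prems[of L] by (intro mult_le_mono1) simp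
  ultimately show ?case by simp
qed simp

lemma digit_sum_inj:
  fixes m :: nat
  assumes "\<And>p. p < L \<Longrightarrow> c p < m" "\<And>p. p < L \<Longrightarrow> d p < m"
    and "(\<Sum>p<L. c p * m ^ p) = (\<Sum>p<L. d p * m ^ p)" "p < L"
  shows "c p = d p"
  using assms
proof (induction L)
  case (Suc L)
  define x y where "x = (\<Sum>p<L. c p * m ^ p)" and "y = (\<Sum>p<L. d p * m ^ p)"
  have xy: "x < m ^ L" "y < m ^ L"
    unfolding x_def y_def using Suc.prems(1,2) by (auto intro!: digit_sum_less)
  have eq: "x + c L * m ^ L = y + d L * m ^ L" using Suc.prems(3) by (simp add: x_def y_def)
  have dv: "(u + a * z) div z = a" if "u < z" for u a z :: nat using that by simp
  have cd: "c L = d L" using dv[OF xy(1), of "c L"] dv[OF xy(2), of "d L"] eq by simp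
  then have "x = y" using eq by simp
  then show ?case using Suc cd by (cases "p = L") (auto simp: x_def y_def less_Suc_eq)
qed simp

context machine begin

lemma ok_pre:
  assumes s: "s ''n'' 0 = n" "s ''k'' 0 = k" "matrix s ''adj'' R" "s ''row'' 0 = 0"
      "\<And>x. s ''mark'' x = 0"
  shows "ok S 40 p_pre s (\<lambda>s'. base s' \<and> s' ''m'' 0 = 4 + length (candidates n R k) \<and>
      listed (candidates n R k) s')"
  unfolding p_pre_def
proof (rule ok_SeqI[OF _ _ _ ok_row, where i' = 39])
  let ?Q = "\<lambda>s'. base s' \<and> s' ''m'' 0 = 4 + length (candidates n R k) \<and> listed (candidates n R k) s'"
  fix s1 assume s1: "\<forall>i<n. s1 ''row'' i = i * n" "agree (writes p_row) s s1"
  have b1: "base s1" using s s1 unfolding base_def by (simp add: agree_def matrix_def)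
  have m1: "s1 ''mark'' = s ''mark''" using s1(2) by (simp add: agree_def)
  show "ok S 39 (Seq p_nonsimp (Seq p_key (Seq p_pack (Seq p_below (Seq p_low p_cand))))) s1 ?Q"
  proof (rule ok_SeqI[OF _ _ _ ok_nonsimp[OF b1], where i' = 38])
    fix s2 assume s2: "\<forall>i<n. s2 ''nons'' i = of_bool (nonsimp R i)" "agree (writes p_nonsimp) s1 s2"
    have b2: "base s2" using base_agree[OF b1 s2(2)] by simp
    have m2: "s2 ''mark'' = s ''mark''" using s2(2) m1 by (simp add: agree_def)
    show "ok S 38 (Seq p_key (Seq p_pack (Seq p_below (Seq p_low p_cand)))) s2 ?Q"
    proof (rule ok_SeqI[OF _ _ _ ok_key[OF b2], where i' = 37])
      fix s3 assume s3: "\<forall>i<n. s3 ''key'' i = key n R i" "agree (writes p_key) s2 s3"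
      have b3: "base s3" using base_agree[OF b2 s3(2)] by simp
      have m3: "s3 ''mark'' = s ''mark''" "s3 ''nons'' = s2 ''nons''" using s3(2) m2
          by (simp_all add: agree_def)
      show "ok S 37 (Seq p_pack (Seq p_below (Seq p_low p_cand))) s3 ?Q"
      proof (rule ok_SeqI[OF _ _ _ ok_pack[OF b3], where i' = 36])
        define T where "T = packing n R (2 * k + 1)"
        fix s4 assume s4: "\<forall>x<n. s4 ''mark'' x = of_bool (x \<in> packing n R (2 * k + 1))"
            "agree (writes p_pack) s3 s4"
        have b4: "base s4" using base_agree[OF b3 s4(2)] by simp
        have m4: "s4 ''nons'' = s2 ''nons''" "s4 ''key'' = s3 ''key''" using s4(2) m3
            by (simp_all add: agree_def)
        show "ok S 36 (Seq p_below (Seq p_low p_cand)) s4 ?Q"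
        proof (rule ok_SeqI[OF _ _ _ ok_below[OF b4, of T], where i' = 35])
          fix s5 assume s5: "matrix s5 ''bel'' (below n R T)" "agree (writes p_below) s4 s5"
          have b5: "base s5" using base_agree[OF b4 s5(2)] by simp
          show "ok S 35 (Seq p_low p_cand) s5 ?Q"
          proof (rule ok_SeqI[OF _ _ _ ok_low[OF b5 s5(1)], where i' = 34])
            fix s6 assume s6: "\<forall>x<n. s6 ''low'' x = of_bool (low n R T k x)"
                "agree (writes p_low) s5 s6"
            have b6: "base s6" using base_agree[OF b5 s6(2)] by simp
            have B6: "matrix s6 ''bel'' (below n R T)" using matrix_agree[OF s5(1) s6(2)] by simp
            show "ok S 34 p_cand s6 ?Q"
            proof (rule ok_conseq[OF ok_cand[OF b6 B6]])
              fix s7 assume "s7 ''m'' 0 = 4 + length (filter (candidate n R T k) [0..<n]) \<and>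
                (\<forall>p<length (filter (candidate n R T k) [0..<n]). s7 ''cand'' (4 + p) = filter (candidate n R T k) [0..<n] ! p)"
                and a7: "agree (writes p_cand) s6 s7"
              moreover have "base s7" using base_agree[OF b6 a7] by simp
              ultimately show "base s7 \<and> s7 ''m'' 0 = 4 + length (candidates n R k) \<and>
                  listed (candidates n R k) s7"
                by (simp add: candidates_def T_def listed_def)
            qed (use S4 s6 in auto)
          qed (use S4 in auto)
        qed (use S4 s2 s3 s4 m4 in \<open>auto simp: T_def\<close>)
      qed (use S4 m3 s in auto)
    qed (use S4 in auto)
  qed (use S4 in auto)
qed (use S4 s in auto)

definition accepting :: "(nat \<Rightarrow> nat) \<Rightarrow> bool" where
  "accepting d \<longleftrightarrow> fst (search n (simul n (candidates n R k) d R k)) = 0"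

definition cval :: "(nat \<Rightarrow> nat) \<Rightarrow> nat" where
  "cval d = (\<Sum>p<2*k. d p * (4 + length (candidates n R k)) ^ p)"

lemma accepting_cong: "(\<And>p. p < 2 * k \<Longrightarrow> c p = d p) \<Longrightarrow> accepting c = accepting d"
  unfolding accepting_def by (subst simul_cong[of k c d]) auto

text \<open>\<open>N\<close> is the number of certificates tested so far and also the value of the
  current one. The last increment wraps the counter around, so at the end only the flag
  \<open>done\<close> can be described.\<close>

definition loop_inv :: "nat \<Rightarrow> memory \<Rightarrow> bool" where
  "loop_inv N s \<longleftrightarrow> (let m = 4 + length (candidates n R k) in
     base s \<and> s ''m'' 0 = m \<and> listed (candidates n R k) s \<and> (\<forall>p<2*k. s ''cert'' p < m) \<and>
     s ''answer'' 0 = of_bool (\<exists>d. (\<forall>p. d p < m) \<and> cval d < N \<and> accepting d) \<and>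
     (N < m ^ (2 * k) \<and> s ''done'' 0 = 0 \<and> cval (s ''cert'') = N \<or> N = m ^ (2 * k) \<and>
         s ''done'' 0 = 1))"

lemma loop_step:
  assumes I: "loop_inv N s" and N: "N < (4 + length (candidates n R k)) ^ (2 * k)"
  shows "ok S 38 (Seq p_test p_incr) s (loop_inv (Suc N))"
proof -
  define cl where "cl = candidates n R k"
  define m where "m = 4 + length cl"
  have b: "base s" "s ''m'' 0 = m" "listed cl s" "s ''done'' 0 = 0" "cval (s ''cert'') = N"
    and cert: "\<And>p. p < 2 * k \<Longrightarrow> s ''cert'' p < m"
    and ans: "s ''answer'' 0 = of_bool (\<exists>d. (\<forall>p. d p < m) \<and> cval d < N \<and> accepting d)"
    using I N by (auto simp: loop_inv_def cl_def m_def Let_def)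
  have cl: "set cl \<subseteq> {..<n}" by (auto simp: cl_def candidates_def)
  have new: "(\<exists>d. (\<forall>p. d p < m) \<and> cval d < Suc N \<and> accepting d) \<longleftrightarrow>
      (\<exists>d. (\<forall>p. d p < m) \<and> cval d < N \<and> accepting d) \<or> accepting (s ''cert'')"
  proof
    assume "\<exists>d. (\<forall>p. d p < m) \<and> cval d < Suc N \<and> accepting d"
    then obtain d where d: "\<forall>p. d p < m" "cval d < Suc N" "accepting d" by blast
    show "(\<exists>d. (\<forall>p. d p < m) \<and> cval d < N \<and> accepting d) \<or> accepting (s ''cert'')"
    proof (cases "cval d = N")
      case True
      \<comment> \<open>Numerals are unique, so a certificate of value \<open>N\<close> agrees with
        the one in memory on all digits that matter.\<close>
      have "d p = s ''cert'' p" if "p < 2 * k" for p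
      proof (rule digit_sum_inj[OF _ _ _ that])
        show "(\<Sum>p<2 * k. d p * m ^ p) = (\<Sum>p<2 * k. s ''cert'' p * m ^ p)"
          using True b(5) by (simp add: cval_def m_def cl_def)
      qed (use d cert in auto)
      then show ?thesis using accepting_cong[of d "s ''cert''"] d(3) by blast
    next
      case False
      then have "cval d < N" using d(2) by simp
      then show ?thesis using d by blast
    qed
  next
    assume "(\<exists>d. (\<forall>p. d p < m) \<and> cval d < N \<and> accepting d) \<or> accepting (s ''cert'')"
    then show "\<exists>d. (\<forall>p. d p < m) \<and> cval d < Suc N \<and> accepting d"
    proof
      assume g: "accepting (s ''cert'')"
      \<comment> \<open>The invariant says nothing about cells beyond the \<open>2 * k\<close>
        digits, so the certificate is padded with zeros.\<close>
      define d where "d p = (if p < 2 * k then s ''cert'' p else 0)" for p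
      have "accepting d" using g accepting_cong[of d "s ''cert''"] by (simp add: d_def)
      moreover have "cval d = N" unfolding b(5)[symmetric] cval_def
          by (intro sum.cong) (auto simp: d_def)
      moreover have "\<forall>p. d p < m" using cert by (auto simp: d_def m_def)
      ultimately show ?thesis by (intro exI[of _ d]) simp
    next
      assume "\<exists>d. (\<forall>p. d p < m) \<and> cval d < N \<and> accepting d"
      then show ?thesis by (meson less_Suc_eq)
    qed
  qed
  show ?thesis
  proof (rule ok_SeqI[OF _ _ _ ok_test[OF b(1,3) cl], where i' = 20])
    fix s1 assume s1: "listed cl s1 \<and> s1 ''answer'' 0 =
      (if fst (search n (simul n cl (s ''cert'') R k)) = 0 then 1 else s ''answer'' 0)" "agree (writes p_test) s s1"
    have b1: "base s1" using base_agree[OF b(1) s1(2)] by simp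
    have e1: "s1 ''m'' 0 = m" "s1 ''done'' 0 = 0" "s1 ''cert'' = s ''cert''"
      using s1(2) b by (simp_all add: agree_def)
    have "s1 ''answer'' 0 = (if accepting (s ''cert'') then 1 else s ''answer'' 0)"
      using s1(1) by (simp add: accepting_def cl_def)
    then have a1: "s1 ''answer'' 0 = of_bool (\<exists>d. (\<forall>p. d p < m) \<and> cval d < Suc N \<and> accepting d)"
      unfolding new ans by simp
    show "ok S 20 p_incr s1 (loop_inv (Suc N))"
    proof (rule ok_conseq[OF ok_incr[OF b1 e1(1) _ e1(2)]])
      fix p assume "p < 2 * k" then show "s1 ''cert'' p < m" using e1 cert by simp
    next
      fix s2 assume s2: "(\<forall>p<2*k. s2 ''cert'' p < m) \<and> s2 ''done'' 0 \<le> 1 \<and>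
          (\<Sum>p<2*k. s2 ''cert'' p * m ^ p) + s2 ''done'' 0 * m ^ (2 * k) = Suc (\<Sum>p<2*k. s1 ''cert'' p * m ^ p)"
        "agree (writes p_incr) s1 s2"
      have b2: "base s2" using base_agree[OF b1 s2(2)] by simp
      have e2: "s2 ''m'' 0 = m" "listed cl s2" "s2 ''answer'' 0 = s1 ''answer'' 0"
        using s2(2) e1 s1(1) by (simp_all add: agree_def listed_def)
      have v: "cval (s2 ''cert'') + s2 ''done'' 0 * m ^ (2 * k) = Suc N"
        using s2(1) b(5) e1(3) by (simp add: cval_def m_def cl_def)
      have lt: "cval (s2 ''cert'') < m ^ (2 * k)"
        using digit_sum_less[of "2 * k" "s2 ''cert''" m] s2(1) by (simp add: cval_def m_def cl_def)
      have Nm: "N < m ^ (2 * k)" using N by (simp add: m_def cl_def)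
      have "s2 ''done'' 0 = 0 \<or> s2 ''done'' 0 = 1" using s2(1) by linarith
      then have "Suc N < m ^ (2 * k) \<and> s2 ''done'' 0 = 0 \<and> cval (s2 ''cert'') = Suc N \<or>
          Suc N = m ^ (2 * k) \<and> s2 ''done'' 0 = 1"
        using v lt Nm by auto
      then show "loop_inv (Suc N) s2"
        using b2 e2 a1 s2(1) unfolding loop_inv_def m_def cl_def Let_def by simp
    qed (use S4 in auto)
  qed (use S4 cert in \<open>auto simp: m_def\<close>)
qed

text \<open>Preprocessing costs at most \<open>S ^ 40\<close> and the loop body at most
  \<open>S ^ 38\<close> in each of the \<open>m ^ (2 * k)\<close> rounds. One more factor
  \<open>S\<close> absorbs the sum and the constant overheads.\<close>

lemma run_main:
  assumes s: "s ''n'' 0 = n" "s ''k'' 0 = k" "matrix s ''adj'' R" "s ''row'' 0 = 0"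
      "\<And>x. s ''mark'' x = 0"
    "\<And>x. s ''cert'' x = 0" "s ''done'' 0 = 0" "s ''answer'' 0 = 0"
  defines "m \<equiv> 4 + length (candidates n R k)"
  shows "\<exists>t s'. run p_main s t s' \<and> s' ''answer'' 0 = of_bool (\<exists>d. (\<forall>p. d p < m) \<and> accepting d) \<and>
    t \<le> m ^ (2 * k) * S ^ 41"
proof -
  define M where "M = m ^ (2 * k)"
  have M1: "1 \<le> M" by (simp add: M_def m_def)
  obtain t1 s1 where r1: "run p_pre s t1 s1" "t1 \<le> S ^ 40" "base s1" "s1 ''m'' 0 = m"
      "listed (candidates n R k) s1"
    using ok_pre[OF s(1-5)] by (auto simp: ok_def m_def)
  have "agree (writes p_pre) s s1" using run_agree r1(1) by blast
  then have e1: "s1 ''cert'' = s ''cert''" "s1 ''done'' 0 = 0" "s1 ''answer'' 0 = 0"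
    using s by (simp_all add: agree_def p_pre_def)
  have I0: "loop_inv 0 s1"
    using r1 e1 s M1 unfolding loop_inv_def Let_def by (simp add: m_def cval_def)
  obtain t2 s2 where r2: "run (While (Sub (Const 1) (Var ''done'')) (Seq p_test p_incr)) s1 t2 s2"
    "t2 \<le> M * (5 + S ^ 38) + 5" "loop_inv M s2"
  proof -
    have "\<exists>t s'. run (While (Sub (Const 1) (Var ''done'')) (Seq p_test p_incr)) s1 t s' \<and>
        t \<le> (M - 0) * (1 + acost (Sub (Const 1) (Var ''done'')) + S ^ 38) + (1 + acost (Sub (Const 1) (Var ''done''))) \<and>
        loop_inv M s'"
    proof (rule run_While_count[where Inv = loop_inv])
      fix i s assume i: "loop_inv i s" "i < M"
      then have "s ''done'' 0 = 0" by (auto simp: loop_inv_def Let_def M_def m_def)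
      then show "aval (Sub (Const 1) (Var ''done'')) s \<noteq> 0 \<and>
        (\<exists>t s'. run (Seq p_test p_incr) s t s' \<and> t \<le> S ^ 38 \<and> loop_inv (Suc i) s')"
        using loop_step[of i s] i by (auto simp: ok_def M_def m_def)
    next
      fix s assume "loop_inv M s"
      then have "s ''done'' 0 = 1" by (auto simp: loop_inv_def Let_def M_def m_def)
      then show "aval (Sub (Const 1) (Var ''done'')) s = 0" by simp
    qed (use I0 in auto)
    then obtain t s' where "run (While (Sub (Const 1) (Var ''done'')) (Seq p_test p_incr)) s1 t s'"
      "t \<le> M * (5 + S ^ 38) + 5" "loop_inv M s'" by (auto simp: algebra_simps)
    then show thesis by (rule that)
  qed
  have run: "run p_main s (1 + acost (Var ''n'') + (t1 + t2)) s2"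
    unfolding p_main_def using s npos by (intro run_Cond_true run_Seq[OF r1(1) r2(1)]) simp
  have ans: "s2 ''answer'' 0 = of_bool (\<exists>d. (\<forall>p. d p < m) \<and> accepting d)"
  proof -
    have "cval d < M" if "\<forall>p. d p < m" for d
      using digit_sum_less[of "2 * k" d m] that by (simp add: cval_def M_def m_def)
    then have "(\<exists>d. (\<forall>p. d p < m) \<and> cval d < M \<and> accepting d) \<longleftrightarrow> (\<exists>d. (\<forall>p. d p < m) \<and> accepting d)"
        by blast
    then show ?thesis using r2(3) by (simp add: loop_inv_def Let_def m_def)
  qed
  have "S ^ 38 \<le> S ^ 40" using S4 by (intro power_increasing) auto
  moreover have "13 \<le> S ^ 40" using power4_5[OF S4, of 40] by simp
  ultimately have "1 + acost (Var ''n'') + (t1 + t2) \<le> 13 + S ^ 40 + M * (5 + S ^ 38) - 5"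
    using r1(2) r2(2) by simp
  also have "\<dots> \<le> M * (8 + S ^ 40) + M * (5 + S ^ 38)"
  proof -
    have "8 + S ^ 40 \<le> M * (8 + S ^ 40)" using mult_le_mono1[OF M1, of "8 + S ^ 40"] by simp
    then show ?thesis by linarith
  qed
  also have "\<dots> = M * (13 + S ^ 40 + S ^ 38)" by (simp add: algebra_simps)
  also have "\<dots> \<le> M * (4 * S ^ 40)"
    using \<open>S ^ 38 \<le> S ^ 40\<close> \<open>13 \<le> S ^ 40\<close> by (intro mult_le_mono2) linarith
  also have "\<dots> \<le> M * (S * S ^ 40)" using S4 by (intro mult_le_mono2 mult_le_mono1) auto
  also have "S * S ^ 40 = S ^ 41" by (simp flip: power_Suc)
  finally show ?thesis using run ans unfolding M_def by blast
qed

end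

text \<open>Origin of 191: \<open>m ^ (2 * k)\<close> contributes \<open>34 * 2 = 68\<close> to the
  coefficient of \<open>k ^ 2\<close>. The parameter \<open>n + 2 * k + 4\<close> is at most
  \<open>max 1 n * 2 ^ (3 * k)\<close>, whose power 41 contributes the exponent
  \<open>123 * k\<close>, at most \<open>123 * k ^ 2\<close>.\<close>

lemma time_bound:
  fixes n k m :: nat
  assumes "0 < k" "m \<le> 2 ^ (34 * k)"
  shows "real (m ^ (2 * k) * (n + 2 * k + 4) ^ 41) \<le> 2 powr (191 * real k ^ 2) * real (max 1 n) ^ 41"
proof -
  have "2 * k + 5 \<le> 2 ^ (3 * k)"
  proof -
    have "k < 2 ^ k" by (rule less_exp)
    then have "k + 1 \<le> 2 ^ k" by linarith
    then have "(k + 1) ^ 3 \<le> (2 ^ k) ^ 3" by (intro power_mono) auto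
    also have "\<dots> = 2 ^ (3 * k)" by (simp flip: power_mult add: mult.commute)
    finally have "(k + 1) ^ 3 \<le> 2 ^ (3 * k)" .
    moreover have "2 * k + 5 \<le> (k + 1) ^ 3"
      using assms(1) by (cases k) (auto simp: power3_eq_cube algebra_simps)
    ultimately show ?thesis by linarith
  qed
  moreover have "n + 2 * k + 4 \<le> max 1 n * (2 * k + 5)"
    by (cases n) (auto simp: algebra_simps)
  ultimately have "n + 2 * k + 4 \<le> max 1 n * 2 ^ (3 * k)"
    by (meson le_trans mult_le_mono2)
  then have "(n + 2 * k + 4) ^ 41 \<le> (max 1 n * 2 ^ (3 * k)) ^ 41" by (rule power_mono) simp
  moreover have "m ^ (2 * k) \<le> (2 ^ (34 * k)) ^ (2 * k)" using assms(2) by (intro power_mono) auto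
  ultimately have "m ^ (2 * k) * (n + 2 * k + 4) ^ 41 \<le> (2 ^ (34 * k)) ^ (2 * k) * (max 1 n * 2 ^ (3 * k)) ^ 41"
    by (rule mult_le_mono[rotated])
  also have "\<dots> = 2 ^ (34 * k * (2 * k) + 3 * k * 41) * max 1 n ^ 41"
    by (simp only: power_mult_distrib power_mult[symmetric] power_add mult.assoc mult.commute mult.left_commute)
  also have "\<dots> \<le> 2 ^ (191 * k ^ 2) * max 1 n ^ 41"
  proof -
    have "34 * k * (2 * k) + 3 * k * 41 \<le> 191 * k ^ 2"
      using assms(1) by (cases k) (auto simp: power2_eq_square algebra_simps)
    then show ?thesis by (intro mult_le_mono1 power_increasing) auto
  qed
  finally have "real (m ^ (2 * k) * (n + 2 * k + 4) ^ 41) \<le> real (2 ^ (191 * k ^ 2) * max 1 n ^ 41)"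
    by (simp only: of_nat_le_iff)
  also have "\<dots> = 2 powr (191 * real k ^ 2) * real (max 1 n) ^ 41"
    using powr_realpow[of 2 "191 * k ^ 2"] by simp
  finally show ?thesis .
qed

theorem theorem4p6:
  shows "\<exists>(P :: com) (f :: nat \<Rightarrow> real) (d :: nat).
    f \<in> O(\<lambda>k. real k ^ 2) \<and>
    (\<forall>(n :: nat) (E :: nat set set) (k :: nat).
       simple_graph ({0..<n}, E) \<and> split_graph ({0..<n}, E) \<and> 0 < k \<longrightarrow>
       (\<exists>t s. run P (encode n E k) t s \<and>
              answer s = of_bool (threshold_contractible ({0..<n}, E) k) \<and>
              real t \<le> 2 powr f k * real (max 1 n) ^ d))"
proof (rule exI[of _ p_main], rule exI[of _ "\<lambda>k. 191 * real k ^ 2"], rule exI[of _ 41], intro conjI allI impI)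
  show "(\<lambda>k. 191 * real k ^ 2) \<in> O(\<lambda>k. real k ^ 2)" by simp
  fix n :: nat and E :: "nat set set" and k :: nat
  assume a: "simple_graph ({0..<n}, E) \<and> split_graph ({0..<n}, E) \<and> 0 < k"
  show "\<exists>t s. run p_main (encode n E k) t s \<and>
              answer s = of_bool (threshold_contractible ({0..<n}, E) k) \<and>
              real t \<le> 2 powr (191 * real k ^ 2) * real (max 1 n) ^ 41"
  proof (cases "n = 0")
    case True
    have E: "E = {}" using simple_graphD(1,2)[of n E] a True by fastforce
    have "threshold_graph ({0..<n}, E)"
      unfolding threshold_graph_def using True E
      by (auto simp: indep_def intro!: exI[of _ "\<lambda>_. 0"] exI[of _ 0])
    then have "threshold_contractible ({0..<n}, E) k"
      unfolding threshold_contractible_def by (intro exI[of _ 0]) auto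
    moreover define s0 where "s0 = encode n E k"
    moreover define s where "s = s0(''answer'' := (s0 ''answer'')(aval (Const 0) s0 := aval (Const 1) s0))"
    moreover have "run p_main s0 (1 + acost (Var ''n'') + (1 + acost (Const 0) + acost (Const 1))) s"
      unfolding p_main_def s_def
      by (intro run_Cond_false run_Assign) (simp add: s0_def encode_def True)
    then have "run p_main s0 6 s" by (simp add: eval_nat_numeral)
    moreover have "real 6 \<le> 2 powr (191 * real k ^ 2) * real (max 1 n) ^ 41"
    proof -
      have "1 \<le> real k" using a by simp
      then have "1 \<le> real k ^ 2" by simp
      then have "(2::real) powr 3 \<le> 2 powr (191 * real k ^ 2)" by (intro powr_mono) auto
      then show ?thesis using True by simp
    qed
    ultimately show ?thesis by (intro exI[of _ 6] exI[of _ s]) (simp add: answer_def)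
  next
    case False
    define R where "R = adjr n E"
    define m where "m = 4 + length (candidates n R k)"
    interpret machine n k R "n + 2 * k + 4"
      by standard (use False simple_graphD(3)[of n E] a in \<open>auto simp: R_def adjr_def\<close>)
    have adj: "matrix (encode n E k) ''adj'' R"
      unfolding matrix_def
    proof (intro allI impI)
      fix i j assume ij: "i < n" "j < n"
      have "(\<exists>i'<n. \<exists>j'<n. i * n + j = i' * n + j' \<and> {i', j'} \<in> E) \<longleftrightarrow> {i, j} \<in> E"
        using matrix_index_eq[OF ij] ij by blast
      then show "encode n E k ''adj'' (i * n + j) = of_bool (R i j)"
        by (simp add: encode_def R_def adjr_def)
    qed
    have init: "encode n E k ''n'' 0 = n" "encode n E k ''k'' 0 = k" "encode n E k ''row'' 0 = 0"
      "encode n E k ''mark'' x = 0" "encode n E k ''cert'' x = 0" "encode n E k ''done'' 0 = 0"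
      "encode n E k ''answer'' 0 = 0" for x
      by (simp_all add: encode_def)
    obtain t s where r: "run p_main (encode n E k) t s"
      "s ''answer'' 0 = of_bool (\<exists>d. (\<forall>p. d p < m) \<and> accepting d)"
          "t \<le> m ^ (2 * k) * (n + 2 * k + 4) ^ 41"
      using run_main[OF init(1,2) adj init(3-7)] unfolding m_def by blast
    have "(\<exists>d. (\<forall>p. d p < m) \<and> accepting d) \<longleftrightarrow> threshold_contractible ({0..<n}, E) k"
      unfolding accepting_def unfolding m_def R_def
      by (rule abstract_correct[symmetric]) (use a in simp_all)
    moreover have "real t \<le> 2 powr (191 * real k ^ 2) * real (max 1 n) ^ 41"
    proof -
      have "m \<le> 2 ^ (34 * k)" using length_candidates[of k n R] a by (simp add: m_def)
      then have "real (m ^ (2 * k) * (n + 2 * k + 4) ^ 41) \<le> 2 powr (191 * real k ^ 2) * real (max 1 n) ^ 41"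
        using a by (intro time_bound) simp_all
      moreover have "real t \<le> real (m ^ (2 * k) * (n + 2 * k + 4) ^ 41)" using r(3)
          by (simp only: of_nat_le_iff)
      ultimately show ?thesis by (rule order_trans[rotated])
    qed
    ultimately show ?thesis using r(1,2) by (intro exI[of _ t] exI[of _ s]) (simp add: answer_def)
  qed
qed

end
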